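(* There exist finitely generated, residually torsion-free-nilpotent groups $N$ and $\Gamma$, together with an injective homomorphism $N\hookrightarrow\Gamma$, such that $N$ and $\Gamma$ have the same nilpotent genus and the same profinite completion, but $\Gamma$ is finitely presented while $H_2(N,\mathbb{Q})$ is infinite dimensional over $\mathbb{Q}$.
   Context: A group $G$ is residually torsion-free-nilpotent if for each $1\neq g\in G$ there is a homomorphism $\phi$ from $G$ to a torsion-free nilpotent group with $\phi(g)\neq 1$. The lower central series of $G$ is defined by $G_1=G$ and $G_{n+1}=\langle [x,y] : x\in G_n,\ y\in G\rangle$. Two residually nilpotent groups $G$ and $\Lambda$ have the same nilpotent genus if $G/G_c\cong\Lambda/\Lambda_c$ for all $c\ge 1$. The profinite completion $\widehat{G}$ is the inverse limit of the finite quotients of $G$; two groups have the same profinite completion if their profinite completions are isomorphic. Homology is with trivial coefficients. *)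

theory Defs
  imports
    "HOL-Algebra.AbelCoset"
    "HOL-Algebra.Generated_Groups"
    "HOL-Algebra.Product_Groups"
    "HOL-Library.Poly_Mapping"
    "HOL-Analysis.Function_Topology"
    "Jordan_Normal_Form.VS_Connect"
begin

section \<open>Lower central series and residual properties\<close>

text \<open>Indexed so that \<open>lower_central G 1\<close> is the whole group; the value at \<open>0\<close> is a dummy.\<close>

primrec lower_central :: "('a, 'b) monoid_scheme \<Rightarrow> nat \<Rightarrow> 'a set" where
  "lower_central G 0 = carrier G"
| "lower_central G (Suc n) =
     (if n = 0 then carrier G
      else generate G (\<Union>x\<in>lower_central G n. \<Union>y\<in>carrier G.
             {x \<otimes>\<^bsub>G\<^esub> y \<otimes>\<^bsub>G\<^esub> inv\<^bsub>G\<^esub> x \<otimes>\<^bsub>G\<^esub> inv\<^bsub>G\<^esub> y}))"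

definition nilpotent_group :: "('a, 'b) monoid_scheme \<Rightarrow> bool" where
  "nilpotent_group G \<longleftrightarrow> group G \<and> (\<exists>c. lower_central G (Suc c) = {\<one>\<^bsub>G\<^esub>})"

definition torsion_free_group :: "('a, 'b) monoid_scheme \<Rightarrow> bool" where
  "torsion_free_group G \<longleftrightarrow>
     group G \<and> (\<forall>x\<in>carrier G. x \<noteq> \<one>\<^bsub>G\<^esub> \<longrightarrow> (\<forall>n::nat. 0 < n \<longrightarrow> x [^]\<^bsub>G\<^esub> n \<noteq> \<one>\<^bsub>G\<^esub>))"

text \<open>The target groups live on \<open>'a set\<close>, the type of the quotients of \<open>G\<close>. For the two properties
  below this is no restriction on the targets: see \<open>residually_nilpotentI\<close> and
  \<open>residually_torsion_free_nilpotentI\<close>.\<close>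

definition residually :: "('a set monoid \<Rightarrow> bool) \<Rightarrow> ('a, 'b) monoid_scheme \<Rightarrow> bool" where
  "residually P G \<longleftrightarrow> group G \<and>
     (\<forall>g\<in>carrier G. g \<noteq> \<one>\<^bsub>G\<^esub> \<longrightarrow>
        (\<exists>H \<phi>. group H \<and> P H \<and> \<phi> \<in> hom G H \<and> \<phi> g \<noteq> \<one>\<^bsub>H\<^esub>))"

definition residually_nilpotent :: "('a, 'b) monoid_scheme \<Rightarrow> bool" where
  "residually_nilpotent = residually nilpotent_group"

definition residually_torsion_free_nilpotent :: "('a, 'b) monoid_scheme \<Rightarrow> bool" where
  "residually_torsion_free_nilpotent =
     residually (\<lambda>H. torsion_free_group H \<and> nilpotent_group H)"

definition same_nilpotent_genus ::
  "('a, 'c) monoid_scheme \<Rightarrow> ('b, 'd) monoid_scheme \<Rightarrow> bool" where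
  "same_nilpotent_genus G L \<longleftrightarrow>
     residually_nilpotent G \<and> residually_nilpotent L \<and>
     (\<forall>c\<ge>1. (G Mod lower_central G c) \<cong> (L Mod lower_central L c))"

lemma (in group) lower_central_normal: "lower_central G n \<lhd> G"
proof (induction n)
  case 0
  show ?case by (simp add: normal_self)
next
  case (Suc n)
  interpret N: normal "lower_central G n" G by (rule Suc)
  let ?S = "\<Union>x\<in>lower_central G n. \<Union>y\<in>carrier G. {x \<otimes> y \<otimes> inv x \<otimes> inv y}"
  have "generate G ?S \<lhd> G"
  proof (rule normal_generateI)
    show "?S \<subseteq> carrier G"
      using N.subset by auto
    fix h g assume "h \<in> ?S" and g: "g \<in> carrier G"
    then obtain x y where x: "x \<in> lower_central G n" and y: "y \<in> carrier G"
      and h: "h = x \<otimes> y \<otimes> inv x \<otimes> inv y" by auto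
    have xc: "x \<in> carrier G" using x N.subset by auto
    have cancel: "inv g \<otimes> (g \<otimes> z) = z" if "z \<in> carrier G" for z
      using that g by (simp add: m_assoc[symmetric])
    have "g \<otimes> x \<otimes> inv g \<in> lower_central G n"
      using N.inv_op_closed2[OF g x] .
    moreover have "g \<otimes> y \<otimes> inv g \<in> carrier G" using g y by simp
    moreover have "g \<otimes> h \<otimes> inv g = (g \<otimes> x \<otimes> inv g) \<otimes> (g \<otimes> y \<otimes> inv g)
        \<otimes> inv (g \<otimes> x \<otimes> inv g) \<otimes> inv (g \<otimes> y \<otimes> inv g)"
      using g xc y by (simp add: h inv_mult_group m_assoc cancel)
    ultimately show "g \<otimes> h \<otimes> inv g \<in> ?S" by blast
  qed
  then show ?case by (simp add: normal_self)
qed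

lemma (in group_hom) lower_central_image:
  "h ` lower_central G n \<subseteq> lower_central H n"
proof (induction n)
  case (Suc n)
  let ?S = "\<Union>x\<in>lower_central G n. \<Union>y\<in>carrier G.
    {x \<otimes>\<^bsub>G\<^esub> y \<otimes>\<^bsub>G\<^esub> inv\<^bsub>G\<^esub> x \<otimes>\<^bsub>G\<^esub> inv\<^bsub>G\<^esub> y}"
  let ?T = "\<Union>x\<in>lower_central H n. \<Union>y\<in>carrier H.
    {x \<otimes>\<^bsub>H\<^esub> y \<otimes>\<^bsub>H\<^esub> inv\<^bsub>H\<^esub> x \<otimes>\<^bsub>H\<^esub> inv\<^bsub>H\<^esub> y}"
  have sub: "lower_central G n \<subseteq> carrier G"
    using G.lower_central_normal normal_imp_subgroup subgroup.subset by blast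
  have subH: "lower_central H n \<subseteq> carrier H"
    using H.lower_central_normal normal_imp_subgroup subgroup.subset by blast
  have S: "?S \<subseteq> carrier G" using sub by auto
  have "h ` ?S \<subseteq> ?T"
  proof
    fix z assume "z \<in> h ` ?S"
    then obtain x y where x: "x \<in> lower_central G n" and y: "y \<in> carrier G"
      and z: "z = h (x \<otimes>\<^bsub>G\<^esub> y \<otimes>\<^bsub>G\<^esub> inv\<^bsub>G\<^esub> x \<otimes>\<^bsub>G\<^esub> inv\<^bsub>G\<^esub> y)" by auto
    have "z = h x \<otimes>\<^bsub>H\<^esub> h y \<otimes>\<^bsub>H\<^esub> inv\<^bsub>H\<^esub> h x \<otimes>\<^bsub>H\<^esub> inv\<^bsub>H\<^esub> h y"
      using x y sub by (auto simp: z)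
    moreover have "h x \<in> lower_central H n" using Suc x by auto
    ultimately show "z \<in> ?T" using y by (intro UN_I[of "h x"] UN_I[of "h y"]) simp_all
  qed
  then have "generate H (h ` ?S) \<subseteq> generate H ?T"
    by (rule H.mono_generate)
  then have "h ` generate G ?S \<subseteq> generate H ?T"
    by (simp only: generate_img[OF S])
  then show ?case
    by (cases "n = 0") (simp_all add: image_subset_iff)
qed (simp add: image_subset_iff)

lemma nilpotent_group_mon:
  assumes "group G" "nilpotent_group H" "h \<in> mon G H"
  shows "nilpotent_group G"
proof -
  interpret group_hom G H h
    using assms by (auto simp: group_hom_def group_hom_axioms_def nilpotent_group_def mon_def)
  obtain c where c: "lower_central H (Suc c) = {\<one>\<^bsub>H\<^esub>}"
    using assms(2) by (auto simp: nilpotent_group_def)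
  have sg: "subgroup (lower_central G (Suc c)) G"
    using G.lower_central_normal normal_imp_subgroup by blast
  have "lower_central G (Suc c) \<subseteq> {\<one>\<^bsub>G\<^esub>}"
  proof
    fix x assume x: "x \<in> lower_central G (Suc c)"
    then have "h x \<in> {\<one>\<^bsub>H\<^esub>}" using lower_central_image[of "Suc c"] c by blast
    then have "h x = h \<one>\<^bsub>G\<^esub>" by simp
    moreover have "x \<in> carrier G" using x sg subgroup.subset by blast
    ultimately have "x = \<one>\<^bsub>G\<^esub>" using assms(3) by (simp add: mon_def inj_on_def)
    then show "x \<in> {\<one>\<^bsub>G\<^esub>}" by simp
  qed
  then have "lower_central G (Suc c) = {\<one>\<^bsub>G\<^esub>}"
    using subgroup.one_closed[OF sg] by (intro equalityI) simp_all
  then show ?thesis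
    unfolding nilpotent_group_def using assms(1) by (intro conjI exI[of _ c])
qed

lemma torsion_free_group_mon:
  assumes "group G" "torsion_free_group H" "h \<in> mon G H"
  shows "torsion_free_group G"
proof -
  interpret group_hom G H h
    using assms by (auto simp: group_hom_def group_hom_axioms_def torsion_free_group_def mon_def)
  have inj: "inj_on h (carrier G)" using assms(3) by (simp add: mon_def)
  have "x [^]\<^bsub>G\<^esub> n \<noteq> \<one>\<^bsub>G\<^esub>" if "x \<in> carrier G" "x \<noteq> \<one>\<^bsub>G\<^esub>" "0 < n" for x and n :: nat
  proof
    assume "x [^]\<^bsub>G\<^esub> n = \<one>\<^bsub>G\<^esub>"
    then have "h x [^]\<^bsub>H\<^esub> n = \<one>\<^bsub>H\<^esub>" using that hom_nat_pow[of x n] by simp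
    moreover have "h x \<noteq> \<one>\<^bsub>H\<^esub>"
      using inj_on_eq_iff[OF inj that(1) G.one_closed] that(2) by simp
    ultimately show False using assms(2) that by (auto simp: torsion_free_group_def)
  qed
  then show ?thesis using assms(1) by (simp add: torsion_free_group_def)
qed

lemma residually_via_quotient:
  assumes G: "group G"
    and ex: "\<And>g. g \<in> carrier G \<Longrightarrow> g \<noteq> \<one>\<^bsub>G\<^esub> \<Longrightarrow>
      \<exists>(H :: 'c monoid) \<phi>. group H \<and> Q H \<and> \<phi> \<in> hom G H \<and> \<phi> g \<noteq> \<one>\<^bsub>H\<^esub>"
    and mon: "\<And>(K :: 'a set monoid) (H :: 'c monoid) f. group K \<Longrightarrow> Q H \<Longrightarrow> f \<in> mon K H \<Longrightarrow> P K"
  shows "residually P (G :: ('a, 'b) monoid_scheme)"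
  unfolding residually_def
proof (intro conjI G ballI impI)
  fix g assume g: "g \<in> carrier G" "g \<noteq> \<one>\<^bsub>G\<^esub>"
  obtain H :: "'c monoid" and \<phi>
    where H: "group H" "Q H" and \<phi>: "\<phi> \<in> hom G H" "\<phi> g \<noteq> \<one>\<^bsub>H\<^esub>"
    using ex[OF g] by blast
  interpret group_hom G H \<phi>
    using G H \<phi> by (simp add: group_hom_def group_hom_axioms_def)
  interpret N: normal "kernel G H \<phi>" G by (rule normal_kernel)
  let ?K = "G Mod kernel G H \<phi>"
  let ?\<pi> = "\<lambda>x. kernel G H \<phi> #>\<^bsub>G\<^esub> x"
  have K: "group ?K" by (rule N.factorgroup_is_group)
  have "(\<lambda>X. the_elem (\<phi> ` X)) \<in> mon ?K H"
    unfolding mon_def using FactGroup_hom FactGroup_inj_on by simp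
  then have P: "P ?K" by (rule mon[OF K H(2)])
  have hom: "?\<pi> \<in> hom G ?K" by (rule N.r_coset_hom_Mod)
  have "g \<notin> kernel G H \<phi>" using \<phi>(2) unfolding kernel_def by blast
  moreover have "g \<in> ?\<pi> g" by (rule G.rcos_self[OF g(1) N.subgroup_axioms])
  ultimately have ne: "?\<pi> g \<noteq> \<one>\<^bsub>?K\<^esub>" unfolding one_FactGroup by metis
  show "\<exists>(H :: 'a set monoid) \<phi>. group H \<and> P H \<and> \<phi> \<in> hom G H \<and> \<phi> g \<noteq> \<one>\<^bsub>H\<^esub>"
    by (rule exI[of _ ?K], rule exI[of _ ?\<pi>], intro conjI K P hom ne)
qed

lemma residually_nilpotentI:
  assumes "group G"
    and "\<And>g. g \<in> carrier G \<Longrightarrow> g \<noteq> \<one>\<^bsub>G\<^esub> \<Longrightarrow>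
      \<exists>(H :: 'c monoid) \<phi>. nilpotent_group H \<and> \<phi> \<in> hom G H \<and> \<phi> g \<noteq> \<one>\<^bsub>H\<^esub>"
  shows "residually_nilpotent (G :: ('a, 'b) monoid_scheme)"
  unfolding residually_nilpotent_def
proof (rule residually_via_quotient[where Q = "nilpotent_group :: 'c monoid \<Rightarrow> bool"])
  fix g assume "g \<in> carrier G" "g \<noteq> \<one>\<^bsub>G\<^esub>"
  then show "\<exists>(H :: 'c monoid) \<phi>. group H \<and> nilpotent_group H \<and> \<phi> \<in> hom G H \<and> \<phi> g \<noteq> \<one>\<^bsub>H\<^esub>"
    using assms(2) nilpotent_group_def by metis
next
  fix K :: "'a set monoid" and H :: "'c monoid" and f
  assume "group K" "nilpotent_group H" "f \<in> mon K H"
  then show "nilpotent_group K" by (rule nilpotent_group_mon)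
qed (fact assms(1))

lemma residually_torsion_free_nilpotentI:
  assumes "group G"
    and "\<And>g. g \<in> carrier G \<Longrightarrow> g \<noteq> \<one>\<^bsub>G\<^esub> \<Longrightarrow>
      \<exists>(H :: 'c monoid) \<phi>. torsion_free_group H \<and> nilpotent_group H \<and> \<phi> \<in> hom G H \<and> \<phi> g \<noteq> \<one>\<^bsub>H\<^esub>"
  shows "residually_torsion_free_nilpotent (G :: ('a, 'b) monoid_scheme)"
  unfolding residually_torsion_free_nilpotent_def
proof (rule residually_via_quotient[where
      Q = "\<lambda>H :: 'c monoid. torsion_free_group H \<and> nilpotent_group H"])
  fix g assume "g \<in> carrier G" "g \<noteq> \<one>\<^bsub>G\<^esub>"
  then show "\<exists>(H :: 'c monoid) \<phi>. group H \<and> (torsion_free_group H \<and> nilpotent_group H)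
      \<and> \<phi> \<in> hom G H \<and> \<phi> g \<noteq> \<one>\<^bsub>H\<^esub>"
    using assms(2) nilpotent_group_def by metis
next
  fix K :: "'a set monoid" and H :: "'c monoid" and f
  assume "group K" "torsion_free_group H \<and> nilpotent_group H" "f \<in> mon K H"
  then show "torsion_free_group K \<and> nilpotent_group K"
    using nilpotent_group_mon torsion_free_group_mon by metis
qed (fact assms(1))

section \<open>Finite generation and finite presentation\<close>

definition finitely_generated_group :: "('a, 'b) monoid_scheme \<Rightarrow> bool" where
  "finitely_generated_group G \<longleftrightarrow>
     group G \<and> (\<exists>S. finite S \<and> S \<subseteq> carrier G \<and> generate G S = carrier G)"

text \<open>A letter \<open>(x, True)\<close> stands for a generator \<open>x\<close> and \<open>(x, False)\<close> for its inverse.\<close>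

definition letter_inv :: "'x \<times> bool \<Rightarrow> 'x \<times> bool" where
  "letter_inv a = (fst a, \<not> snd a)"

fun reduced_word :: "('x \<times> bool) list \<Rightarrow> bool" where
  "reduced_word (a # b # w) \<longleftrightarrow> a \<noteq> letter_inv b \<and> reduced_word (b # w)"
| "reduced_word _ \<longleftrightarrow> True"

fun cons_letter :: "'x \<times> bool \<Rightarrow> ('x \<times> bool) list \<Rightarrow> ('x \<times> bool) list" where
  "cons_letter a [] = [a]"
| "cons_letter a (b # w) = (if a = letter_inv b then w else a # b # w)"

text \<open>The free group on \<open>X\<close> as the group of reduced words; the product concatenates and freely
  reduces.\<close>

definition free_group :: "'x set \<Rightarrow> ('x \<times> bool) list monoid" where
  "free_group X =
     \<lparr>carrier = {w. reduced_word w \<and> set w \<subseteq> X \<times> UNIV},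
      monoid.mult = foldr cons_letter,
      one = []\<rparr>"

definition normal_closure :: "('a, 'b) monoid_scheme \<Rightarrow> 'a set \<Rightarrow> 'a set" where
  "normal_closure G R = \<Inter> {K. K \<lhd> G \<and> R \<subseteq> K}"

definition finitely_presented_group :: "('a, 'b) monoid_scheme \<Rightarrow> bool" where
  "finitely_presented_group G \<longleftrightarrow>
     group G \<and>
     (\<exists>(X :: nat set) R. finite X \<and> finite R \<and> R \<subseteq> carrier (free_group X) \<and>
        (free_group X Mod normal_closure (free_group X) R) \<cong> G)"

lemma letter_inv_invol [simp]: "letter_inv (letter_inv a) = a"
  by (simp add: letter_inv_def)

lemma letter_inv_eq_iff [simp]: "letter_inv a = letter_inv b \<longleftrightarrow> a = b"
  by (auto simp: letter_inv_def prod_eq_iff)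

lemma reduced_word_tl: "reduced_word (a # w) \<Longrightarrow> reduced_word w"
  by (cases w) auto

lemma reduced_word_cons_letter: "reduced_word w \<Longrightarrow> reduced_word (cons_letter a w)"
  by (cases w) (auto dest: reduced_word_tl)

lemma set_cons_letter: "set (cons_letter a w) \<subseteq> insert a (set w)"
  by (cases w) auto

lemma cons_letter_inv: "reduced_word w \<Longrightarrow> cons_letter a (cons_letter (letter_inv a) w) = w"
  by (cases w rule: reduced_word.cases) auto

lemma cons_letter_inv': "reduced_word w \<Longrightarrow> cons_letter (letter_inv a) (cons_letter a w) = w"
  using cons_letter_inv[of w "letter_inv a"] by simp

lemma reduced_word_mult: "reduced_word v \<Longrightarrow> reduced_word (foldr cons_letter u v)"
  by (induction u) (auto intro: reduced_word_cons_letter)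

lemma set_mult_word: "set (foldr cons_letter u v) \<subseteq> set u \<union> set v"
proof (induction u)
  case (Cons a u)
  then show ?case using set_cons_letter[of a "foldr cons_letter u v"] by auto
qed simp

lemma mult_word_cons_letter:
  "reduced_word w \<Longrightarrow>
     foldr cons_letter (cons_letter a u) w = cons_letter a (foldr cons_letter u w)"
  by (cases u) (auto simp: cons_letter_inv cons_letter_inv' reduced_word_mult)

lemma mult_word_assoc:
  "reduced_word w \<Longrightarrow>
     foldr cons_letter (foldr cons_letter u v) w = foldr cons_letter u (foldr cons_letter v w)"
  by (induction u) (auto simp: mult_word_cons_letter)

lemma mult_word_Nil: "reduced_word u \<Longrightarrow> foldr cons_letter u [] = u"
  by (induction u rule: reduced_word.induct) auto

lemma foldr_cons_letter_reduced:
  "reduced_word w \<Longrightarrow> foldr cons_letter (rev (map letter_inv w)) w = []"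
proof (induction w)
  case (Cons a w)
  then show ?case using reduced_word_tl[of a w] by auto
qed simp

lemma mult_word_reduce:
  "reduced_word w \<Longrightarrow> foldr cons_letter (foldr cons_letter u []) w = foldr cons_letter u w"
  using mult_word_assoc[of w u "[]"] by simp

lemma group_free_group: "group (free_group X)"
proof (rule groupI)
  fix u v assume "u \<in> carrier (free_group X)" "v \<in> carrier (free_group X)"
  then show "u \<otimes>\<^bsub>free_group X\<^esub> v \<in> carrier (free_group X)"
    using set_mult_word[of u v] by (auto simp: free_group_def reduced_word_mult)
next
  fix w assume w: "w \<in> carrier (free_group X)"
  let ?v = "foldr cons_letter (rev (map letter_inv w)) []"
  have "set ?v \<subseteq> X \<times> UNIV"
    using w set_mult_word[of "rev (map letter_inv w)" "[]"]
    by (fastforce simp: free_group_def letter_inv_def)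
  then have "?v \<in> carrier (free_group X)"
    by (simp add: free_group_def reduced_word_mult)
  moreover have "?v \<otimes>\<^bsub>free_group X\<^esub> w = \<one>\<^bsub>free_group X\<^esub>"
    using w by (simp add: free_group_def mult_word_reduce foldr_cons_letter_reduced)
  ultimately show "\<exists>v\<in>carrier (free_group X). v \<otimes>\<^bsub>free_group X\<^esub> w = \<one>\<^bsub>free_group X\<^esub>"
    by blast
qed (auto simp: free_group_def mult_word_assoc)

section \<open>Profinite completion\<close>

definition finite_index_normals :: "('a, 'b) monoid_scheme \<Rightarrow> 'a set set" where
  "finite_index_normals G = {U. U \<lhd> G \<and> finite (rcosets\<^bsub>G\<^esub> U)}"

text \<open>The inverse limit of the finite quotients \<open>G Mod U\<close>. For \<open>U \<subseteq> V\<close> the canonical projection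
  \<open>G Mod U \<rightarrow> G Mod V\<close> is \<open>A \<mapsto> V <#> A\<close>.\<close>

definition profinite_completion :: "('a, 'b) monoid_scheme \<Rightarrow> ('a set \<Rightarrow> 'a set) monoid" where
  "profinite_completion G =
     (product_group (finite_index_normals G) (\<lambda>U. G Mod U))
       \<lparr>carrier :=
          {f \<in> \<Pi>\<^sub>E U\<in>finite_index_normals G. carrier (G Mod U).
             \<forall>U\<in>finite_index_normals G. \<forall>V\<in>finite_index_normals G.
               U \<subseteq> V \<longrightarrow> V <#>\<^bsub>G\<^esub> f U = f V}\<rparr>"

definition profinite_topology :: "('a, 'b) monoid_scheme \<Rightarrow> ('a set \<Rightarrow> 'a set) topology" where
  "profinite_topology G =
     subtopology
       (product_topology (\<lambda>U. discrete_topology (carrier (G Mod U))) (finite_index_normals G))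
       (carrier (profinite_completion G))"

text \<open>Isomorphism of profinite groups, that is, of topological groups.\<close>

definition same_profinite_completion ::
  "('a, 'c) monoid_scheme \<Rightarrow> ('b, 'd) monoid_scheme \<Rightarrow> bool" where
  "same_profinite_completion G L \<longleftrightarrow>
     (\<exists>\<phi>. \<phi> \<in> iso (profinite_completion G) (profinite_completion L) \<and>
          homeomorphic_map (profinite_topology G) (profinite_topology L) \<phi>)"

lemma group_profinite_completion:
  fixes G (structure)
  assumes "group G"
  shows "group (profinite_completion G)"
proof -
  interpret group G by fact
  let ?I = "finite_index_normals G"
  let ?P = "product_group ?I (\<lambda>U. G Mod U)"
  have N: "U \<lhd> G" if "U \<in> ?I" for U using that by (simp add: finite_index_normals_def)
  have grp: "group (G Mod U)" if "U \<in> ?I" for U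
    using N[OF that] by (rule normal.factorgroup_is_group)
  have P: "group ?P" by (rule product_group) (rule grp)
  have proj_coset: "V <#> (U #> x) = V #> x"
    if "U \<in> ?I" "V \<in> ?I" "U \<subseteq> V" "x \<in> carrier G" for U V x
  proof -
    interpret U: normal U G by (rule N[OF that(1)])
    interpret V: normal V G by (rule N[OF that(2)])
    have "V <#> U = V"
    proof
      show "V <#> U \<subseteq> V" using that(3) by (auto simp: set_mult_def)
      show "V \<subseteq> V <#> U"
      proof
        fix v assume v: "v \<in> V"
        then have "v = v \<otimes> \<one>" using V.subset by auto
        then show "v \<in> V <#> U" using v U.one_closed unfolding set_mult_def by blast
      qed
    qed
    then show ?thesis
      using setmult_rcos_assoc[OF V.subset U.subset that(4)] by simp
  qed
  have proj_mult: "V <#> (A <#> B) = (V <#> A) <#> (V <#> B)"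
    if UV: "U \<in> ?I" "V \<in> ?I" "U \<subseteq> V" and AB: "A \<in> carrier (G Mod U)" "B \<in> carrier (G Mod U)"
    for U V A B
  proof -
    interpret U: normal U G by (rule N[OF UV(1)])
    interpret V: normal V G by (rule N[OF UV(2)])
    obtain a b where a: "a \<in> carrier G" "A = U #> a" and b: "b \<in> carrier G" "B = U #> b"
      using AB by (auto simp: carrier_FactGroup)
    show ?thesis
      using UV a b by (simp add: U.rcos_sum V.rcos_sum proj_coset)
  qed
  have "subgroup (carrier (profinite_completion G)) ?P"
  proof (rule group.subgroupI[OF P])
    show "carrier (profinite_completion G) \<subseteq> carrier ?P"
      by (auto simp: profinite_completion_def)
    have "\<one>\<^bsub>?P\<^esub> \<in> carrier ?P" by (rule monoid.one_closed[OF group.is_monoid[OF P]])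
    moreover have "V <#> U = V" if UV: "U \<in> ?I" "V \<in> ?I" "U \<subseteq> V" for U V
      using proj_coset[OF UV one_closed] coset_mult_one N[OF UV(1)] N[OF UV(2)]
      by (simp add: normal_imp_subgroup subgroup.subset)
    ultimately have "\<one>\<^bsub>?P\<^esub> \<in> carrier (profinite_completion G)"
      by (simp add: profinite_completion_def)
    then show "carrier (profinite_completion G) \<noteq> {}" by blast
  next
    fix f assume f: "f \<in> carrier (profinite_completion G)"
    then have fP: "f \<in> (\<Pi>\<^sub>E U\<in>?I. carrier (G Mod U))" by (simp add: profinite_completion_def)
    have inv: "inv\<^bsub>?P\<^esub> f = (\<lambda>U\<in>?I. inv\<^bsub>G Mod U\<^esub> f U)"
      by (rule inv_product_group[OF fP grp])
    have "V <#> (inv\<^bsub>G Mod U\<^esub> f U) = inv\<^bsub>G Mod V\<^esub> f V"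
      if UV: "U \<in> ?I" "V \<in> ?I" "U \<subseteq> V" for U V
    proof -
      interpret U: normal U G by (rule N[OF UV(1)])
      interpret V: normal V G by (rule N[OF UV(2)])
      obtain a where a: "a \<in> carrier G" "f U = U #> a"
        using fP UV by (auto simp: carrier_FactGroup PiE_iff)
      have fV: "f V = V #> a"
        using f UV proj_coset[OF UV a(1)] a by (auto simp: profinite_completion_def)
      have "f U \<in> carrier (G Mod U)" "f V \<in> carrier (G Mod V)" using fP UV by auto
      then show ?thesis
        using UV a by (simp add: U.inv_FactGroup V.inv_FactGroup U.rcos_inv V.rcos_inv fV proj_coset)
    qed
    moreover have "inv\<^bsub>?P\<^esub> f \<in> carrier ?P"
      using group.inv_closed[OF P] fP by simp
    ultimately show "inv\<^bsub>?P\<^esub> f \<in> carrier (profinite_completion G)"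
      unfolding inv by (auto simp: profinite_completion_def)
  next
    fix f g assume f: "f \<in> carrier (profinite_completion G)"
      and g: "g \<in> carrier (profinite_completion G)"
    have fP: "f \<in> carrier ?P" and gP: "g \<in> carrier ?P"
      using f g by (auto simp: profinite_completion_def)
    have "f \<otimes>\<^bsub>?P\<^esub> g \<in> carrier ?P"
      using P fP gP by (rule monoid.m_closed[OF group.is_monoid])
    moreover have "V <#> (f U <#> g U) = f V <#> g V"
      if UV: "U \<in> ?I" "V \<in> ?I" "U \<subseteq> V" for U V
      using proj_mult[OF UV] f g UV by (auto simp: profinite_completion_def PiE_iff)
    ultimately show "f \<otimes>\<^bsub>?P\<^esub> g \<in> carrier (profinite_completion G)"
      by (auto simp: profinite_completion_def)
  qed
  from subgroup.subgroup_is_group[OF this P] show ?thesis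
    by (simp add: profinite_completion_def)
qed

section \<open>Rational group homology\<close>

text \<open>The scalar multiple \<open>r (W + x) = W + r x\<close>, written without choosing a representative.\<close>

definition quotient_module :: "('r, 'm, 'd) module_scheme \<Rightarrow> 'm set \<Rightarrow> ('r, 'm set) module" where
  "quotient_module M W =
     \<lparr>carrier = a_rcosets\<^bsub>M\<^esub> W,
      monoid.mult = undefined,
      one = undefined,
      zero = W,
      add = (\<lambda>A B. A <+>\<^bsub>M\<^esub> B),
      module.smult = (\<lambda>r A. \<Union>x\<in>A. W +>\<^bsub>M\<^esub> (r \<odot>\<^bsub>M\<^esub> x))\<rparr>"

text \<open>The bar complex with coefficients in the trivial module of rational numbers. The list
  \<open>[g1, ..., gn]\<close> is the basis element usually written \<open>[g1 | ... | gn]\<close>.\<close>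

definition bar_chains :: "('a, 'b) monoid_scheme \<Rightarrow> nat \<Rightarrow> (rat, 'a list \<Rightarrow>\<^sub>0 rat) module" where
  "bar_chains G n =
     \<lparr>carrier = {c. Poly_Mapping.keys c \<subseteq> {xs. length xs = n \<and> set xs \<subseteq> carrier G}},
      monoid.mult = undefined,
      one = undefined,
      zero = 0,
      add = (+),
      module.smult = (\<lambda>r. Poly_Mapping.map ((*) r))\<rparr>"

text \<open>For \<open>0 < i < n\<close> the face \<open>i\<close> of \<open>[g1, ..., gn]\<close> multiplies \<open>gi\<close> and the next entry; the faces
  \<open>0\<close> and \<open>n\<close> drop the first and the last entry (see the two lemmas after the definition).\<close>

definition bar_face :: "('a, 'b) monoid_scheme \<Rightarrow> nat \<Rightarrow> 'a list \<Rightarrow> 'a list" where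
  "bar_face G i xs =
     map (\<lambda>k. if Suc k < i then xs ! k
              else if Suc k = i then xs ! k \<otimes>\<^bsub>G\<^esub> xs ! Suc k
              else xs ! Suc k)
       [0..<length xs - 1]"

lemma bar_face_first: "bar_face G 0 xs = tl xs"
  by (rule nth_equalityI) (auto simp: bar_face_def nth_tl)

lemma bar_face_last: "bar_face G (length xs) xs = butlast xs"
  by (rule nth_equalityI) (auto simp: bar_face_def nth_butlast)

definition bar_boundary :: "('a, 'b) monoid_scheme \<Rightarrow> ('a list \<Rightarrow>\<^sub>0 rat) \<Rightarrow> ('a list \<Rightarrow>\<^sub>0 rat)" where
  "bar_boundary G c =
     (\<Sum>xs\<in>Poly_Mapping.keys c.
        if xs = [] then 0
        else \<Sum>i\<le>length xs.
          Poly_Mapping.single (bar_face G i xs) ((-1) ^ i * Poly_Mapping.lookup c xs))"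

definition bar_cycles :: "('a, 'b) monoid_scheme \<Rightarrow> nat \<Rightarrow> ('a list \<Rightarrow>\<^sub>0 rat) set" where
  "bar_cycles G n = {c \<in> carrier (bar_chains G n). bar_boundary G c = 0}"

definition bar_boundaries :: "('a, 'b) monoid_scheme \<Rightarrow> nat \<Rightarrow> ('a list \<Rightarrow>\<^sub>0 rat) set" where
  "bar_boundaries G n = bar_boundary G ` carrier (bar_chains G (Suc n))"

definition rational_homology ::
  "('a, 'b) monoid_scheme \<Rightarrow> nat \<Rightarrow> (rat, ('a list \<Rightarrow>\<^sub>0 rat) set) module" where
  "rational_homology G n =
     quotient_module ((bar_chains G n)\<lparr>carrier := bar_cycles G n\<rparr>) (bar_boundaries G n)"

lemma module_quotient_module:
  assumes "Module.module R M" and "submodule R W M"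
  shows "Module.module R (quotient_module M W)"
proof -
  interpret M: Module.module R M by fact
  interpret S: submodule R W M by fact
  have "additive_subgroup W M"
  proof (rule additive_subgroup.intro, rule group.subgroupI)
    show "group (add_monoid M)" by (rule M.a_group)
    show "W \<subseteq> carrier (add_monoid M)" using S.subset by simp
    show "W \<noteq> {}" using S.zero_closed by blast
    fix a assume a: "a \<in> W"
    have "(\<ominus>\<^bsub>R\<^esub> \<one>\<^bsub>R\<^esub>) \<odot>\<^bsub>M\<^esub> a \<in> W" using a by simp
    moreover have "(\<ominus>\<^bsub>R\<^esub> \<one>\<^bsub>R\<^esub>) \<odot>\<^bsub>M\<^esub> a = \<ominus>\<^bsub>M\<^esub> a"
      using a S.subset by (intro M.smult_minus_1) auto
    ultimately show "inv\<^bsub>add_monoid M\<^esub> a \<in> W" by (simp add: a_inv_def)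
  qed simp
  then interpret W: abelian_subgroup W M
    by (rule abelian_subgroupI3) (rule M.abelian_group_axioms)
  let ?Q = "quotient_module M W"
  have car: "A \<in> carrier ?Q \<longleftrightarrow> (\<exists>x\<in>carrier M. A = W +>\<^bsub>M\<^esub> x)" for A
    by (auto simp: quotient_module_def A_RCOSETS_def')
  have add: "(W +>\<^bsub>M\<^esub> x) \<oplus>\<^bsub>?Q\<^esub> (W +>\<^bsub>M\<^esub> y) = W +>\<^bsub>M\<^esub> (x \<oplus>\<^bsub>M\<^esub> y)"
    if "x \<in> carrier M" "y \<in> carrier M" for x y
    using that by (simp add: quotient_module_def W.a_rcos_sum)
  have smult: "r \<odot>\<^bsub>?Q\<^esub> (W +>\<^bsub>M\<^esub> x) = W +>\<^bsub>M\<^esub> (r \<odot>\<^bsub>M\<^esub> x)"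
    if r: "r \<in> carrier R" and x: "x \<in> carrier M" for r x
  proof -
    have "W +>\<^bsub>M\<^esub> (r \<odot>\<^bsub>M\<^esub> y) = W +>\<^bsub>M\<^esub> (r \<odot>\<^bsub>M\<^esub> x)" if y: "y \<in> W +>\<^bsub>M\<^esub> x" for y
    proof -
      obtain w where w: "w \<in> W" "y = w \<oplus>\<^bsub>M\<^esub> x"
        using y by (auto simp: a_r_coset_def')
      have "r \<odot>\<^bsub>M\<^esub> y = r \<odot>\<^bsub>M\<^esub> w \<oplus>\<^bsub>M\<^esub> r \<odot>\<^bsub>M\<^esub> x"
        using w r x S.subset by (auto intro: M.smult_r_distr)
      moreover have "r \<odot>\<^bsub>M\<^esub> w \<in> W" using w r by simp
      ultimately have "r \<odot>\<^bsub>M\<^esub> y \<in> W +>\<^bsub>M\<^esub> (r \<odot>\<^bsub>M\<^esub> x)"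
        by (auto simp: a_r_coset_def')
      then show ?thesis
        using W.a_repr_independence'[of "r \<odot>\<^bsub>M\<^esub> y" "r \<odot>\<^bsub>M\<^esub> x"] r x by simp
    qed
    moreover have "x \<in> W +>\<^bsub>M\<^esub> x" by (rule W.a_rcos_self) (rule x)
    ultimately have "(\<Union>y\<in>W +>\<^bsub>M\<^esub> x. W +>\<^bsub>M\<^esub> (r \<odot>\<^bsub>M\<^esub> y)) = W +>\<^bsub>M\<^esub> (r \<odot>\<^bsub>M\<^esub> x)"
      by (intro SUP_eq_const) blast
    then show ?thesis by (simp only: quotient_module_def module.simps)
  qed
  have zero: "\<zero>\<^bsub>?Q\<^esub> = W +>\<^bsub>M\<^esub> \<zero>\<^bsub>M\<^esub>"
    using M.a_coset_add_zero[OF S.subset] by (simp add: quotient_module_def)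
  have ag: "abelian_group ?Q"
  proof (rule abelian_groupI)
    fix A assume "A \<in> carrier ?Q"
    then obtain x where x: "x \<in> carrier M" "A = W +>\<^bsub>M\<^esub> x" unfolding car by blast
    then have "(W +>\<^bsub>M\<^esub> (\<ominus>\<^bsub>M\<^esub> x)) \<oplus>\<^bsub>?Q\<^esub> A = \<zero>\<^bsub>?Q\<^esub>"
      by (simp add: add zero M.l_neg)
    moreover have "W +>\<^bsub>M\<^esub> (\<ominus>\<^bsub>M\<^esub> x) \<in> carrier ?Q"
      unfolding car using x by blast
    ultimately show "\<exists>B\<in>carrier ?Q. B \<oplus>\<^bsub>?Q\<^esub> A = \<zero>\<^bsub>?Q\<^esub>" by (rule bexI)
  next
    fix A B assume "A \<in> carrier ?Q" "B \<in> carrier ?Q"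
    then show "A \<oplus>\<^bsub>?Q\<^esub> B \<in> carrier ?Q"
      unfolding car by (elim bexE) (simp only: add, blast intro: M.a_closed)
  next
    show "\<zero>\<^bsub>?Q\<^esub> \<in> carrier ?Q" unfolding car zero by blast
  qed (auto simp: car add zero M.a_ac)
  show ?thesis
  proof (rule moduleI[OF M.R.is_cring ag])
    fix a b A B assume "a \<in> carrier R" "b \<in> carrier R" "A \<in> carrier ?Q" "B \<in> carrier ?Q"
    then show "(a \<oplus>\<^bsub>R\<^esub> b) \<odot>\<^bsub>?Q\<^esub> A = (a \<odot>\<^bsub>?Q\<^esub> A) \<oplus>\<^bsub>?Q\<^esub> (b \<odot>\<^bsub>?Q\<^esub> A)"
      and "a \<odot>\<^bsub>?Q\<^esub> (A \<oplus>\<^bsub>?Q\<^esub> B) = (a \<odot>\<^bsub>?Q\<^esub> A) \<oplus>\<^bsub>?Q\<^esub> (a \<odot>\<^bsub>?Q\<^esub> B)"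
      by (auto simp: car smult add M.smult_l_distr M.smult_r_distr)
  qed (auto simp: car smult M.smult_assoc1)
qed

lemma lookup_scale [simp]:
  "Poly_Mapping.lookup (Poly_Mapping.map ((*) r) c) k = r * Poly_Mapping.lookup c k"
  for r :: rat
  by (simp add: Poly_Mapping.map.rep_eq when_def)

lemma keys_scale: "Poly_Mapping.keys (Poly_Mapping.map ((*) r) c) \<subseteq> Poly_Mapping.keys c"
  for r :: rat
  by (auto simp: in_keys_iff)

lemma scale_add:
  "Poly_Mapping.map ((*) r) (c + d) = Poly_Mapping.map ((*) r) c + Poly_Mapping.map ((*) r) d"
  for r :: rat
  by (rule poly_mapping_eqI) (simp add: lookup_add algebra_simps)

lemma scale_zero: "Poly_Mapping.map ((*) r) 0 = 0"
  for r :: rat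
  by (rule poly_mapping_eqI) simp

lemma scale_sum:
  "Poly_Mapping.map ((*) r) (sum f A) = (\<Sum>x\<in>A. Poly_Mapping.map ((*) r) (f x))"
  for r :: rat
  by (induction A rule: infinite_finite_induct) (simp_all add: scale_add scale_zero)

lemma scale_single:
  "Poly_Mapping.map ((*) r) (Poly_Mapping.single x q) = Poly_Mapping.single x (r * q)"
  for r :: rat
  by (rule poly_mapping_eqI) (simp add: lookup_single when_def)

lemma vectorspace_bar_chains: "vectorspace class_ring (bar_chains G n)"
proof -
  have "abelian_group (bar_chains G n)"
  proof (rule abelian_groupI)
    fix c assume c: "c \<in> carrier (bar_chains G n)"
    then have "- c \<in> carrier (bar_chains G n)" by (simp add: bar_chains_def)
    moreover have "- c \<oplus>\<^bsub>bar_chains G n\<^esub> c = \<zero>\<^bsub>bar_chains G n\<^esub>" by (simp add: bar_chains_def)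
    ultimately show "\<exists>d\<in>carrier (bar_chains G n). d \<oplus>\<^bsub>bar_chains G n\<^esub> c = \<zero>\<^bsub>bar_chains G n\<^esub>"
      by blast
  next
    fix c d assume "c \<in> carrier (bar_chains G n)" "d \<in> carrier (bar_chains G n)"
    then show "c \<oplus>\<^bsub>bar_chains G n\<^esub> d \<in> carrier (bar_chains G n)"
      using Poly_Mapping.keys_add[of c d] by (simp add: bar_chains_def) blast
  qed (auto simp: bar_chains_def algebra_simps)
  then have "Module.module class_ring (bar_chains G n)"
  proof (rule moduleI[OF class_cring.is_cring])
    fix r c assume "c \<in> carrier (bar_chains G n)"
    then show "r \<odot>\<^bsub>bar_chains G n\<^esub> c \<in> carrier (bar_chains G n)"
      using keys_scale[of r c] by (auto simp: bar_chains_def)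
  qed (auto simp: bar_chains_def scale_add intro!: poly_mapping_eqI simp: lookup_add algebra_simps)
  then show ?thesis by (simp add: vectorspace_def class_field)
qed

lemma bar_boundary_superset:
  assumes "finite S" "Poly_Mapping.keys c \<subseteq> S"
  shows "bar_boundary G c =
     (\<Sum>xs\<in>S. if xs = [] then 0
        else \<Sum>i\<le>length xs.
          Poly_Mapping.single (bar_face G i xs) ((-1) ^ i * Poly_Mapping.lookup c xs))"
  unfolding bar_boundary_def using assms
  by (intro sum.mono_neutral_left) (auto simp: in_keys_iff)

lemma bar_boundary_add: "bar_boundary G (c + d) = bar_boundary G c + bar_boundary G d"
proof -
  let ?S = "Poly_Mapping.keys c \<union> Poly_Mapping.keys d"
  have S: "finite ?S" "Poly_Mapping.keys c \<subseteq> ?S" "Poly_Mapping.keys d \<subseteq> ?S"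
    "Poly_Mapping.keys (c + d) \<subseteq> ?S"
    using Poly_Mapping.keys_add[of c d] by auto
  show ?thesis
    unfolding S(2-4)[THEN bar_boundary_superset[OF S(1)]]
    by (subst sum.distrib[symmetric], rule sum.cong)
      (auto simp: lookup_add distrib_left single_add sum.distrib)
qed

lemma bar_boundary_zero: "bar_boundary G 0 = 0"
  by (simp add: bar_boundary_def)

lemma bar_boundary_sum: "bar_boundary G (sum f A) = (\<Sum>x\<in>A. bar_boundary G (f x))"
  by (induction A rule: infinite_finite_induct) (simp_all add: bar_boundary_add bar_boundary_zero)

lemma bar_boundary_scale:
  "bar_boundary G (Poly_Mapping.map ((*) r) c) = Poly_Mapping.map ((*) r) (bar_boundary G c)"
  apply (subst bar_boundary_superset[OF finite_keys keys_scale])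
  apply (simp only: bar_boundary_def scale_sum)
  apply (rule sum.cong)
   apply (auto simp: scale_sum scale_zero scale_single mult.left_commute simp del: sum.atMost_Suc)
  done

lemma bar_boundary_single:
  "bar_boundary G (Poly_Mapping.single xs q) =
     (if xs = [] then 0
      else \<Sum>i\<le>length xs. Poly_Mapping.single (bar_face G i xs) ((-1) ^ i * q))"
  by (subst bar_boundary_superset[of "{xs}"]) auto

lemma length_bar_face [simp]: "length (bar_face G i xs) = length xs - 1"
  by (simp add: bar_face_def)

lemma bar_boundary_in_chains:
  assumes "group G" "c \<in> carrier (bar_chains G (Suc n))"
  shows "bar_boundary G c \<in> carrier (bar_chains G n)"
proof -
  interpret group G by fact
  have face: "set (bar_face G i xs) \<subseteq> carrier G" if "set xs \<subseteq> carrier G" for i xs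
  proof -
    have "xs ! k \<in> carrier G" if "k < length xs" for k
      using \<open>set xs \<subseteq> carrier G\<close> that by auto
    then show ?thesis by (auto simp: bar_face_def)
  qed
  have "Poly_Mapping.keys (if xs = [] then 0
        else \<Sum>i\<le>length xs.
          Poly_Mapping.single (bar_face G i xs) ((-1) ^ i * Poly_Mapping.lookup c xs))
      \<subseteq> {xs. length xs = n \<and> set xs \<subseteq> carrier G}" if "xs \<in> Poly_Mapping.keys c" for xs
  proof -
    have xs: "length xs = Suc n" "set xs \<subseteq> carrier G"
      using that assms(2) by (auto simp: bar_chains_def)
    have "Poly_Mapping.keys (\<Sum>i\<le>length xs.
        Poly_Mapping.single (bar_face G i xs) ((-1) ^ i * Poly_Mapping.lookup c xs))
      \<subseteq> (\<Union>i\<le>length xs. Poly_Mapping.keys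
        (Poly_Mapping.single (bar_face G i xs) ((-1) ^ i * Poly_Mapping.lookup c xs)))"
      by (rule keys_sum)
    also have "\<dots> \<subseteq> {xs. length xs = n \<and> set xs \<subseteq> carrier G}"
      using xs face[OF xs(2)] by (auto split: if_splits)
    finally show ?thesis using xs by auto
  qed
  then show ?thesis
    unfolding bar_boundary_def bar_chains_def
    using keys_sum by fastforce
qed

lemma bar_face_face:
  assumes "group G" "set xs \<subseteq> carrier G" "i \<le> j" "Suc j \<le> length xs"
  shows "bar_face G i (bar_face G (Suc j) xs) = bar_face G j (bar_face G i xs)"
proof (rule nth_equalityI)
  interpret group G by fact
  have xs: "xs ! k \<in> carrier G" if "k < length xs" for k using assms(2) that by auto
  fix k assume "k < length (bar_face G i (bar_face G (Suc j) xs))"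
  then have k: "k < length xs - 1 - 1" by simp
  have "xs ! k \<in> carrier G" "xs ! Suc k \<in> carrier G" "xs ! Suc (Suc k) \<in> carrier G"
    using k by (auto intro!: xs)
  then show "bar_face G i (bar_face G (Suc j) xs) ! k = bar_face G j (bar_face G i xs) ! k"
    using k assms(3) by (auto simp: bar_face_def m_assoc)
qed simp

lemma bar_boundary_boundary_single:
  assumes "group G" "set xs \<subseteq> carrier G"
  shows "bar_boundary G (bar_boundary G (Poly_Mapping.single xs q)) = 0"
proof (cases "length xs \<ge> 2")
  case False
  then have "xs = [] \<or> (\<exists>x. xs = [x])" by (cases xs; cases "tl xs") auto
  then show ?thesis
    by (auto simp: bar_boundary_single bar_boundary_sum bar_boundary_zero bar_face_def)
next
  case True
  define n where "n = length xs - 1"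
  have n: "length xs = Suc n" "n > 0" using True by (auto simp: n_def)
  have face_ne: "bar_face G i xs \<noteq> []" for i using n by (metis length_bar_face n_def length_0_conv not_gr0)
  define T where "T = (\<lambda>(i, j). Poly_Mapping.single (bar_face G j (bar_face G i xs)) ((-1) ^ (i + j) * q))"
  have "xs \<noteq> []" using n by auto
  then have "bar_boundary G (Poly_Mapping.single xs q) =
      (\<Sum>i\<le>Suc n. Poly_Mapping.single (bar_face G i xs) ((-1) ^ i * q))"
    unfolding bar_boundary_single n(1) by (simp only: if_False)
  then have "bar_boundary G (bar_boundary G (Poly_Mapping.single xs q)) =
      (\<Sum>i\<le>Suc n. bar_boundary G (Poly_Mapping.single (bar_face G i xs) ((-1) ^ i * q)))"
    by (simp only: bar_boundary_sum)
  also have "\<dots> = (\<Sum>i\<le>Suc n. \<Sum>j\<le>n. T (i, j))"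
  proof (rule sum.cong[OF refl])
    fix i
    have "length (bar_face G i xs) = n" by (simp add: n_def)
    then show "bar_boundary G (Poly_Mapping.single (bar_face G i xs) ((-1) ^ i * q)) = (\<Sum>j\<le>n. T (i, j))"
      using face_ne[of i] by (simp add: bar_boundary_single T_def power_add mult_ac)
  qed
  also have "\<dots> = (\<Sum>p\<in>{..Suc n} \<times> {..n}. T p)"
    by (simp add: sum.cartesian_product)
  also have "{..Suc n} \<times> {..n} = {(i, j). i \<le> j \<and> j \<le> n} \<union> (\<lambda>(i, j). (Suc j, i)) ` {(i, j). i \<le> j \<and> j \<le> n}"
    (is "_ = ?A \<union> ?h ` ?A")
  proof -
    have "(i, j) \<in> ?A \<union> ?h ` ?A" if "i \<le> Suc n" "j \<le> n" for i j
    proof (cases "j < i")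
      case True
      have "(i, j) \<in> ?h ` ?A"
        by (rule image_eqI[where x = "(j, i - 1)"]) (use that True in auto)
      then show ?thesis by simp
    qed (use that in simp)
    then have "{..Suc n} \<times> {..n} \<subseteq> ?A \<union> ?h ` ?A" by (intro subrelI) simp
    moreover have "?A \<union> ?h ` ?A \<subseteq> {..Suc n} \<times> {..n}" by auto
    ultimately show ?thesis by (rule equalityI)
  qed
  also have "(\<Sum>p\<in>?A \<union> ?h ` ?A. T p) = (\<Sum>p\<in>?A. T p) + (\<Sum>p\<in>?h ` ?A. T p)"
  proof (rule sum.union_disjoint)
    show fin: "finite ?A" by (rule finite_subset[of _ "{..n} \<times> {..n}"]) auto
    then show "finite (?h ` ?A)" by (rule finite_imageI)
  qed auto
  also have "(\<Sum>p\<in>?h ` ?A. T p) = (\<Sum>p\<in>?A. T (?h p))"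
    by (rule sum.reindex[unfolded comp_def]) (auto simp: inj_on_def)
  also have "\<dots> = (\<Sum>p\<in>?A. - T p)"
  proof (rule sum.cong[OF refl])
    fix p assume "p \<in> ?A"
    then obtain i j where p: "p = (i, j)" "i \<le> j" "j \<le> n" by auto
    have "bar_face G i (bar_face G (Suc j) xs) = bar_face G j (bar_face G i xs)"
      using p n assms by (intro bar_face_face) auto
    then show "T (?h p) = - T p"
      by (simp add: p T_def single_uminus add.commute)
  qed
  finally show ?thesis by (simp add: sum_negf)
qed

lemma bar_boundary_boundary:
  assumes "group G" "c \<in> carrier (bar_chains G n)"
  shows "bar_boundary G (bar_boundary G c) = 0"
proof -
  have c: "c = (\<Sum>xs\<in>Poly_Mapping.keys c. Poly_Mapping.single xs (Poly_Mapping.lookup c xs))"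
    by (rule poly_mapping_eqI) (simp add: lookup_sum lookup_single when_def in_keys_iff)
  show ?thesis
    using assms by (subst c)
      (auto simp: bar_boundary_sum bar_chains_def intro!: sum.neutral bar_boundary_boundary_single)
qed

lemma vectorspace_rational_homology:
  assumes "group G"
  shows "vectorspace class_ring (rational_homology G n)"
proof -
  interpret C: vectorspace class_ring "bar_chains G n" by (rule vectorspace_bar_chains)
  have simps: "add (bar_chains G n) = (+)" "zero (bar_chains G n) = 0"
    "module.smult (bar_chains G n) = (\<lambda>r. Poly_Mapping.map ((*) r))"
    by (simp_all add: bar_chains_def)
  have Z: "submodule class_ring (bar_cycles G n) (bar_chains G n)"
    by (rule submodule.intro)
      (use C.module_axioms C.M.a_closed C.M.zero_closed C.smult_closed in
        \<open>auto simp: bar_cycles_def simps bar_boundary_add bar_boundary_scale bar_boundary_zero scale_zero\<close>)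
  let ?Z = "(bar_chains G n)\<lparr>carrier := bar_cycles G n\<rparr>"
  have MZ: "Module.module class_ring ?Z" by (rule C.submodule_is_module[OF Z])
  interpret D: vectorspace class_ring "bar_chains G (Suc n)" by (rule vectorspace_bar_chains)
  have simpsD: "add (bar_chains G (Suc n)) = (+)" "zero (bar_chains G (Suc n)) = 0"
    "module.smult (bar_chains G (Suc n)) = (\<lambda>r. Poly_Mapping.map ((*) r))"
    by (simp_all add: bar_chains_def)
  have "submodule class_ring (bar_boundaries G n) ?Z"
  proof (rule submodule.intro[OF MZ])
    show "bar_boundaries G n \<subseteq> carrier ?Z"
      using assms by (auto simp: bar_boundaries_def bar_cycles_def
          intro: bar_boundary_in_chains bar_boundary_boundary)
    show "\<zero>\<^bsub>?Z\<^esub> \<in> bar_boundaries G n"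
      using D.M.zero_closed bar_boundary_zero[of G]
      by (force simp: bar_boundaries_def simps simpsD)
    fix v w assume "v \<in> bar_boundaries G n" "w \<in> bar_boundaries G n"
    then obtain a b where "a \<in> carrier (bar_chains G (Suc n))" "b \<in> carrier (bar_chains G (Suc n))"
      "v = bar_boundary G a" "w = bar_boundary G b" by (auto simp: bar_boundaries_def)
    then show "v \<oplus>\<^bsub>?Z\<^esub> w \<in> bar_boundaries G n"
      using D.M.a_closed[of a b]
      by (auto simp: bar_boundaries_def simps simpsD bar_boundary_add[symmetric])
  next
    fix r v assume "v \<in> bar_boundaries G n"
    then obtain a where "a \<in> carrier (bar_chains G (Suc n))" "v = bar_boundary G a"
      by (auto simp: bar_boundaries_def)
    then show "r \<odot>\<^bsub>?Z\<^esub> v \<in> bar_boundaries G n"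
      using D.smult_closed[of r a]
      by (auto simp: bar_boundaries_def simps simpsD bar_boundary_scale[symmetric])
  qed
  from module_quotient_module[OF MZ this] show ?thesis
    by (simp add: vectorspace_def class_field rational_homology_def)
qed

end

theory Submission
  imports Defs "HOL-Algebra.Bij" "HOL-Number_Theory.Number_Theory"
begin

text \<open>Let \<open>F\<close> be free on \<open>a, t, a', t'\<close> and let \<open>Q\<close> be its quotient by the relators
  \<open>a [a, t a t\<^sup>-\<^sup>1]\<close>, \<open>a' [a', t' a' t'\<^sup>-\<^sup>1]\<close>, \<open>t [t', a']\<close>, \<open>t' [t, a]\<close>. These are two copies of the group
  \<open>\<langle>a, t | [a, t a t\<^sup>-\<^sup>1] = a\<^sup>-\<^sup>1\<rangle>\<close>, amalgamated along the free subgroups on \<open>t, [a, t]\<close> with the two free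
  generators swapped; \<open>a\<close> has infinite order in \<open>Q\<close>. With \<open>b = t a t\<^sup>-\<^sup>1\<close> the
  first relation reads \<open>b a b\<^sup>-\<^sup>1 = a\<^sup>2\<close>. In a finite quotient \<open>a\<close> and \<open>b\<close> have the same order \<open>n\<close>, which therefore
  divides \<open>2\<^sup>n - 1\<close>; so \<open>n = 1\<close> and everything dies. Thus \<open>Q\<close> has no nontrivial finite quotients.
  Since every relator \<open>r\<^sub>i\<close> is the generator \<open>x\<^sub>i\<close> times a commutator, central extensions of \<open>Q\<close> split.

  Take \<open>\<Gamma> = F \<times> F\<close>, and let \<open>N\<close> be the fibre product of two copies of \<open>F \<rightarrow> Q\<close>. The two properties of
  \<open>Q\<close> make the inclusion an isomorphism of profinite completions (Platonov and Tavgen). The endomorphism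
  \<open>x\<^sub>i \<mapsto> r\<^sub>i\<close> of \<open>F\<close>, applied to both factors, maps \<open>\<Gamma>\<close> into \<open>N\<close> and is the identity modulo commutators, so it
  induces isomorphisms of all lower central quotients. Finally, with \<open>r = t [t', a']\<close>, the commuting pairs
  \<open>(r, 1)\<close>, \<open>(1, a\<^sup>k r a\<^sup>-\<^sup>k)\<close> give 2-cycles of \<open>N\<close>. They are independent in homology, since
  they are dual to the cocycles obtained from the Fox derivative with respect to \<open>t\<close> on the two factors,
  twisted by the powers of \<open>a\<close>.\<close>

text \<open>Since \<open>Q\<close> is finitely generated without finite quotients, each of its
  linear images is trivial, so the infinite order of \<open>a\<close> cannot be seen in matrices;
  hence the permutation groups of infinite sets. That infinite order is also what makes the homology
  large: the conjugates of \<open>r\<close> by powers of \<open>a\<close> are separated by cocycles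
  that read off an element of an image of \<open>Q\<close>. Pairing explicit cycles with these gives
  the lower bound, and no homology group is computed.

  The harder half of comparing profinite completions is that every \<open>U\<close> of finite index
  in \<open>N\<close> comes from \<open>\<Gamma>\<close>. Its trace on the first factor is a normal
  subgroup \<open>A\<close> of \<open>F\<close>, of finite index in the kernel \<open>R\<close> of
  \<open>F \<rightarrow> Q\<close>, and a normal subgroup of finite index in \<open>F\<close> is
  wanted that meets \<open>R\<close> inside \<open>A\<close>. The centralizer of \<open>R/A\<close>
  in \<open>F/A\<close> maps onto \<open>Q\<close>, because finite quotients are missing, and it is
  then a central extension of \<open>Q\<close>, which splits: this is where the two properties of
  \<open>Q\<close> meet.

  \<open>N\<close> is finitely generated because \<open>Q\<close> is finitely presented: the
  diagonal and the pairs \<open>(r\<^sub>i, 1)\<close> generate it.\<close>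

lemma group_homI: "group G \<Longrightarrow> group H \<Longrightarrow> h \<in> hom G H \<Longrightarrow> group_hom G H h"
  by (simp add: group_hom_def group_hom_axioms_def)

lemma (in group) inv_cancel_left:
  assumes "x \<in> carrier G" "y \<in> carrier G"
  shows "inv x \<otimes> (x \<otimes> y) = y" "x \<otimes> (inv x \<otimes> y) = y"
  using assms by (simp_all add: m_assoc[symmetric])

lemma (in normal) rcos_eq_iff:
  assumes "x \<in> carrier G" "y \<in> carrier G"
  shows "H #> x = H #> y \<longleftrightarrow> x \<otimes> inv y \<in> H"
proof
  assume "H #> x = H #> y"
  then have "x \<in> H #> y" using rcos_self[OF assms(1) is_subgroup] by simp
  then obtain h where "h \<in> H" "x = h \<otimes> y" by (auto simp: r_coset_def)
  then show "x \<otimes> inv y \<in> H" using assms by (simp add: m_assoc subset[THEN subsetD])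
next
  assume "x \<otimes> inv y \<in> H"
  then have "x \<in> H #> y"
    using assms by (auto simp: r_coset_def m_assoc intro!: bexI[of _ "x \<otimes> inv y"])
  then show "H #> x = H #> y" using repr_independence assms is_subgroup by metis
qed

lemma (in normal) rcos_eq_self_iff:
  assumes "x \<in> carrier G" shows "H #> x = H \<longleftrightarrow> x \<in> H"
  using rcos_eq_iff[OF assms one_closed] assms subset by (simp add: coset_mult_one)

text \<open>The composite of \<open>f\<close> with the projection onto \<open>H Mod B\<close> has
  kernel \<open>A\<close>. Asking for surjectivity only modulo \<open>B\<close> admits the relator
  endomorphism as \<open>f\<close>, whose values have both coordinates in
  \<open>Rel\<close>.\<close>

lemma Mod_iso_Mod:
  assumes "group G" "B \<lhd> H" "f \<in> hom G H"
    and ker: "{x \<in> carrier G. f x \<in> B} = A"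
    and sur: "\<And>y. y \<in> carrier H \<Longrightarrow> \<exists>x\<in>carrier G. B #>\<^bsub>H\<^esub> y = B #>\<^bsub>H\<^esub> f x"
  shows "G Mod A \<cong> H Mod B"
proof -
  interpret B: normal B H by fact
  have "(\<lambda>x. B #>\<^bsub>H\<^esub> f x) \<in> hom G (H Mod B)"
    using Group.hom_compose[OF assms(3) B.r_coset_hom_Mod] by (simp add: comp_def)
  then interpret q: group_hom G "H Mod B" "\<lambda>x. B #>\<^bsub>H\<^esub> f x"
    using assms(1) B.factorgroup_is_group by (intro group_homI)
  have fc: "f x \<in> carrier H" if "x \<in> carrier G" for x using assms(3) that by (rule hom_in_carrier)
  have "kernel G (H Mod B) (\<lambda>x. B #>\<^bsub>H\<^esub> f x) = A"
    by (simp add: kernel_def B.rcos_eq_self_iff fc flip: ker cong: conj_cong)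
  moreover have "(\<lambda>x. B #>\<^bsub>H\<^esub> f x) ` carrier G = carrier (H Mod B)"
    using fc sur by (auto simp: carrier_FactGroup image_iff)
  ultimately show ?thesis using q.FactGroup_iso by simp
qed

section \<open>Normal subgroups of finite index\<close>

lemma kernel_finite_index:
  assumes "group_hom G H h" "finite (h ` carrier G)"
  shows "kernel G H h \<in> finite_index_normals G"
proof -
  interpret group_hom G H h by fact
  have "(\<lambda>X. the_elem (h ` X)) ` carrier (G Mod kernel G H h) \<subseteq> h ` carrier G"
  proof clarify
    fix X assume X: "X \<in> carrier (G Mod kernel G H h)"
    then obtain x where x: "x \<in> carrier G" "X = kernel G H h #>\<^bsub>G\<^esub> x"
      by (auto simp: carrier_FactGroup)
    then have "h ` X = {h x}"
      using FactGroup_nonempty[OF X] by (auto simp: r_coset_def kernel_def)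
    then show "the_elem (h ` X) \<in> h ` carrier G" using x by simp
  qed
  then have "finite (carrier (G Mod kernel G H h))"
    using finite_imageD[OF finite_subset[OF _ assms(2)] FactGroup_inj_on] by blast
  then show ?thesis
    using normal_kernel by (simp add: finite_index_normals_def FactGroup_def)
qed

lemma finite_index_normals_hom:
  assumes "U \<in> finite_index_normals G"
  shows "group_hom G (G Mod U) (\<lambda>x. U #>\<^bsub>G\<^esub> x)" "finite (carrier (G Mod U))"
    "U = {x \<in> carrier G. U #>\<^bsub>G\<^esub> x = U}"
proof -
  interpret normal U G using assms by (simp add: finite_index_normals_def)
  show "group_hom G (G Mod U) (\<lambda>x. U #>\<^bsub>G\<^esub> x)"
    using is_group factorgroup_is_group r_coset_hom_Mod by (intro group_homI)
  show "finite (carrier (G Mod U))"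
    using assms by (simp add: finite_index_normals_def FactGroup_def)
  show "U = {x \<in> carrier G. U #>\<^bsub>G\<^esub> x = U}"
    using subset by (simp add: rcos_eq_self_iff cong: conj_cong) blast
qed

lemma finite_index_normals_vimage:
  assumes "group G" "f \<in> hom G H" "V \<in> finite_index_normals H"
  shows "{x \<in> carrier G. f x \<in> V} \<in> finite_index_normals G"
proof -
  interpret q: group_hom H "H Mod V" "\<lambda>x. V #>\<^bsub>H\<^esub> x"
    by (rule finite_index_normals_hom(1)[OF assms(3)])
  interpret V: normal V H using assms by (simp add: finite_index_normals_def)
  have "(\<lambda>x. V #>\<^bsub>H\<^esub> f x) \<in> hom G (H Mod V)"
    using Group.hom_compose[OF assms(2) V.r_coset_hom_Mod] by (simp add: comp_def)
  then interpret c: group_hom G "H Mod V" "\<lambda>x. V #>\<^bsub>H\<^esub> f x"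
    using assms(1) V.factorgroup_is_group by (intro group_homI)
  have "kernel G (H Mod V) (\<lambda>x. V #>\<^bsub>H\<^esub> f x) \<in> finite_index_normals G"
  proof (rule kernel_finite_index[OF c.group_hom_axioms])
    show "finite ((\<lambda>x. V #>\<^bsub>H\<^esub> f x) ` carrier G)"
      by (rule finite_subset[OF _ finite_index_normals_hom(2)[OF assms(3)]]) auto
  qed
  moreover have "kernel G (H Mod V) (\<lambda>x. V #>\<^bsub>H\<^esub> f x) = {x \<in> carrier G. f x \<in> V}"
    by (simp add: kernel_def V.rcos_eq_self_iff hom_in_carrier[OF assms(2)] cong: conj_cong)
  ultimately show ?thesis by simp
qed

lemma finite_index_normals_Int:
  assumes "U \<in> finite_index_normals G" "V \<in> finite_index_normals G"
  shows "U \<inter> V \<in> finite_index_normals G"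
proof -
  interpret U: group_hom G "G Mod U" "\<lambda>x. U #>\<^bsub>G\<^esub> x"
    by (rule finite_index_normals_hom(1)[OF assms(1)])
  interpret V: group_hom G "G Mod V" "\<lambda>x. V #>\<^bsub>G\<^esub> x"
    by (rule finite_index_normals_hom(1)[OF assms(2)])
  let ?H = "(G Mod U) \<times>\<times> (G Mod V)" and ?h = "\<lambda>x. (U #>\<^bsub>G\<^esub> x, V #>\<^bsub>G\<^esub> x)"
  interpret P: group_hom G ?H ?h
    using U.H.is_group V.H.is_group U.homh V.homh
    by (intro group_homI DirProd_group) (auto simp: hom_def)
  have "kernel G ?H ?h \<in> finite_index_normals G"
  proof (rule kernel_finite_index[OF P.group_hom_axioms])
    show "finite (?h ` carrier G)"
      by (rule finite_subset[of _ "carrier ?H"])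
        (auto simp: finite_index_normals_hom(2)[OF assms(1)] finite_index_normals_hom(2)[OF assms(2)])
  qed
  moreover have "kernel G ?H ?h = U \<inter> V"
    using finite_index_normals_hom(3)[OF assms(1)] finite_index_normals_hom(3)[OF assms(2)]
    by (auto simp: kernel_def)
  ultimately show ?thesis by simp
qed

section \<open>The universal property of free groups\<close>

definition letter_val :: "('a, 'b) monoid_scheme \<Rightarrow> ('x \<Rightarrow> 'a) \<Rightarrow> 'x \<times> bool \<Rightarrow> 'a" where
  "letter_val G f a = (if snd a then f (fst a) else inv\<^bsub>G\<^esub> f (fst a))"

definition free_eval :: "('a, 'b) monoid_scheme \<Rightarrow> ('x \<Rightarrow> 'a) \<Rightarrow> ('x \<times> bool) list \<Rightarrow> 'a" where
  "free_eval G f w = foldr (\<lambda>a y. letter_val G f a \<otimes>\<^bsub>G\<^esub> y) w \<one>\<^bsub>G\<^esub>"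

lemma free_eval_simps:
  "free_eval G f [] = \<one>\<^bsub>G\<^esub>"
  "free_eval G f (a # w) = letter_val G f a \<otimes>\<^bsub>G\<^esub> free_eval G f w"
  by (simp_all add: free_eval_def)

abbreviation gen :: "'x \<Rightarrow> ('x \<times> bool) list" where
  "gen x \<equiv> [(x, True)]"

lemma carrier_free_group: "w \<in> carrier (free_group X) \<longleftrightarrow> reduced_word w \<and> set w \<subseteq> X \<times> UNIV"
  by (simp add: free_group_def)

lemma gen_in_free_group: "x \<in> X \<Longrightarrow> gen x \<in> carrier (free_group X)"
  by (simp add: carrier_free_group)

lemma mult_free_group: "u \<otimes>\<^bsub>free_group X\<^esub> v = foldr cons_letter u v"
  and one_free_group: "\<one>\<^bsub>free_group X\<^esub> = []"
  by (simp_all add: free_group_def)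

context group
begin

lemma letter_val_closed: "f \<in> X \<rightarrow> carrier G \<Longrightarrow> a \<in> X \<times> UNIV \<Longrightarrow> letter_val G f a \<in> carrier G"
  by (auto simp: letter_val_def Pi_iff)

lemma free_eval_closed: "f \<in> X \<rightarrow> carrier G \<Longrightarrow> set w \<subseteq> X \<times> UNIV \<Longrightarrow> free_eval G f w \<in> carrier G"
  by (induction w) (simp_all add: free_eval_simps letter_val_closed)

lemma letter_val_inv:
  "f \<in> X \<rightarrow> carrier G \<Longrightarrow> a \<in> X \<times> UNIV \<Longrightarrow> letter_val G f (letter_inv a) = inv (letter_val G f a)"
  by (auto simp: letter_val_def letter_inv_def Pi_iff)

lemma free_eval_cons_letter:
  assumes "f \<in> X \<rightarrow> carrier G" "a \<in> X \<times> UNIV" "set w \<subseteq> X \<times> UNIV"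
  shows "free_eval G f (cons_letter a w) = letter_val G f a \<otimes> free_eval G f w"
proof (cases w)
  case (Cons b v)
  have b: "b \<in> X \<times> UNIV" "set v \<subseteq> X \<times> UNIV" using assms Cons by auto
  note c = letter_val_closed[OF assms(1)] free_eval_closed[OF assms(1) b(2)]
  show ?thesis
    using assms b c Cons by (auto simp: free_eval_simps letter_val_inv inv_cancel_left)
qed (simp add: free_eval_simps)

text \<open>Evaluation is defined on all words and by \<open>free_eval_cons_letter\<close> does not
  notice cancellation, so a plain induction over the letters of \<open>u\<close> suffices.\<close>

lemma free_eval_foldr:
  assumes "f \<in> X \<rightarrow> carrier G" "set u \<subseteq> X \<times> UNIV" "set v \<subseteq> X \<times> UNIV"
  shows "free_eval G f (foldr cons_letter u v) = free_eval G f u \<otimes> free_eval G f v"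
  using assms(2)
proof (induction u)
  case (Cons a u)
  have s: "set (foldr cons_letter u v) \<subseteq> X \<times> UNIV"
    using set_mult_word[of u v] Cons.prems assms(3) by auto
  show ?case
    using Cons assms free_eval_cons_letter[OF assms(1) _ s, of a]
    by (simp add: free_eval_simps m_assoc letter_val_closed[OF assms(1)] free_eval_closed[OF assms(1)])
qed (simp add: free_eval_simps free_eval_closed[OF assms(1,3)])

lemma free_eval_hom:
  assumes "f \<in> X \<rightarrow> carrier G"
  shows "free_eval G f \<in> hom (free_group X) G"
  using free_eval_closed[OF assms] free_eval_foldr[OF assms]
  by (auto simp: hom_def carrier_free_group mult_free_group)

lemma free_eval_gen: "f x \<in> carrier G \<Longrightarrow> free_eval G f (gen x) = f x"
  by (simp add: free_eval_simps letter_val_def)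

end

lemma generate_free_group: "generate (free_group X) (gen ` X) = carrier (free_group X)"
proof
  interpret group "free_group X" by (rule group_free_group)
  show "generate (free_group X) (gen ` X) \<subseteq> carrier (free_group X)"
    by (intro generate_incl) (auto intro: gen_in_free_group)
  have "w \<in> generate (free_group X) (gen ` X)" if "reduced_word w" "set w \<subseteq> X \<times> UNIV" for w
    using that
  proof (induction w)
    case Nil
    then show ?case using generate.one[of "free_group X"] by (simp add: one_free_group)
  next
    case (Cons a w)
    obtain x b where a: "a = (x, b)" "x \<in> X" using Cons.prems by (cases a) auto
    have "[(x, False)] = inv\<^bsub>free_group X\<^esub> (gen x)"
      using a gen_in_free_group[of x X]
      by (intro inv_equality[symmetric])
        (auto simp: mult_free_group one_free_group letter_inv_def carrier_free_group)
    then have "[a] \<in> generate (free_group X) (gen ` X)"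
      using a generate.incl[of "gen x" "gen ` X"] generate.inv[of "gen x" "gen ` X"]
      by (cases b) auto
    moreover have "a # w = [a] \<otimes>\<^bsub>free_group X\<^esub> w"
      using Cons.prems by (cases w) (auto simp: mult_free_group)
    moreover have "w \<in> generate (free_group X) (gen ` X)"
      using Cons.IH reduced_word_tl[OF Cons.prems(1)] Cons.prems(2) by simp
    ultimately show ?case by (metis generate.eng)
  qed
  then show "carrier (free_group X) \<subseteq> generate (free_group X) (gen ` X)"
    by (auto simp: carrier_free_group)
qed

lemma hom_eq_on_generate:
  assumes "group_hom G H h" "group_hom G H k" "S \<subseteq> carrier G"
    and "\<And>x. x \<in> S \<Longrightarrow> h x = k x" and x: "x \<in> generate G S"
  shows "h x = k x"
proof -
  interpret h: group_hom G H h by fact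
  interpret k: group_hom G H k by fact
  show ?thesis using x
  proof induction
    case (eng a b)
    then show ?case using h.G.generate_in_carrier[OF assms(3)] by simp
  qed (use assms in \<open>auto simp: subset_iff\<close>)
qed

lemma free_group_hom_eq:
  assumes "group H" "h \<in> hom (free_group X) H" "k \<in> hom (free_group X) H"
    and "\<And>x. x \<in> X \<Longrightarrow> h (gen x) = k (gen x)" and "w \<in> carrier (free_group X)"
  shows "h w = k w"
  by (rule hom_eq_on_generate[of "free_group X" H h k "gen ` X"])
    (use assms generate_free_group[of X] in \<open>auto intro: group_homI group_free_group gen_in_free_group\<close>)

section \<open>Free groups are residually torsion-free nilpotent\<close>

text \<open>Unitriangular integer matrices on the coordinates \<open>0\<close> to \<open>n\<close>,
  as additive maps \<open>1 + A\<close>: entry \<open>i\<close> of \<open>A v\<close> depends only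
  on the entries of \<open>v\<close> from \<open>i + k\<close> to \<open>n\<close>. The parameter
  \<open>k\<close> filters the group, \<open>k = 1\<close> giving all of it and \<open>k > n\<close>
  only the identity. With maps in place of matrices the product is composition.\<close>

definition unip :: "nat \<Rightarrow> nat \<Rightarrow> ((nat \<Rightarrow> int) \<Rightarrow> nat \<Rightarrow> int) set" where
  "unip n k = {g. (\<forall>v w. g (\<lambda>i. v i + w i) = (\<lambda>i. g v i + g w i)) \<and>
     (\<forall>v i. (\<forall>j. i + k \<le> j \<and> j \<le> n \<longrightarrow> v j = 0) \<longrightarrow> g v i = v i)}"

definition unip_group :: "nat \<Rightarrow> ((nat \<Rightarrow> int) \<Rightarrow> nat \<Rightarrow> int) monoid" where
  "unip_group n = \<lparr>carrier = unip n 1, monoid.mult = (\<circ>), one = id\<rparr>"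

lemma unip_add: "g \<in> unip n k \<Longrightarrow> g (\<lambda>i. v i + w i) = (\<lambda>i. g v i + g w i)"
  by (simp add: unip_def)

lemma unip_fix: "g \<in> unip n k \<Longrightarrow> (\<And>j. i + k \<le> j \<Longrightarrow> j \<le> n \<Longrightarrow> v j = 0) \<Longrightarrow> g v i = v i"
  by (simp add: unip_def)

lemma unipI:
  assumes "\<And>v w i. g (\<lambda>i. v i + w i) i = g v i + g w i"
    and "\<And>v i. (\<And>j. i + k \<le> j \<Longrightarrow> j \<le> n \<Longrightarrow> v j = 0) \<Longrightarrow> g v i = v i"
  shows "g \<in> unip n k"
  using assms by (auto simp: unip_def)

lemma unip_diff:
  assumes "g \<in> unip n k"
  shows "g (\<lambda>i. v i - w i) i = g v i - g w i"
  using fun_cong[OF unip_add[OF assms, of "\<lambda>i. v i - w i" w], of i] by simp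

lemma unip_mono: "k \<le> l \<Longrightarrow> unip n l \<subseteq> unip n k"
  by (auto simp: unip_def)

lemma unip_comp:
  assumes "g \<in> unip n k" "h \<in> unip n k"
  shows "g \<circ> h \<in> unip n k"
proof (rule unipI)
  fix v :: "nat \<Rightarrow> int" and i assume v: "\<And>j. i + k \<le> j \<Longrightarrow> j \<le> n \<Longrightarrow> v j = 0"
  have h: "h v j = v j" if "i \<le> j" for j
    using assms(2) by (rule unip_fix) (use that v in auto)
  have "g (h v) i = h v i"
    using assms(1) by (rule unip_fix) (use h v in auto)
  then show "(g \<circ> h) v i = v i" using h by simp
qed (simp add: assms[THEN unip_add])

lemma unip_id: "id \<in> unip n k"
  by (simp add: unip_def)

lemma unip_large: "g \<in> unip n k \<Longrightarrow> n < k \<Longrightarrow> g = id"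
  by (intro ext) (simp add: unip_fix[of g n k])

text \<open>If \<open>g = 1 + A\<close> then \<open>(1 - A) g = 1 - A\<^sup>2\<close> is closer to the identity.\<close>

lemma unip_left_inverse:
  assumes "g \<in> unip n k" "1 \<le> k"
  shows "\<exists>h\<in>unip n k. h \<circ> g = id"
  using assms
proof (induction "Suc n - k" arbitrary: g k rule: less_induct)
  case less
  show ?case
  proof (cases "n < k")
    case True
    then show ?thesis using less.prems unip_large[OF less.prems(1)] unip_id[of n k] by auto
  next
    case False
    define g' where "g' v = (\<lambda>i. 2 * v i - g v i)" for v :: "nat \<Rightarrow> int"
    have g': "g' \<in> unip n k"
      by (rule unipI) (auto simp: g'_def unip_add[OF less.prems(1)] unip_fix[OF less.prems(1)])
    have "g' \<circ> g \<in> unip n (k + k)"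
    proof (rule unipI)
      fix v :: "nat \<Rightarrow> int" and i assume v: "\<And>j. i + (k + k) \<le> j \<Longrightarrow> j \<le> n \<Longrightarrow> v j = 0"
      have "g (\<lambda>i. g v i - v i) i = g v i - v i"
      proof (rule unip_fix[OF less.prems(1)])
        fix j assume "i + k \<le> j" "j \<le> n"
        then have "g v j = v j" using v by (intro unip_fix[OF less.prems(1)]) auto
        then show "g v j - v j = 0" by simp
      qed
      then show "(g' \<circ> g) v i = v i"
        by (simp add: g'_def unip_diff[OF less.prems(1)])
    qed (simp add: less.prems(1)[THEN unip_add] g'[THEN unip_add])
    then obtain h where h: "h \<in> unip n (k + k)" "h \<circ> (g' \<circ> g) = id"
      using less.hyps[OF _ \<open>g' \<circ> g \<in> unip n (k + k)\<close>] False less.prems(2) by fastforce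
    have "h \<circ> g' \<in> unip n k"
      using h unip_mono[of k "k + k" n] by (intro unip_comp g') auto
    then show ?thesis using h(2) by (intro bexI[of _ "h \<circ> g'"]) (auto simp: o_assoc)
  qed
qed

lemma group_unip_group: "group (unip_group n)"
proof (rule groupI)
  fix g assume "g \<in> carrier (unip_group n)"
  then show "\<exists>h\<in>carrier (unip_group n). h \<otimes>\<^bsub>unip_group n\<^esub> g = \<one>\<^bsub>unip_group n\<^esub>"
    using unip_left_inverse[of g n 1] by (simp add: unip_group_def)
next
  fix g h assume "g \<in> carrier (unip_group n)" "h \<in> carrier (unip_group n)"
  then show "g \<otimes>\<^bsub>unip_group n\<^esub> h \<in> carrier (unip_group n)"
    by (simp add: unip_group_def unip_comp)
qed (simp_all add: unip_group_def o_assoc unip_id)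

lemma subgroup_unip:
  assumes "1 \<le> k"
  shows "subgroup (unip n k) (unip_group n)"
proof -
  interpret group "unip_group n" by (rule group_unip_group)
  have sub: "unip n k \<subseteq> carrier (unip_group n)"
    using unip_mono[OF assms] by (simp add: unip_group_def)
  show ?thesis
  proof (rule subgroupI[OF sub])
    fix g assume g: "g \<in> unip n k"
    obtain h where h: "h \<in> unip n k" "h \<circ> g = id" using unip_left_inverse[OF g assms] by auto
    have "inv\<^bsub>unip_group n\<^esub> g = h"
      using g h sub by (intro inv_equality) (auto simp: unip_group_def)
    then show "inv\<^bsub>unip_group n\<^esub> g \<in> unip n k" using h by simp
  next
    fix g h assume "g \<in> unip n k" "h \<in> unip n k"
    then show "g \<otimes>\<^bsub>unip_group n\<^esub> h \<in> unip n k" by (simp add: unip_group_def unip_comp)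
  qed (use unip_id in auto)
qed

text \<open>With \<open>x = 1 + A\<close> and \<open>y = 1 + B\<close>, the entry \<open>i\<close> of \<open>(x y - y x) v = (A B - B A) v\<close> only involves
  entries of \<open>v\<close> at distance more than \<open>k\<close>.\<close>

lemma unip_commutator:
  assumes x: "x \<in> unip n k" and y: "y \<in> unip n 1" and "1 \<le> k"
    and c: "c \<in> unip n 1" and eq: "c \<circ> y \<circ> x = x \<circ> y"
  shows "c \<in> unip n (Suc k)"
proof (rule unipI)
  fix u :: "nat \<Rightarrow> int" and i assume u: "\<And>j. i + Suc k \<le> j \<Longrightarrow> j \<le> n \<Longrightarrow> u j = 0"
  interpret group "unip_group n" by (rule group_unip_group)
  have xy: "x \<in> carrier (unip_group n)" "y \<in> carrier (unip_group n)"
    using x y unip_mono[OF \<open>1 \<le> k\<close>] by (auto simp: unip_group_def)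
  \<comment> \<open>Writing the test vector as \<open>u = y (x v)\<close> turns \<open>c u\<close>
    into \<open>x (y v)\<close>, so only the two products of \<open>x\<close> and \<open>y\<close>
    have to be compared on \<open>v\<close>.\<close>
  define z where "z = inv\<^bsub>unip_group n\<^esub> (y \<otimes>\<^bsub>unip_group n\<^esub> x)"
  have z: "z \<in> unip n 1" "y \<circ> x \<circ> z = id"
    using xy inv_closed[of "y \<otimes>\<^bsub>unip_group n\<^esub> x"] r_inv[of "y \<otimes>\<^bsub>unip_group n\<^esub> x"]
    by (auto simp: z_def unip_group_def unip_comp)
  define v where "v = z u"
  have uv: "u = y (x v)" using z(2) by (auto simp: v_def fun_eq_iff)
  have v: "v j = 0" if "i + Suc k \<le> j" "j \<le> n" for j
    using unip_fix[OF z(1), of j u] u that by (simp add: v_def)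
  have xv: "x v j = v j" if "i + 1 \<le> j" for j
    by (rule unip_fix[OF x]) (use v that in auto)
  have yv: "y v j = v j" if "i + k \<le> j" for j
    by (rule unip_fix[OF y]) (use v that in auto)
  have "y (\<lambda>j. x v j - v j) i = x v i - v i"
    by (rule unip_fix[OF y]) (use xv in auto)
  moreover have "x (\<lambda>j. y v j - v j) i = y v i - v i"
    by (rule unip_fix[OF x]) (use yv in auto)
  ultimately have "x (y v) i = y (x v) i"
    by (simp add: unip_diff[OF x] unip_diff[OF y])
  moreover have "c u = x (y v)" using eq unfolding uv by (simp add: fun_eq_iff)
  ultimately show "c u i = u i" using uv by simp
qed (simp add: c[THEN unip_add])

lemma lower_central_unip: "1 \<le> c \<Longrightarrow> lower_central (unip_group n) c \<subseteq> unip n c"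
proof (induction c)
  case (Suc c)
  interpret group "unip_group n" by (rule group_unip_group)
  show ?case
  proof (cases "c = 0")
    case True
    then show ?thesis by (simp add: unip_group_def)
  next
    case False
    have "x \<otimes>\<^bsub>unip_group n\<^esub> y \<otimes>\<^bsub>unip_group n\<^esub> inv\<^bsub>unip_group n\<^esub> x \<otimes>\<^bsub>unip_group n\<^esub> inv\<^bsub>unip_group n\<^esub> y
        \<in> unip n (Suc c)" (is "?c \<in> _")
      if x: "x \<in> lower_central (unip_group n) c" and y: "y \<in> carrier (unip_group n)" for x y
    proof (rule unip_commutator)
      show xu: "x \<in> unip n c" using Suc False x by auto
      show yu: "y \<in> unip n 1" using y by (simp add: unip_group_def)
      show "1 \<le> c" using False by simp
      have xc: "x \<in> carrier (unip_group n)"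
        using xu unip_mono[of 1 c n] False by (auto simp: unip_group_def)
      then have "?c \<in> carrier (unip_group n)" using y by simp
      then show "?c \<in> unip n 1" by (simp add: unip_group_def)
      have "?c \<otimes>\<^bsub>unip_group n\<^esub> y \<otimes>\<^bsub>unip_group n\<^esub> x = x \<otimes>\<^bsub>unip_group n\<^esub> y"
        using xc y by (simp add: m_assoc)
      then show "?c \<circ> y \<circ> x = x \<circ> y" by (simp add: unip_group_def)
    qed
    then have "generate (unip_group n) (\<Union>x\<in>lower_central (unip_group n) c. \<Union>y\<in>carrier (unip_group n).
        {x \<otimes>\<^bsub>unip_group n\<^esub> y \<otimes>\<^bsub>unip_group n\<^esub> inv\<^bsub>unip_group n\<^esub> x \<otimes>\<^bsub>unip_group n\<^esub> inv\<^bsub>unip_group n\<^esub> y})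
        \<subseteq> unip n (Suc c)"
      by (intro generate_subgroup_incl subgroup_unip) auto
    then show ?thesis using False by simp
  qed
qed simp

lemma nilpotent_unip_group: "nilpotent_group (unip_group n)"
proof -
  interpret group "unip_group n" by (rule group_unip_group)
  have "lower_central (unip_group n) (Suc n) \<subseteq> unip n (Suc n)"
    by (rule lower_central_unip) simp
  also have "\<dots> \<subseteq> {\<one>\<^bsub>unip_group n\<^esub>}"
    using unip_large[of _ n "Suc n"] by (auto simp: unip_group_def)
  finally have "lower_central (unip_group n) (Suc n) = {\<one>\<^bsub>unip_group n\<^esub>}"
    using lower_central_normal[of "Suc n"] normal_imp_subgroup subgroup.one_closed by blast
  then show ?thesis
    unfolding nilpotent_group_def using group_unip_group by blast
qed

text \<open>Write \<open>g = 1 + A\<close>. Entry \<open>i\<close> of \<open>A v\<close> involves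
  only \<open>v (i + k)\<close>, while entry \<open>i\<close> of \<open>A\<^sup>2 v\<close> only
  sees places from \<open>i + 2 k\<close> on, where \<open>v\<close> vanishes. So the power is
  linear in \<open>m\<close>.\<close>

lemma unip_pow_eq:
  assumes g: "g \<in> unip n k" "1 \<le> k" and v: "\<And>j. i + Suc k \<le> j \<Longrightarrow> j \<le> n \<Longrightarrow> v j = 0"
  shows "(g ^^ m) v i = v i + int m * (g v i - v i)"
proof (induction m)
  case (Suc m)
  have gm: "g ^^ m \<in> unip n 1"
    using g unip_mono[OF g(2)] by (induction m) (auto intro!: unip_comp unip_id simp: unip_id[unfolded id_def])
  have "(g ^^ m) (\<lambda>j. g v j - v j) i = g v i - v i"
  proof (rule unip_fix[OF gm])
    fix j assume "i + 1 \<le> j" "j \<le> n"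
    then have "g v j = v j" by (intro unip_fix[OF g(1)]) (use v in auto)
    then show "g v j - v j = 0" by simp
  qed
  then have "(g ^^ m) (g v) i = (g ^^ m) v i + (g v i - v i)"
    using unip_diff[OF gm, of "g v" v i] by simp
  then show ?case using Suc by (simp add: funpow_swap1 algebra_simps)
qed simp

lemma torsion_free_unip_group: "torsion_free_group (unip_group n)"
proof -
  interpret group "unip_group n" by (rule group_unip_group)
  have pow: "g [^]\<^bsub>unip_group n\<^esub> m = g ^^ m" for g and m :: nat
    by (induction m) (simp_all add: nat_pow_def unip_group_def funpow_swap1 fun_eq_iff)
  have "g = id" if g: "g \<in> unip n 1" "g ^^ m = id" "0 < m" for g m
  proof -
    \<comment> \<open>A torsion element climbs the filtration: its first possibly nonzero
      superdiagonal is multiplied by \<open>m\<close> in the power, hence is zero.\<close>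
    have "g \<in> unip n (Suc k)" for k
    proof (induction k)
      case (Suc k)
      show ?case
      proof (rule unipI)
        fix v :: "nat \<Rightarrow> int" and i assume v: "\<And>j. i + Suc (Suc k) \<le> j \<Longrightarrow> j \<le> n \<Longrightarrow> v j = 0"
        have "(g ^^ m) v i = v i + int m * (g v i - v i)"
          by (rule unip_pow_eq[OF Suc]) (use v in auto)
        then show "g v i = v i" using g by simp
      qed (simp add: unip_add[OF g(1)])
    qed (use g in simp)
    then show "g = id" using unip_large[of g n "Suc n"] by simp
  qed
  then show ?thesis
    using group_unip_group by (auto simp: torsion_free_group_def pow) (auto simp: unip_group_def)
qed

section \<open>Shears that detect reduced words\<close>

definition shear :: "'x list \<Rightarrow> int \<Rightarrow> 'x \<Rightarrow> (nat \<Rightarrow> int) \<Rightarrow> nat \<Rightarrow> int" where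
  "shear bs s x v = (\<lambda>i. if i < length bs \<and> bs ! i = x then v i + s * v (Suc i) else v i)"

lemma shear_in_unip: "shear bs s x \<in> unip (length bs) 1"
  by (rule unipI) (auto simp: shear_def algebra_simps)

text \<open>Adjacent entries of \<open>bs\<close> differ, so the superdiagonal positions of one
  generator are never consecutive and the nilpotent part squares to zero.\<close>

lemma shear_inverse:
  assumes "distinct_adj bs"
  shows "shear bs (-1) x \<circ> shear bs 1 x = id"
proof -
  have "bs ! i \<noteq> bs ! Suc i" if "Suc i < length bs" for i
    using assms that by (auto simp: distinct_adj_conv_nth)
  then show ?thesis by (auto simp: shear_def fun_eq_iff)
qed

lemma letter_val_shear:
  assumes "distinct_adj bs"
  shows "letter_val (unip_group (length bs)) (shear bs 1) (x, b) = shear bs (if b then 1 else -1) x"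
proof -
  interpret group "unip_group (length bs)" by (rule group_unip_group)
  have "inv\<^bsub>unip_group (length bs)\<^esub> (shear bs 1 x) = shear bs (-1) x"
    using shear_inverse[OF assms, of x] shear_in_unip[of bs]
    by (intro inv_equality) (auto simp: unip_group_def)
  then show ?thesis by (simp add: letter_val_def)
qed

text \<open>Every run of equal generators in \<open>w\<close> gets one superdiagonal entry of its own. Reading \<open>w\<close> from the
  right, the last basis vector climbs by one entry per run, and within a run the leading coefficient
  only grows.\<close>

lemma free_eval_shear:
  assumes "distinct_adj bs" "reduced_word w" "bs = pre @ remdups_adj (map fst w)"
  defines "u \<equiv> free_eval (unip_group (length bs)) (shear bs 1) w (\<lambda>i. if i = length bs then 1 else 0)"
    and "j \<equiv> length pre"
  shows "(\<forall>i<j. u i = 0) \<and> (w = [] \<longrightarrow> u j = 1) \<and>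
    (w \<noteq> [] \<longrightarrow> u (Suc j) \<noteq> 0 \<and> (\<exists>m>0. u j = (if snd (hd w) then m else - m) * u (Suc j)))"
  using assms(2,3) unfolding u_def j_def
proof (induction w arbitrary: pre)
  case (Cons a w)
  obtain x b where a: "a = (x, b)" by (cases a)
  let ?j = "length pre" and ?s = "if b then 1 else -1 :: int"
  define u where "u = free_eval (unip_group (length bs)) (shear bs 1) w (\<lambda>i. if i = length bs then 1 else 0)"
  have u': "free_eval (unip_group (length bs)) (shear bs 1) (a # w) (\<lambda>i. if i = length bs then 1 else 0)
      = shear bs ?s x u"
    unfolding a free_eval_simps letter_val_shear[OF assms(1)] u_def by (simp add: unip_group_def)
  have red: "reduced_word w" using Cons.prems reduced_word_tl by blast
  have "\<exists>ys. remdups_adj (map fst (a # w)) = x # ys"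
    by (simp add: a remdups_adj_Cons split: list.split)
  then have jx: "?j < length bs" "bs ! ?j = x" using Cons.prems(2) by (auto simp: nth_append)
  have jx': "\<not> (Suc ?j < length bs \<and> bs ! Suc ?j = x)"
    using assms(1) jx by (auto simp: distinct_adj_conv_nth)
  have sh: "shear bs ?s x u ?j = u ?j + ?s * u (Suc ?j)" "shear bs ?s x u (Suc ?j) = u (Suc ?j)"
    using jx jx' by (auto simp: shear_def)
  have low: "shear bs ?s x u i = 0" if "i < ?j" "\<And>i. i \<le> ?j - 1 \<Longrightarrow> u i = 0" "bs ! i = x \<longrightarrow> u (Suc i) = 0" for i
    using that by (auto simp: shear_def)
  show ?case
  proof (cases "w \<noteq> [] \<and> fst (hd w) = x")
    case True
    then obtain w' where w: "w = (x, snd (hd w)) # w'" by (cases w) auto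
    have hd: "snd (hd w) = b" using Cons.prems(1) by (subst (asm) w) (auto simp: a letter_inv_def)
    have "bs = pre @ remdups_adj (map fst w)"
      using Cons.prems(2) by (subst w, subst (asm) w) (simp add: a)
    note IH = Cons.IH[OF red this, folded u_def]
    \<comment> \<open>The position just before the run belongs to another generator, so the shear
      cannot carry the entry at \<open>?j\<close> to a smaller index.\<close>
    have "shear bs ?s x u i = 0" if "i < ?j" for i
    proof (cases "Suc i = ?j")
      case True
      then have "bs ! i \<noteq> x" using assms(1) jx by (metis distinct_adj_conv_nth)
      then show ?thesis using IH that by (auto simp: shear_def)
    next
      case False
      then show ?thesis using IH that by (auto simp: shear_def)
    qed
    moreover obtain m where m: "m > 0" "u ?j = (if b then m else - m) * u (Suc ?j)"
      using IH True hd by auto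
    have "\<exists>m>0. shear bs ?s x u ?j = (if b then m else - m) * shear bs ?s x u (Suc ?j)"
      using m sh by (intro exI[of _ "m + 1"]) (simp add: algebra_simps)
    ultimately show ?thesis unfolding u' using IH True sh(2) by (simp add: a)
  next
    case False
    \<comment> \<open>A new run starts. With \<open>x\<close> moved into the prefix, the induction
      hypothesis has a nonzero entry at \<open>Suc ?j\<close> and zero at \<open>?j\<close>, so this
      letter makes the ratio of the two entries \<open>1\<close> or \<open>-1\<close>.\<close>
    have "bs = (pre @ [x]) @ remdups_adj (map fst w)"
      using Cons.prems(2) False by (cases w) (auto simp: a)
    note IH = Cons.IH[OF red this, folded u_def]
    have "u (Suc ?j) \<noteq> 0" using IH by (cases "w = []") (auto split: if_splits)
    moreover have "u ?j = 0" using IH by simp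
    moreover have "shear bs ?s x u i = 0" if "i < ?j" for i
      using IH that by (auto simp: shear_def)
    ultimately show ?thesis
      unfolding u' using sh by (auto simp: a intro!: exI[of _ 1])
  qed
qed (simp add: free_eval_simps unip_group_def)

lemma residually_torsion_free_nilpotent_free_group:
  "residually_torsion_free_nilpotent (free_group X)"
proof (rule residually_torsion_free_nilpotentI[OF group_free_group])
  fix w assume w: "w \<in> carrier (free_group X)" "w \<noteq> \<one>\<^bsub>free_group X\<^esub>"
  define bs where "bs = remdups_adj (map fst w)"
  let ?G = "unip_group (length bs)" and ?h = "free_eval (unip_group (length bs)) (shear bs 1)"
  interpret group ?G by (rule group_unip_group)
  have wne: "w \<noteq> []" using w by (simp add: one_free_group)
  have "distinct_adj bs" "reduced_word w" using w by (simp_all add: bs_def carrier_free_group)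
  \<comment> \<open>The last basis vector has entry \<open>0\<close> at index \<open>0\<close>, as
    \<open>bs\<close> is nonempty; the action of \<open>w\<close> makes that entry nonzero.\<close>
  from free_eval_shear[OF this, of "[]"] wne
  have "?h w (\<lambda>i. if i = length bs then 1 else 0) 0 \<noteq> 0"
    by (auto simp: bs_def split: if_splits)
  moreover have "length bs \<noteq> 0" using wne by (simp add: bs_def)
  ultimately have "?h w \<noteq> \<one>\<^bsub>?G\<^esub>" by (auto simp: unip_group_def)
  moreover have "?h \<in> hom (free_group X) ?G"
    using shear_in_unip[of bs] by (intro free_eval_hom) (auto simp: unip_group_def)
  ultimately show "\<exists>(H :: ((nat \<Rightarrow> int) \<Rightarrow> nat \<Rightarrow> int) monoid) \<phi>. torsion_free_group H \<and> nilpotent_group H \<and>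
      \<phi> \<in> hom (free_group X) H \<and> \<phi> w \<noteq> \<one>\<^bsub>H\<^esub>"
    using torsion_free_unip_group nilpotent_unip_group by blast
qed

section \<open>An infinite quotient\<close>

definition commutator :: "('a, 'b) monoid_scheme \<Rightarrow> 'a \<Rightarrow> 'a \<Rightarrow> 'a" where
  "commutator G x y = x \<otimes>\<^bsub>G\<^esub> y \<otimes>\<^bsub>G\<^esub> inv\<^bsub>G\<^esub> x \<otimes>\<^bsub>G\<^esub> inv\<^bsub>G\<^esub> y"

lemma (in group) commutator_closed [simp]:
  "x \<in> carrier G \<Longrightarrow> y \<in> carrier G \<Longrightarrow> commutator G x y \<in> carrier G"
  by (simp add: commutator_def)

lemma (in group_hom) hom_commutator:
  "x \<in> carrier G \<Longrightarrow> y \<in> carrier G \<Longrightarrow> h (commutator G x y) = commutator H (h x) (h y)"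
  by (simp add: commutator_def)

section \<open>Gluing two copies of a group along a free subgroup with its generators
  swapped\<close>

text \<open>The amalgam acts on the set \<open>K\<close> itself: one copy by left translations, the other by their conjugates
  under a permutation that swaps the two free generators in \<open>v\<close> of \<open>v x\<close>, for \<open>v\<close> in the free subgroup and
  \<open>x\<close> in a transversal.\<close>

lemma swap_amalgam:
  fixes K :: "('a, 'b) monoid_scheme"
  assumes "group K" and tp: "t \<in> carrier K" "p \<in> carrier K"
    and free: "\<And>w. w \<in> carrier (free_group UNIV) \<Longrightarrow>
      free_eval K (\<lambda>b. if b then t else p) w = \<one>\<^bsub>K\<^esub> \<Longrightarrow> w = []"
  shows "\<exists>(L :: ('a \<Rightarrow> 'a) monoid) i j. group L \<and> i \<in> hom K L \<and> inj_on i (carrier K) \<and>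
    j \<in> hom K L \<and> i t = j p \<and> i p = j t"
proof -
  interpret K: group K by fact
  let ?F = "free_group (UNIV :: bool set)"
  interpret F: group ?F by (rule group_free_group)
  define \<mu> where "\<mu> = free_eval K (\<lambda>b. if b then t else p)"
  have \<mu>: "\<mu> \<in> hom ?F K" unfolding \<mu>_def using tp by (intro K.free_eval_hom) auto
  interpret \<mu>: group_hom ?F K \<mu> using \<mu> F.is_group K.is_group by (intro group_homI)
  have \<mu>_gen: "\<mu> (gen b) = (if b then t else p)" for b
    unfolding \<mu>_def using tp by (subst K.free_eval_gen) auto
  have inj: "inj_on \<mu> (carrier ?F)"
    using free by (intro \<mu>.inj_on_one_iff[THEN iffD2]) (auto simp: \<mu>_def one_free_group)
  define \<sigma> where "\<sigma> = free_eval ?F (\<lambda>b. gen (\<not> b))"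
  have \<sigma>: "\<sigma> \<in> hom ?F ?F"
    unfolding \<sigma>_def by (intro F.free_eval_hom) (auto intro: gen_in_free_group)
  interpret \<sigma>: group_hom ?F ?F \<sigma> using \<sigma> F.is_group by (intro group_homI)
  have \<sigma>_gen: "\<sigma> (gen b) = gen (\<not> b)" for b
    unfolding \<sigma>_def by (subst F.free_eval_gen) (auto intro: gen_in_free_group)
  have \<sigma>\<sigma>: "\<sigma> (\<sigma> w) = w" if "w \<in> carrier ?F" for w
    using free_group_hom_eq[OF F.is_group, of "\<sigma> \<circ> \<sigma>" UNIV id w] that
      Group.hom_compose[OF \<sigma> \<sigma>] \<sigma>_gen by (simp add: hom_def)
  \<comment> \<open>The choice depends only on the coset as a set, which makes \<open>rep\<close>
    constant on cosets of the free subgroup.\<close>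
  define rep where "rep x = (SOME y. y \<in> (\<lambda>w. \<mu> w \<otimes>\<^bsub>K\<^esub> x) ` carrier ?F)" for x
  have rep: "\<exists>w\<in>carrier ?F. x = \<mu> w \<otimes>\<^bsub>K\<^esub> rep x" if x: "x \<in> carrier K" for x
  proof -
    have "rep x \<in> (\<lambda>w. \<mu> w \<otimes>\<^bsub>K\<^esub> x) ` carrier ?F"
      unfolding rep_def by (rule someI_ex) (use F.one_closed in blast)
    then obtain w where "w \<in> carrier ?F" "rep x = \<mu> w \<otimes>\<^bsub>K\<^esub> x" by auto
    then show ?thesis using x
      by (intro bexI[of _ "inv\<^bsub>?F\<^esub> w"]) (simp_all add: K.inv_cancel_left)
  qed
  have rep_closed: "rep x \<in> carrier K" if x: "x \<in> carrier K" for x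
  proof -
    have "rep x \<in> (\<lambda>w. \<mu> w \<otimes>\<^bsub>K\<^esub> x) ` carrier ?F"
      unfolding rep_def by (rule someI_ex) (use F.one_closed in blast)
    then show ?thesis using x by auto
  qed
  have rep_mult: "rep (\<mu> v \<otimes>\<^bsub>K\<^esub> x) = rep x" if x: "x \<in> carrier K" and v: "v \<in> carrier ?F" for x v
  proof -
    have "(\<lambda>w. \<mu> w \<otimes>\<^bsub>K\<^esub> (\<mu> v \<otimes>\<^bsub>K\<^esub> x)) ` carrier ?F = (\<lambda>w. \<mu> w \<otimes>\<^bsub>K\<^esub> x) ` carrier ?F" (is "?A = ?B")
    proof
      show "?A \<subseteq> ?B"
      proof clarify
        fix w assume "w \<in> carrier ?F"
        then show "\<mu> w \<otimes>\<^bsub>K\<^esub> (\<mu> v \<otimes>\<^bsub>K\<^esub> x) \<in> ?B"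
          using x v by (intro image_eqI[of _ _ "w \<otimes>\<^bsub>?F\<^esub> v"]) (simp_all add: K.m_assoc)
      qed
      show "?B \<subseteq> ?A"
      proof clarify
        fix w assume "w \<in> carrier ?F"
        then show "\<mu> w \<otimes>\<^bsub>K\<^esub> x \<in> ?A"
          using x v by (intro image_eqI[of _ _ "w \<otimes>\<^bsub>?F\<^esub> inv\<^bsub>?F\<^esub> v"]) (simp_all add: K.m_assoc K.inv_cancel_left)
      qed
    qed
    then show ?thesis by (simp add: rep_def)
  qed
  define word where "word x = (SOME w. w \<in> carrier ?F \<and> x = \<mu> w \<otimes>\<^bsub>K\<^esub> rep x)" for x
  have word: "word x \<in> carrier ?F" "x = \<mu> (word x) \<otimes>\<^bsub>K\<^esub> rep x" if "x \<in> carrier K" for x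
    using someI_ex[of "\<lambda>w. w \<in> carrier ?F \<and> x = \<mu> w \<otimes>\<^bsub>K\<^esub> rep x"] rep[OF that]
    by (auto simp: word_def)
  have word_eqI: "word x = w" if "x \<in> carrier K" "w \<in> carrier ?F" "x = \<mu> w \<otimes>\<^bsub>K\<^esub> rep x" for x w
  proof -
    have "\<mu> (word x) \<otimes>\<^bsub>K\<^esub> rep x = \<mu> w \<otimes>\<^bsub>K\<^esub> rep x" using word[OF that(1)] that(3) by simp
    then have "\<mu> (word x) = \<mu> w"
      using rep_closed[OF that(1)] word(1)[OF that(1)] that(2) K.right_cancel[of "rep x"] by simp
    then show ?thesis using inj word(1)[OF that(1)] that(2) by (auto dest: inj_onD)
  qed
  define \<phi> where "\<phi> x = \<mu> (\<sigma> (word x)) \<otimes>\<^bsub>K\<^esub> rep x" for x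
  have \<phi>_closed: "\<phi> x \<in> carrier K" if "x \<in> carrier K" for x
    using word(1)[OF that] rep_closed[OF that] by (simp add: \<phi>_def)
  have \<phi>\<phi>: "\<phi> (\<phi> x) = x" if x: "x \<in> carrier K" for x
  proof -
    have "rep (\<mu> (\<sigma> (word x)) \<otimes>\<^bsub>K\<^esub> rep x) = rep x"
      "rep (rep x) = rep x"
      using x word(1)[OF x] rep_closed[OF x] rep_mult[of "rep x" "word x"] word(2)[OF x]
        rep_mult[of "rep x" "\<sigma> (word x)"] by auto
    then have r: "rep (\<phi> x) = rep x" by (simp add: \<phi>_def)
    have "word (\<phi> x) = \<sigma> (word x)"
      using word(1)[OF x] x by (intro word_eqI \<phi>_closed) (auto simp: r, simp add: \<phi>_def)
    then show ?thesis
      using word[OF x] r by (simp add: \<phi>_def \<sigma>\<sigma>)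
  qed
  \<comment> \<open>The point of \<open>\<phi>\<close>: conjugation by it exchanges the translations
    by \<open>t\<close> and by \<open>p\<close>, which gives \<open>i t = j p\<close> and
    \<open>i p = j t\<close>.\<close>
  have \<phi>_mult: "\<phi> (\<mu> v \<otimes>\<^bsub>K\<^esub> x) = \<mu> (\<sigma> v) \<otimes>\<^bsub>K\<^esub> \<phi> x"
    if x: "x \<in> carrier K" and v: "v \<in> carrier ?F" for x v
  proof -
    have "word (\<mu> v \<otimes>\<^bsub>K\<^esub> x) = v \<otimes>\<^bsub>?F\<^esub> word x"
    proof (rule word_eqI)
      have "\<mu> v \<otimes>\<^bsub>K\<^esub> x = \<mu> v \<otimes>\<^bsub>K\<^esub> (\<mu> (word x) \<otimes>\<^bsub>K\<^esub> rep x)" using word(2)[OF x] by simp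
      then show "\<mu> v \<otimes>\<^bsub>K\<^esub> x = \<mu> (v \<otimes>\<^bsub>?F\<^esub> word x) \<otimes>\<^bsub>K\<^esub> rep (\<mu> v \<otimes>\<^bsub>K\<^esub> x)"
        using word(1)[OF x] v x rep_closed[OF x] by (simp add: rep_mult K.m_assoc)
    qed (use word(1)[OF x] v x in auto)
    then show ?thesis
      using word(1)[OF x] v x rep_closed[OF x] by (simp add: \<phi>_def rep_mult K.m_assoc)
  qed
  \<comment> \<open>The two actions generate an image of the amalgam in which the first copy still
    embeds, because left translations act freely.\<close>
  let ?L = "BijGroup (carrier K)"
  define i where "i k = (\<lambda>x\<in>carrier K. k \<otimes>\<^bsub>K\<^esub> x)" for k
  define j where "j k = (\<lambda>x\<in>carrier K. \<phi> (k \<otimes>\<^bsub>K\<^esub> \<phi> x))" for k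
  have iB: "i k \<in> Bij (carrier K)" if "k \<in> carrier K" for k
    unfolding Bij_def i_def using that
    by (auto intro!: bij_betw_byWitness[where f' = "\<lambda>x. inv\<^bsub>K\<^esub> k \<otimes>\<^bsub>K\<^esub> x"] simp: K.inv_cancel_left)
  have jB: "j k \<in> Bij (carrier K)" if "k \<in> carrier K" for k
    unfolding Bij_def j_def using that
    by (auto intro!: bij_betw_byWitness[where f' = "\<lambda>x. \<phi> (inv\<^bsub>K\<^esub> k \<otimes>\<^bsub>K\<^esub> \<phi> x)"]
        simp: K.inv_cancel_left \<phi>\<phi> \<phi>_closed)
  have "i \<in> hom K ?L"
    using iB by (auto simp: hom_def BijGroup_def compose_def i_def K.m_assoc fun_eq_iff restrict_def)
  moreover have "j \<in> hom K ?L"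
    using jB by (auto simp: hom_def BijGroup_def compose_def j_def K.m_assoc \<phi>\<phi> \<phi>_closed fun_eq_iff restrict_def)
  moreover have "inj_on i (carrier K)"
  proof (rule inj_onI)
    fix x y assume xy: "x \<in> carrier K" "y \<in> carrier K" "i x = i y"
    have "i x \<one>\<^bsub>K\<^esub> = i y \<one>\<^bsub>K\<^esub>" using xy(3) by simp
    then show "x = y" using xy(1,2) by (simp add: i_def)
  qed
  moreover have "i t = j p"
    using \<phi>_mult[of "\<phi> _" "gen False"] tp
    by (auto simp: i_def j_def fun_eq_iff restrict_def \<mu>_gen \<sigma>_gen \<phi>\<phi> \<phi>_closed gen_in_free_group)
  moreover have "i p = j t"
    using \<phi>_mult[of "\<phi> _" "gen True"] tp
    by (auto simp: i_def j_def fun_eq_iff restrict_def \<mu>_gen \<sigma>_gen \<phi>\<phi> \<phi>_closed gen_in_free_group)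
  ultimately show ?thesis using group_BijGroup by blast
qed

section \<open>A permutation model of Baumslag's one-relator group\<close>

text \<open>A tree-like partial injection sends \<open>(i, v)\<close> to \<open>(0, (i, True) # v)\<close> and its inverse sends \<open>(j, v)\<close>
  to \<open>(0, (j, False) # v)\<close>, whenever this is not a backtracking step. The innermost case only serves to
  make the function total and bijective on all lists, reduced or not.\<close>

definition tree_step :: "nat \<times> (nat \<times> bool) list \<Rightarrow> nat \<times> (nat \<times> bool) list" where
  "tree_step = (\<lambda>(i, v). case v of
      (j, False) # v' \<Rightarrow> if i = 0 then
          (case v' of (k, True) # u \<Rightarrow> if j = 0 then (0, (0, True) # (k, False) # u) else (j, v')
            | _ \<Rightarrow> (j, v'))
        else (0, (i, True) # v)
    | _ \<Rightarrow> (0, (i, True) # v))"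

definition tree_back :: "nat \<times> (nat \<times> bool) list \<Rightarrow> nat \<times> (nat \<times> bool) list" where
  "tree_back = (\<lambda>(i, v). case v of
      (j, True) # v' \<Rightarrow> if i = 0 then
          (case v' of (k, False) # u \<Rightarrow> if j = 0 then (0, (0, False) # (k, True) # u) else (j, v')
            | _ \<Rightarrow> (j, v'))
        else (0, (i, False) # v)
    | _ \<Rightarrow> (0, (i, False) # v))"

lemma tree_step_back: "tree_step (tree_back x) = x" "tree_back (tree_step x) = x"
  by (cases x, auto simp: tree_step_def tree_back_def split: list.splits bool.splits prod.splits if_splits)+

text \<open>These are the steps that extend the path; reading a reduced word from the base point
  below uses no others.\<close>

lemma tree_step_forward:
  "\<not> (i = 0 \<and> v \<noteq> [] \<and> \<not> snd (hd v)) \<Longrightarrow> tree_step (i, v) = (0, (i, True) # v)"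
  "\<not> (i = 0 \<and> v \<noteq> [] \<and> snd (hd v)) \<Longrightarrow> tree_back (i, v) = (0, (i, False) # v)"
  by (auto simp: tree_step_def tree_back_def split: list.splits bool.splits)

lemma countable_infinite_bij_nat:
  assumes "countable A" "infinite A"
  obtains e :: "'a \<Rightarrow> nat" where "bij_betw e A UNIV"
  using assms to_nat_on_infinite by blast

text \<open>The affine group of maps \<open>2\<^sup>k x + d\<close>, with the left translations by \<open>x + 1\<close> and \<open>2 x\<close>,
  in coordinates in which the first (second) translation is the shift of the integer component.\<close>

lemma affine_coordinates:
  obtains ca cb :: "int \<times> rat \<Rightarrow> int \<times> nat" where "bij ca" "bij cb"
    "\<And>k d. ca (k, d + 1) = (fst (ca (k, d)) + 1, snd (ca (k, d)))"
    "\<And>k d. cb (k + 1, 2 * d) = (fst (cb (k, d)) + 1, snd (cb (k, d)))"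
    "\<And>k d k' d'. snd (ca (k, d)) = snd (ca (k', d')) \<Longrightarrow> k = k'"
    "\<And>k d k' d'. snd (cb (k, d)) = snd (cb (k', d')) \<Longrightarrow> d * 2 powi (k' - k) = d'"
proof -
  let ?I = "(UNIV :: int set) \<times> {q :: rat. 0 \<le> q \<and> q < 1}"
  have "infinite ?I" using infinite_UNIV_int by (auto dest!: finite_cartesian_productD1 intro!: exI[of _ 0])
  then obtain e1 :: "int \<times> rat \<Rightarrow> nat" where e1: "bij_betw e1 ?I UNIV"
    using countable_infinite_bij_nat[of ?I] by (metis countableI_type)
  have "infinite (UNIV :: rat set)" by (rule infinite_UNIV_char_0)
  then obtain e2 :: "rat \<Rightarrow> nat" where e2: "bij_betw e2 UNIV UNIV"
    using countable_infinite_bij_nat[of "UNIV :: rat set"] by (metis countableI_type)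
  \<comment> \<open>The orbit of \<open>(k, d)\<close> under \<open>d \<mapsto> d + 1\<close> is
    determined by \<open>(k, frac d)\<close>, the one under
    \<open>(k, d) \<mapsto> (k + 1, 2 d)\<close> by \<open>d / 2 ^ k\<close>. Both kinds of orbits
    are countably infinite in number, so a numbering by \<open>nat\<close> allows them to be
    matched.\<close>
  define ca where "ca = (\<lambda>(k :: int, d :: rat). (\<lfloor>d\<rfloor>, e1 (k, frac d)))"
  define cb where "cb = (\<lambda>(k :: int, d :: rat). (k, e2 (d * 2 powi (- k))))"
  have inj1: "e1 (k, frac d) = e1 (k', frac d') \<longleftrightarrow> k = k' \<and> frac d = frac d'" for k k' d d'
    using inj_on_eq_iff[OF bij_betw_imp_inj_on[OF e1], of "(k, frac d)" "(k', frac d')"]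
    by (simp add: frac_lt_1)
  have inj2: "e2 d = e2 d' \<longleftrightarrow> d = d'" for d d'
    using bij_betw_imp_inj_on[OF e2] by (simp add: inj_eq)
  have "bij ca"
  proof (rule bijI)
    show "inj ca"
    proof (rule injI)
      fix x y assume xy: "ca x = ca y"
      obtain k d k' d' where p: "x = (k, d)" "y = (k', d')" by (cases x, cases y)
      have "k = k'" "\<lfloor>d\<rfloor> = \<lfloor>d'\<rfloor>" "frac d = frac d'" using xy by (simp_all add: p ca_def inj1)
      then show "x = y" by (simp add: p frac_def)
    qed
    show "surj ca"
    proof (unfold surj_def, rule allI)
      show "\<exists>x. y = ca x" for y
      proof -
        obtain m n where y: "y = (m, n)" by (cases y)
        have "n \<in> e1 ` ?I" using e1 by (simp add: bij_betw_def)
        then obtain k q where "n = e1 (k, q)" "0 \<le> q" "q < 1" by auto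
        then have "y = ca (k, of_int m + q)"
          using frac_unique_iff[of "of_int m + q" q] floor_unique[of m "of_int m + q"] by (simp add: y ca_def)
        then show ?thesis ..
      qed
    qed
  qed
  moreover have "bij cb"
  proof (rule bijI)
    show "inj cb" by (auto simp: inj_def cb_def inj2)
    show "surj cb"
    proof (unfold surj_def, rule allI)
      show "\<exists>x. y = cb x" for y
      proof -
        obtain m n where y: "y = (m, n)" by (cases y)
        have "n \<in> e2 ` UNIV" using e2 by (simp add: bij_betw_def)
        then obtain q where "n = e2 q" by auto
        then have "y = cb (m, q * 2 powi m)" by (simp add: y cb_def power_int_minus mult.assoc)
        then show ?thesis ..
      qed
    qed
  qed
  moreover have "ca (k, d + 1) = (fst (ca (k, d)) + 1, snd (ca (k, d)))" for k d
    by (simp add: ca_def frac_1_eq)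
  moreover have "cb (k + 1, 2 * d) = (fst (cb (k, d)) + 1, snd (cb (k, d)))" for k d
    by (simp add: cb_def power_int_add power_int_diff power_int_minus field_simps)
  moreover have "k = k'" if "snd (ca (k, d)) = snd (ca (k', d'))" for k d k' d'
    using that by (simp add: ca_def inj1)
  moreover have "d * 2 powi (k' - k) = d'" if "snd (cb (k, d)) = snd (cb (k', d'))" for k d k' d'
    using that by (simp add: cb_def inj2 power_int_diff power_int_minus field_simps)
  ultimately show ?thesis by (rule that)
qed

text \<open>The two stable letters below have the tree-like normal form of an HNN extension; \<open>p\<close> moves every
  orbit of the two translations off itself, so that reduced words in \<open>t\<close> and \<open>p\<close> never backtrack.\<close>

lemma baumslag_group_exists:
  "\<exists>(K :: (((int \<times> rat) \<times> (nat \<times> bool) list) \<Rightarrow> ((int \<times> rat) \<times> (nat \<times> bool) list)) monoid) a t.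
    group K \<and> a \<in> carrier K \<and> t \<in> carrier K \<and>
    commutator K a (t \<otimes>\<^bsub>K\<^esub> a \<otimes>\<^bsub>K\<^esub> inv\<^bsub>K\<^esub> t) = inv\<^bsub>K\<^esub> a \<and>
    (\<forall>n>0. a [^]\<^bsub>K\<^esub> (n :: nat) \<noteq> \<one>\<^bsub>K\<^esub>) \<and>
    (\<forall>w \<in> carrier (free_group UNIV).
      free_eval K (\<lambda>b. if b then t else commutator K a t) w = \<one>\<^bsub>K\<^esub> \<longrightarrow> w = [])"
proof -
  obtain ca cb :: "int \<times> rat \<Rightarrow> int \<times> nat" where bij: "bij ca" "bij cb"
    and ca: "\<And>k d. ca (k, d + 1) = (fst (ca (k, d)) + 1, snd (ca (k, d)))"
    and cb: "\<And>k d. cb (k + 1, 2 * d) = (fst (cb (k, d)) + 1, snd (cb (k, d)))"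
    and orb_a: "\<And>k d k' d'. snd (ca (k, d)) = snd (ca (k', d')) \<Longrightarrow> k = k'"
    and orb_b: "\<And>k d k' d'. snd (cb (k, d)) = snd (cb (k', d')) \<Longrightarrow> d * 2 powi (k' - k) = d'"
    using affine_coordinates by blast
  define ia ib where "ia = inv_into UNIV ca" and "ib = inv_into UNIV cb"
  have iv: "ca (ia x) = x" "ia (ca y) = y" "cb (ib x) = x" "ib (cb y) = y" for x y
    using bij by (simp_all add: ia_def ib_def bij_is_surj surj_f_inv_f bij_is_inj)
  let ?X = "UNIV :: ((int \<times> rat) \<times> (nat \<times> bool) list) set"
  let ?K = "BijGroup ?X"
  interpret K: group ?K by (rule group_BijGroup)
  have carK: "f \<in> carrier ?K \<longleftrightarrow> bij f" for f by (simp add: BijGroup_def Bij_def)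
  have multK: "f \<otimes>\<^bsub>?K\<^esub> g = f \<circ> g" if "bij f" "bij g" for f g
    using that by (simp add: BijGroup_def Bij_def compose_def comp_def restrict_def)
  have oneK: "\<one>\<^bsub>?K\<^esub> = id" by (simp add: BijGroup_def id_def restrict_def)
  have invK: "inv\<^bsub>?K\<^esub> f = g" if "bij f" "bij g" "g \<circ> f = id" for f g
    using that by (intro K.inv_equality) (simp_all add: carK multK oneK)
  define a where "a = (\<lambda>((k, d), v). ((k :: int, d + 1 :: rat), v :: (nat \<times> bool) list))"
  define a' where "a' = (\<lambda>((k, d), v). ((k :: int, d - 1 :: rat), v :: (nat \<times> bool) list))"
  \<comment> \<open>\<open>t\<close> carries orbits of the first translation onto orbits of the
    second and keeps the integer component; hence \<open>t a t\<^sup>-\<^sup>1\<close> acts on the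
    affine part as the second translation, see \<open>ta\<close>. A forward step records on the path
    the orbit that was left.\<close>
  define t where "t = (\<lambda>(s, v). case tree_step (snd (ca s), v) of (j, v') \<Rightarrow> (ib (fst (ca s), j), v'))"
  define t' where "t' = (\<lambda>(s, v). case tree_back (snd (cb s), v) of (j, v') \<Rightarrow> (ia (fst (cb s), j), v'))"
  \<comment> \<open>With \<open>b = t a t\<^sup>-\<^sup>1\<close> this is the action of
    \<open>a b\<^sup>-\<^sup>1\<close>, which is the commutator of \<open>a\<close> and
    \<open>t\<close>.\<close>
  define p where "p = (\<lambda>((k, d), v). ((k - 1 :: int, d / 2 + 1 :: rat), v :: (nat \<times> bool) list))"
  define p' where "p' = (\<lambda>((k, d), v). ((k + 1 :: int, 2 * d - 2 :: rat), v :: (nat \<times> bool) list))"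
  have aa: "a' \<circ> a = id" "a \<circ> a' = id" by (auto simp: a_def a'_def fun_eq_iff)
  then have aa': "a' (a x) = x" "a (a' x) = x" for x by (simp_all add: fun_eq_iff del: split_paired_All)
  from aa have a: "bij a" "bij a'" "a' \<circ> a = id" by (blast intro: o_bij)+
  have pp: "p' \<circ> p = id" "p \<circ> p' = id" by (auto simp: p_def p'_def fun_eq_iff field_simps)
  then have p: "bij p" "bij p'" "p' \<circ> p = id" by (blast intro: o_bij)+
  have "t' (t x) = x" for x
  proof -
    obtain s v where x: "x = (s, v)" by (cases x)
    obtain j v' where step: "tree_step (snd (ca s), v) = (j, v')" by fastforce
    then have "tree_back (j, v') = (snd (ca s), v)" by (metis tree_step_back(2))
    then show ?thesis using step by (simp add: x t_def t'_def iv)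
  qed
  moreover have "t (t' x) = x" for x
  proof -
    obtain s v where x: "x = (s, v)" by (cases x)
    obtain j v' where step: "tree_back (snd (cb s), v) = (j, v')" by fastforce
    then have "tree_step (j, v') = (snd (cb s), v)" by (metis tree_step_back(1))
    then show ?thesis using step by (simp add: x t_def t'_def iv)
  qed
  ultimately have tt: "t' (t x) = x" "t (t' x) = x" for x by blast+
  then have "t' \<circ> t = id" "t \<circ> t' = id" by (simp_all add: fun_eq_iff)
  then have t: "bij t" "bij t'" "t' \<circ> t = id" by (blast intro: o_bij)+
  have ta: "t (a (t' ((k, d), v))) = ((k + 1, 2 * d), v)" for k d v
  proof -
    obtain i v' where b: "tree_back (snd (cb (k, d)), v) = (i, v')" by fastforce
    then have f: "tree_step (i, v') = (snd (cb (k, d)), v)" using tree_step_back(1) by metis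
    obtain k' d' where ia: "ia (fst (cb (k, d)), i) = (k', d')" by fastforce
    then have "ca (k', d') = (fst (cb (k, d)), i)" using iv(1) by metis
    then have "ca (k', d' + 1) = (fst (cb (k, d)) + 1, i)" using ca by simp
    then have "t (a (t' ((k, d), v))) = (ib (fst (cb (k, d)) + 1, snd (cb (k, d))), v)"
      by (simp add: t'_def b ia a_def t_def f)
    also have "ib (fst (cb (k, d)) + 1, snd (cb (k, d))) = (k + 1, 2 * d)"
      using cb iv(4) by metis
    finally show ?thesis .
  qed
  have invs: "inv\<^bsub>?K\<^esub> a = a'" "inv\<^bsub>?K\<^esub> t = t'" "inv\<^bsub>?K\<^esub> p = p'"
    using invK a t p by auto
  have b: "t \<otimes>\<^bsub>?K\<^esub> a \<otimes>\<^bsub>?K\<^esub> inv\<^bsub>?K\<^esub> t = t \<circ> a \<circ> t'"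
    using a t by (simp add: invs multK bij_comp)
  have b': "inv\<^bsub>?K\<^esub> (t \<circ> a \<circ> t') = t \<circ> a' \<circ> t'"
    using a t by (intro invK bij_comp) (auto simp: fun_eq_iff tt aa')
  have ta': "t (a' (t' ((k, d), v))) = ((k - 1, d / 2), v)" for k d v
  proof -
    obtain k' d' v' where z: "t (a' (t' ((k, d), v))) = ((k', d'), v')" by (metis surj_pair)
    then have "t' ((k', d'), v') = a' (t' ((k, d), v))" using tt(1) by metis
    then have "t (a (t' ((k', d'), v'))) = ((k, d), v)" by (simp add: aa' tt)
    then show ?thesis unfolding z by (auto simp: ta)
  qed
  have comm_b: "commutator ?K a (t \<otimes>\<^bsub>?K\<^esub> a \<otimes>\<^bsub>?K\<^esub> inv\<^bsub>?K\<^esub> t) = a'"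
    unfolding b unfolding commutator_def b' unfolding invs using a t
    by (simp add: multK bij_comp) (auto simp: fun_eq_iff tt a_def a'_def ta[unfolded a_def] ta'[unfolded a'_def])
  have comm_t: "commutator ?K a t = p"
    unfolding commutator_def invs using a t
    by (auto simp: multK bij_comp fun_eq_iff ta') (auto simp: a_def p_def ta')
  have bij_pow: "bij (a ^^ n)" for n :: nat by (rule bij_fn[OF a(1)])
  have powa: "a [^]\<^bsub>?K\<^esub> n = a ^^ n" for n :: nat
  proof (induction n)
    case (Suc n)
    then show ?case
      using a(1) bij_pow[of n] by (simp add: multK funpow_Suc_right del: funpow.simps)
  qed (simp add: oneK)
  have apow: "(a ^^ n) ((k, d), v) = ((k, d + of_nat n), v)" for n k d v
    by (induction n) (simp_all add: a_def)
  have inf: "a [^]\<^bsub>?K\<^esub> n \<noteq> \<one>\<^bsub>?K\<^esub>" if "0 < n" for n :: nat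
    using that apow[of n 0 0 "[]"] powa by (auto simp: oneK)
  \<comment> \<open>The power \<open>p\<^sup>m\<close>: the map \<open>d / 2 + 1\<close> contracts
    by one half towards its fixed point \<open>2\<close>.\<close>
  define pm where "pm m = (\<lambda>(k :: int, d :: rat). (k - m, d * 2 powi (- m) + 2 - 2 powi (1 - m)))"
    for m :: int
  have pm_0: "pm 0 s = s" for s by (cases s) (simp add: pm_def)
  have pm_p: "p (pm m s, v) = (pm (m + 1) s, v)" "p' (pm m s, v) = (pm (m - 1) s, v)" for m s v
    by (cases s; simp add: pm_def p_def p'_def power_int_diff power_int_minus power_int_add field_simps)+
  have pm_a: "m = 0" if "snd (ca (pm m s)) = snd (ca s)" for m s
  proof (cases s)
    case (Pair k d)
    then show ?thesis using orb_a that unfolding pm_def by fastforce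
  qed
  have pm_b: "m = 0" if "snd (cb (pm m s)) = snd (cb s)" for m s
  proof (cases s)
    case (Pair k d)
    have "snd (cb (k, d)) = snd (cb (k - m, d * 2 powi (- m) + 2 - 2 powi (1 - m)))"
      using that by (simp add: Pair pm_def)
    from orb_b[OF this] have "d * 2 powi (k - m - k) = d * 2 powi (- m) + 2 - 2 powi (1 - m)" .
    then have "2 powi (1 - m) = (2 :: rat)" by simp
    then have "(2 :: rat) powi (1 - m) = 2 powi 1" by simp
    then have "1 - m = 1"
      using power_int_strict_increasing[of "1 - m" 1 "2 :: rat"] power_int_strict_increasing[of 1 "1 - m" "2 :: rat"]
      by (cases "1 - m" "1 :: int" rule: linorder_cases) auto
    then show ?thesis by simp
  qed
  \<comment> \<open>Either the starting point or a position right after a stable letter: a forward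
    step lands in orbit \<open>0\<close> of the other translation and leaves its sign at the head of
    the path.\<close>
  define base where "base s v \<longleftrightarrow> (v = [] \<and> s = (0, 0)) \<or> (v \<noteq> [] \<and> snd (hd v) \<and> snd (cb s) = 0) \<or>
    (v \<noteq> [] \<and> \<not> snd (hd v) \<and> snd (ca s) = 0)" for s and v :: "(nat \<times> bool) list"
  define x0 where "x0 = ((0 :: int, 0 :: rat), [] :: (nat \<times> bool) list)"
  let ?f = "\<lambda>b. if b then t else p" and ?ev = "free_eval ?K (\<lambda>b. if b then t else p)"
  have fc: "?f \<in> UNIV \<rightarrow> carrier ?K" using t p by (simp add: carK)
  have letter: "letter_val ?K ?f (c, e) = (if c then if e then t else t' else if e then p else p')" for c e
    by (simp add: letter_val_def invs)
  have ev: "?ev (l # w) x = letter_val ?K ?f l (?ev w x)" for l w x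
    using K.letter_val_closed[OF fc, of l] K.free_eval_closed[OF fc, of w]
    by (simp add: free_eval_simps carK multK)
  have t_step: "\<exists>s v'. t (pm m s0, v) = (s, v') \<and> base s v' \<and> v' \<noteq> [] \<and> snd (hd v')"
    if "base s0 v" "m = 0 \<longrightarrow> v = [] \<or> snd (hd v)" for m s0 v
  proof -
    have "tree_step (snd (ca (pm m s0)), v) = (0, (snd (ca (pm m s0)), True) # v)"
      using that pm_a[of m s0] by (intro tree_step_forward) (auto simp: base_def)
    then show ?thesis by (simp add: t_def base_def iv)
  qed
  have t'_step: "\<exists>s v'. t' (pm m s0, v) = (s, v') \<and> base s v' \<and> v' \<noteq> [] \<and> \<not> snd (hd v')"
    if "base s0 v" "m = 0 \<longrightarrow> v = [] \<or> \<not> snd (hd v)" for m s0 v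
  proof -
    have "tree_back (snd (cb (pm m s0)), v) = (0, (snd (cb (pm m s0)), False) # v)"
      using that pm_b[of m s0] by (intro tree_step_forward) (auto simp: base_def)
    then show ?thesis by (simp add: t'_def base_def iv)
  qed
  \<comment> \<open>Here \<open>m\<close> is the exponent of \<open>p\<close> collected since the
    last stable letter. If it is nonzero, the point has left orbit \<open>0\<close>. Otherwise the
    path is empty or, the word being reduced, a stable letter that comes next has the sign at its
    head. In no case does that letter backtrack.\<close>
  have inv_word: "\<exists>m s v. ?ev w x0 = (pm m s, v) \<and> base s v \<and> (case w of [] \<Rightarrow> m = 0 \<and> v = []
      | (c, e) # _ \<Rightarrow> if c then m = 0 \<and> v \<noteq> [] \<and> snd (hd v) = e else if e then m > 0 else m < 0)"
    if "reduced_word w" for w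
    using that
  proof (induction w)
    case Nil
    show ?case
      by (intro exI[of _ 0] exI[of _ "(0, 0)"] exI[of _ "[]"]) (simp add: free_eval_simps x0_def oneK pm_0 base_def)
  next
    case (Cons l w)
    obtain c e where l: "l = (c, e)" by (cases l)
    obtain m s v where IH: "?ev w x0 = (pm m s, v)" "base s v"
      and cs: "case w of [] \<Rightarrow> m = 0 \<and> v = []
        | (c, e) # _ \<Rightarrow> if c then m = 0 \<and> v \<noteq> [] \<and> snd (hd v) = e else if e then m > 0 else m < 0"
      using Cons.IH[OF reduced_word_tl[OF Cons.prems]] by blast
    have red: "w = [] \<or> l \<noteq> letter_inv (hd w)" using Cons.prems by (cases w) auto
    have e1: "?ev (l # w) x0 = letter_val ?K ?f l (pm m s, v)" using IH(1) by (simp add: ev)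
    show ?case
    proof (cases c)
      case c: True
      have turn: "m = 0 \<longrightarrow> v = [] \<or> snd (hd v) = e"
        using cs red c by (auto simp: l letter_inv_def split: list.splits if_splits)
      have "\<exists>s' v'. ?ev (l # w) x0 = (s', v') \<and> base s' v' \<and> v' \<noteq> [] \<and> snd (hd v') = e"
        using t_step[OF IH(2), of m] t'_step[OF IH(2), of m] turn
        unfolding e1 by (cases e) (simp_all add: l letter c)
      then show ?thesis using c by (force simp: l pm_0 intro: exI[of _ 0])
    next
      case c: False
      have "if e then m \<ge> 0 else m \<le> 0"
        using cs red c by (auto simp: l letter_inv_def split: list.splits if_splits)
      moreover have "?ev (l # w) x0 = (pm (if e then m + 1 else m - 1) s, v)"
        unfolding e1 by (simp add: l letter c pm_p)
      ultimately show ?thesis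
        using IH(2) c by (intro exI[of _ "if e then m + 1 else m - 1"] exI[of _ s] exI[of _ v]) (auto simp: l)
    qed
  qed
  have free: "w = []" if w: "reduced_word w" "?ev w = \<one>\<^bsub>?K\<^esub>" for w
  proof (rule ccontr)
    assume "w \<noteq> []"
    then obtain c e w' where w': "w = (c, e) # w'" by (cases w) auto
    obtain m s v where *: "?ev w x0 = (pm m s, v)" "base s v"
      "if c then m = 0 \<and> v \<noteq> [] \<and> snd (hd v) = e else if e then m > 0 else m < 0"
      using inv_word[OF w(1)] by (auto simp: w')
    have "pm m s = (0, 0)" "v = []" using *(1) w(2) by (simp_all add: oneK x0_def)
    moreover then have "s = (0, 0)" "m \<noteq> 0" using *(2,3) by (auto simp: base_def split: if_splits)
    ultimately show False by (simp add: pm_def)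
  qed
  have at: "a \<in> carrier ?K" "t \<in> carrier ?K" using a t by (simp_all add: carK)
  have rel: "commutator ?K a (t \<otimes>\<^bsub>?K\<^esub> a \<otimes>\<^bsub>?K\<^esub> inv\<^bsub>?K\<^esub> t) = inv\<^bsub>?K\<^esub> a"
    by (rule trans[OF comm_b]) (simp add: invs)
  have inf': "\<forall>n>0. a [^]\<^bsub>?K\<^esub> (n :: nat) \<noteq> \<one>\<^bsub>?K\<^esub>" using inf by blast
  have free': "\<forall>w \<in> carrier (free_group UNIV).
      free_eval ?K (\<lambda>b. if b then t else commutator ?K a t) w = \<one>\<^bsub>?K\<^esub> \<longrightarrow> w = []"
    unfolding comm_t using free by (simp add: carrier_free_group)
  show ?thesis
    by (rule exI[of _ ?K], rule exI[of _ a], rule exI[of _ t])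
      (intro conjI K.is_group at rel inf' free')
qed

section \<open>The four relators\<close>

text \<open>The indices 0, 1, 2, 3 stand for \<open>a\<close>, \<open>t\<close>, \<open>a'\<close>, \<open>t'\<close>. Writing the relations as a generator times a
  commutator costs nothing and makes the presentation balanced with trivial abelianization.\<close>

definition rel_val :: "('a, 'b) monoid_scheme \<Rightarrow> (nat \<Rightarrow> 'a) \<Rightarrow> nat \<Rightarrow> 'a" where
  "rel_val G f i = f i \<otimes>\<^bsub>G\<^esub>
     (if even i then commutator G (f i) (f (Suc i) \<otimes>\<^bsub>G\<^esub> f i \<otimes>\<^bsub>G\<^esub> inv\<^bsub>G\<^esub> f (Suc i))
      else commutator G (f ((i + 2) mod 4)) (f ((i + 1) mod 4)))"

abbreviation F4 :: "(nat \<times> bool) list monoid" where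
  "F4 \<equiv> free_group {..<4}"

definition relator :: "nat \<Rightarrow> (nat \<times> bool) list" where
  "relator = rel_val F4 gen"

lemma all_less_4: "(\<forall>i<4. P i) \<longleftrightarrow> P 0 \<and> P 1 \<and> P 2 \<and> P (3 :: nat)"
  by (auto simp: less_Suc_eq numeral_eq_Suc)

lemma gen_in_F4: "i < 4 \<Longrightarrow> gen i \<in> carrier F4"
  by (intro gen_in_free_group) simp

lemma rel_val_hom:
  assumes "group_hom G H h" "f \<in> {..<4} \<rightarrow> carrier G" "i < 4"
  shows "h (rel_val G f i) = rel_val H (h \<circ> f) i" "rel_val G f i \<in> carrier G"
proof -
  interpret group_hom G H h by fact
  have "f i \<in> carrier G" if "i < 4" for i using assms(2) that by auto
  moreover have "Suc i < 4" if "even i" using that assms(3) by presburger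
  ultimately show "h (rel_val G f i) = rel_val H (h \<circ> f) i" "rel_val G f i \<in> carrier G"
    using assms(3) by (simp_all add: rel_val_def hom_commutator)
qed

lemma relator_hom:
  assumes "group_hom F4 H h" "i < 4"
  shows "h (relator i) = rel_val H (\<lambda>j. h (gen j)) i" "relator i \<in> carrier F4"
  using rel_val_hom[OF assms(1) _ assms(2), of gen] gen_in_F4 by (auto simp: relator_def comp_def)

lemma relator_closed: "i < 4 \<Longrightarrow> relator i \<in> carrier F4"
  using relator_hom(2)[of F4 "\<lambda>x. x"] by (simp add: group_homI group_free_group hom_def)

lemma infinite_quotient:
  obtains L :: "(((int \<times> rat) \<times> (nat \<times> bool) list \<Rightarrow> (int \<times> rat) \<times> (nat \<times> bool) list) \<Rightarrow>
      (int \<times> rat) \<times> (nat \<times> bool) list \<Rightarrow> (int \<times> rat) \<times> (nat \<times> bool) list) monoid"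
    and \<pi> where "group L" "\<pi> \<in> hom F4 L" "\<And>i. i < 4 \<Longrightarrow> \<pi> (relator i) = \<one>\<^bsub>L\<^esub>"
    "\<And>n. 0 < n \<Longrightarrow> \<pi> (gen 0) [^]\<^bsub>L\<^esub> (n :: nat) \<noteq> \<one>\<^bsub>L\<^esub>"
proof -
  obtain K :: "((int \<times> rat) \<times> (nat \<times> bool) list \<Rightarrow> (int \<times> rat) \<times> (nat \<times> bool) list) monoid" and a t
    where K: "group K" "a \<in> carrier K" "t \<in> carrier K"
      "commutator K a (t \<otimes>\<^bsub>K\<^esub> a \<otimes>\<^bsub>K\<^esub> inv\<^bsub>K\<^esub> t) = inv\<^bsub>K\<^esub> a"
      "\<And>n. 0 < n \<Longrightarrow> a [^]\<^bsub>K\<^esub> (n :: nat) \<noteq> \<one>\<^bsub>K\<^esub>"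
      "\<And>w. w \<in> carrier (free_group UNIV) \<Longrightarrow>
        free_eval K (\<lambda>b. if b then t else commutator K a t) w = \<one>\<^bsub>K\<^esub> \<Longrightarrow> w = []"
    using baumslag_group_exists by blast
  interpret K: group K by fact
  have "commutator K a t \<in> carrier K" using K by simp
  from swap_amalgam[OF K(1,3) this K(6)]
  obtain L :: "((((int \<times> rat) \<times> (nat \<times> bool) list \<Rightarrow> (int \<times> rat) \<times> (nat \<times> bool) list) \<Rightarrow>
      (int \<times> rat) \<times> (nat \<times> bool) list \<Rightarrow> (int \<times> rat) \<times> (nat \<times> bool) list)) monoid" and i j
    where L: "group L" "i \<in> hom K L" "inj_on i (carrier K)" "j \<in> hom K L"
      "i t = j (commutator K a t)" "i (commutator K a t) = j t"
    by blast
  interpret L: group L by fact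
  interpret i: group_hom K L i using K L by (intro group_homI)
  interpret j: group_hom K L j using K L by (intro group_homI)
  define f where "f = (\<lambda>k :: nat. if k = 0 then i a else if k = 1 then i t else if k = 2 then j a else j t)"
  have f: "f \<in> {..<4} \<rightarrow> carrier L" using K by (auto simp: f_def)
  let ?\<pi> = "free_eval L f"
  have hom: "?\<pi> \<in> hom F4 L" by (rule L.free_eval_hom[OF f])
  interpret \<pi>: group_hom F4 L ?\<pi> using hom L group_free_group by (intro group_homI)
  have gen: "?\<pi> (gen k) = f k" if "k < 4" for k using f that by (intro L.free_eval_gen) auto
  have tat: "h (commutator K a (t \<otimes>\<^bsub>K\<^esub> a \<otimes>\<^bsub>K\<^esub> inv\<^bsub>K\<^esub> t)) = commutator L (h a) (h t \<otimes>\<^bsub>L\<^esub> h a \<otimes>\<^bsub>L\<^esub> inv\<^bsub>L\<^esub> h t)"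
    if "group_hom K L h" for h
    using K(2,3) K.m_closed K.inv_closed
    by (simp only: group_hom.hom_commutator[OF that] group_hom.hom_mult[OF that] group_hom.hom_inv[OF that])
  have comm: "x \<otimes>\<^bsub>L\<^esub> commutator L z y = \<one>\<^bsub>L\<^esub>" if "x = commutator L y z" "y \<in> carrier L" "z \<in> carrier L" for x y z
    using that by (simp add: commutator_def L.m_assoc L.inv_cancel_left)
  \<comment> \<open>Relators \<open>0\<close> and \<open>2\<close> are the Baumslag relation in the
    two copies; relators \<open>1\<close> and \<open>3\<close> are the gluing
    \<open>t = [a', t']\<close> and \<open>t' = [a, t]\<close>.\<close>
  have "rel_val L f 0 = \<one>\<^bsub>L\<^esub>"
    using tat[OF i.group_hom_axioms, symmetric] K(2-4) by (simp add: rel_val_def f_def)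
  moreover have "rel_val L f 2 = \<one>\<^bsub>L\<^esub>"
    using tat[OF j.group_hom_axioms, symmetric] K(2-4) by (simp add: rel_val_def f_def)
  moreover have "rel_val L f 1 = \<one>\<^bsub>L\<^esub>"
    using comm[of "i t" "j a" "j t"] j.hom_commutator[of a t] L(5) K(2,3)
    by (simp add: rel_val_def f_def)
  moreover have "rel_val L f 3 = \<one>\<^bsub>L\<^esub>"
    using comm[of "j t" "i a" "i t"] i.hom_commutator[of a t] L(6) K(2,3)
    by (simp add: rel_val_def f_def)
  ultimately have "\<forall>k<4. rel_val L f k = \<one>\<^bsub>L\<^esub>" unfolding all_less_4 by blast
  moreover have "rel_val L (\<lambda>k. ?\<pi> (gen k)) k = rel_val L f k" if "k < 4" for k
  proof -
    have "Suc k < 4" if "even k" using that \<open>k < 4\<close> by presburger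
    then show ?thesis using that by (simp add: rel_val_def gen)
  qed
  ultimately have "?\<pi> (relator k) = \<one>\<^bsub>L\<^esub>" if "k < 4" for k
    using relator_hom(1)[OF \<pi>.group_hom_axioms that] that by simp
  moreover have "?\<pi> (gen 0) [^]\<^bsub>L\<^esub> n \<noteq> \<one>\<^bsub>L\<^esub>" if n: "0 < n" for n :: nat
  proof
    assume "?\<pi> (gen 0) [^]\<^bsub>L\<^esub> n = \<one>\<^bsub>L\<^esub>"
    then have "f 0 [^]\<^bsub>L\<^esub> n = \<one>\<^bsub>L\<^esub>" using gen[of 0] by simp
    then have "i (a [^]\<^bsub>K\<^esub> n) = i \<one>\<^bsub>K\<^esub>" using K(2) by (simp add: f_def i.hom_nat_pow)
    then have "a [^]\<^bsub>K\<^esub> n = \<one>\<^bsub>K\<^esub>"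
      using inj_on_eq_iff[OF L(3), of "a [^]\<^bsub>K\<^esub> n" "\<one>\<^bsub>K\<^esub>"] K(2) by simp
    then show False using K(5)[OF n] by simp
  qed
  ultimately show ?thesis using that L(1) hom by blast
qed

section \<open>Finite quotients\<close>

text \<open>Otherwise let \<open>p\<close> be the least prime factor of \<open>n\<close>. The order
  of \<open>2\<close> modulo \<open>p\<close> divides both \<open>n\<close> and
  \<open>p - 1\<close>. A prime factor of that order would divide \<open>n\<close> and be smaller
  than \<open>p\<close>, so the order is \<open>1\<close> and \<open>p\<close> divides
  \<open>2 - 1\<close>.\<close>

lemma dvd_two_power_minus_1_imp_eq_1:
  assumes "n dvd 2 ^ n - (1 :: nat)" "0 < n"
  shows "n = 1"
proof (rule ccontr)
  assume "n \<noteq> 1"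
  define p where "p = (LEAST p. prime p \<and> p dvd n)"
  have p: "prime p" "p dvd n"
    unfolding p_def using LeastI_ex[OF prime_factor_nat[OF \<open>n \<noteq> 1\<close>]] by blast+
  have least: "p \<le> q" if "prime q" "q dvd n" for q
    unfolding p_def using that by (intro Least_le) simp
  have "p dvd 2 ^ n - 1" using p(2) assms(1) dvd_trans by blast
  then have c: "[2 ^ n = 1] (mod p)"
    using cong_diff_iff_cong_0_nat[of 1 "2 ^ n" p] by (simp add: cong_0_iff)
  have d: "ord p 2 dvd n" using c ord_divides by blast
  have "ord p 2 = 1"
  proof (rule ccontr)
    assume "ord p 2 \<noteq> 1"
    then obtain q where q: "prime q" "q dvd ord p 2" using prime_factor_nat by blast
    have "coprime p 2"
    proof (rule ccontr)
      assume "\<not> coprime p 2"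
      then have "2 dvd p" by simp
      then have "p = 2" using primes_dvd_imp_eq[of 2 p] two_is_prime_nat p(1) by simp
      then have "even (2 ^ n - (1 :: nat))" using \<open>p dvd 2 ^ n - 1\<close> by simp
      then show False using assms(2) by simp
    qed
    then have "ord p 2 dvd p - 1"
      using order_divides_totient[of p 2] totient_prime[OF p(1)] by simp
    then have "q \<le> p - 1" using q(2) prime_gt_1_nat[OF p(1)] by (intro dvd_imp_le) auto
    moreover have "p \<le> q" using least[OF q(1)] q(2) d dvd_trans by blast
    ultimately show False using prime_gt_1_nat[OF p(1)] by simp
  qed
  then have "[2 ^ 1 = 1] (mod p)" using ord_divides[of 2 1 p] by simp
  then show False using prime_gt_1_nat[OF p(1)] by (cases "p = 2") (auto simp: cong_def)
qed

lemma (in group) finite_baumslag_relation: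
  assumes fin: "finite (carrier G)" and a: "a \<in> carrier G" and t: "t \<in> carrier G"
    and rel: "a \<otimes> commutator G a (t \<otimes> a \<otimes> inv t) = \<one>"
  shows "a = \<one>"
proof -
  define b where "b = t \<otimes> a \<otimes> inv t"
  have b: "b \<in> carrier G" using a t by (simp add: b_def)
  have bn: "b [^] n = t \<otimes> a [^] n \<otimes> inv t" for n :: nat
  proof (induction n)
    case (Suc n)
    then show ?case using a t by (simp add: b_def m_assoc inv_cancel_left)
  qed (use t in simp)
  have "b \<otimes> a \<otimes> inv b = b \<otimes> a \<otimes> inv b \<otimes> (a \<otimes> commutator G a b)"
    using rel a b by (simp add: b_def)
  have "a \<otimes> a \<otimes> (b \<otimes> inv a \<otimes> inv b) = \<one>"
    using rel a b by (simp add: b_def[symmetric] commutator_def m_assoc)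
  then have "a \<otimes> a = inv (b \<otimes> inv a \<otimes> inv b)" using a b by (intro inv_equality[symmetric]) auto
  then have conj: "b \<otimes> a \<otimes> inv b = a [^] (2 :: nat)"
    using a b by (simp add: inv_mult_group m_assoc numeral_2_eq_2)
  have conj_pow: "b \<otimes> a [^] m \<otimes> inv b = a [^] (2 * m)" for m :: nat
  proof (induction m)
    case (Suc m)
    have "b \<otimes> a [^] Suc m \<otimes> inv b = (b \<otimes> a [^] m \<otimes> inv b) \<otimes> (b \<otimes> a \<otimes> inv b)"
      using a b by (simp add: m_assoc inv_cancel_left)
    also have "\<dots> = a [^] (2 * m + 2)" using Suc conj a by (simp add: nat_pow_mult)
    finally show ?case by simp
  qed (use b in simp)
  have iter: "b [^] k \<otimes> a \<otimes> inv (b [^] k) = a [^] (2 ^ k :: nat)" for k :: nat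
  proof (induction k)
    case (Suc k)
    have "b [^] Suc k \<otimes> a \<otimes> inv (b [^] Suc k) = b \<otimes> (b [^] k \<otimes> a \<otimes> inv (b [^] k)) \<otimes> inv b"
      using a b nat_pow_comm[of b k 1] by (simp add: m_assoc inv_mult_group nat_pow_Suc2 del: nat_pow_Suc)
    then show ?case using Suc conj_pow by simp
  qed (use a in simp)
  \<comment> \<open>\<open>b\<close> is a conjugate of \<open>a\<close>, so its power with exponent
    \<open>?n\<close> is trivial; conjugating \<open>a\<close> by that power therefore changes
    nothing, but by \<open>iter\<close> it also raises \<open>a\<close> to the power
    \<open>2 ^ ?n\<close>.\<close>
  let ?n = "group.ord G a"
  have "0 < ?n" using ord_ge_1[OF fin a] by simp
  have "b [^] ?n = \<one>" using bn[of ?n] pow_ord_eq_1[OF a] t by simp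
  then have "a [^] (2 ^ ?n :: nat) = a" using iter[of ?n] a by simp
  then have "a [^] (2 ^ ?n - 1 :: nat) \<otimes> a = \<one> \<otimes> a"
    using nat_pow_mult[OF a, of "2 ^ ?n - 1" 1] a by simp
  then have "a [^] (2 ^ ?n - 1 :: nat) = \<one>" using a by (subst (asm) right_cancel) auto
  then have "?n dvd 2 ^ ?n - 1" using pow_eq_id[OF a] by simp
  from dvd_two_power_minus_1_imp_eq_1[OF this \<open>0 < ?n\<close>] show ?thesis
    using pow_ord_eq_1[OF a] a by simp
qed

lemma rel_val_1: "rel_val G f 1 = f 1 \<otimes>\<^bsub>G\<^esub> commutator G (f 3) (f 2)"
  and rel_val_3: "rel_val G f 3 = f 3 \<otimes>\<^bsub>G\<^esub> commutator G (f 1) (f 0)"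
proof -
  have "(1 + 2) mod 4 = (3 :: nat)" "(1 + 1) mod 4 = (2 :: nat)" "(3 + 2) mod 4 = (1 :: nat)"
    "(3 + 1) mod 4 = (0 :: nat)" "odd (1 :: nat)" "odd (3 :: nat)" by simp_all
  then show "rel_val G f 1 = f 1 \<otimes>\<^bsub>G\<^esub> commutator G (f 3) (f 2)"
    "rel_val G f 3 = f 3 \<otimes>\<^bsub>G\<^esub> commutator G (f 1) (f 0)"
    by (simp_all only: rel_val_def if_False)
qed

lemma finite_quotient_trivial:
  assumes "group_hom F4 H h" "finite (carrier H)"
    and rel: "\<And>i. i < 4 \<Longrightarrow> h (relator i) = \<one>\<^bsub>H\<^esub>" and w: "w \<in> carrier F4"
  shows "h w = \<one>\<^bsub>H\<^esub>"
proof -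
  interpret group_hom F4 H h by fact
  define f where "f i = h (gen i)" for i
  have f: "f i \<in> carrier H" if "i < 4" for i using gen_in_F4[OF that] by (simp add: f_def)
  have r: "rel_val H f i = \<one>\<^bsub>H\<^esub>" if "i < 4" for i
    using relator_hom(1)[OF group_hom_axioms that] rel[OF that] by (simp add: f_def[abs_def])
  have "f 0 = \<one>\<^bsub>H\<^esub>"
    by (rule H.finite_baumslag_relation[OF assms(2), of _ "f 1"]) (use f r[of 0] in \<open>auto simp: rel_val_def\<close>)
  moreover have "f 2 = \<one>\<^bsub>H\<^esub>"
    by (rule H.finite_baumslag_relation[OF assms(2), of _ "f 3"])
      (use f r[of 2] in \<open>auto simp: rel_val_def numeral_eq_Suc\<close>)
  \<comment> \<open>With \<open>a\<close> and \<open>a'\<close> gone, the commutators in relators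
    \<open>1\<close> and \<open>3\<close> collapse and leave \<open>t\<close> and
    \<open>t'\<close>.\<close>
  moreover have "f 1 = \<one>\<^bsub>H\<^esub>"
    using r[of 1] f[of 1] f[of 3] \<open>f 2 = \<one>\<^bsub>H\<^esub>\<close> unfolding rel_val_1 by (simp add: commutator_def)
  moreover have "f 3 = \<one>\<^bsub>H\<^esub>"
    using r[of 3] f[of 3] f[of 1] \<open>f 0 = \<one>\<^bsub>H\<^esub>\<close> unfolding rel_val_3 by (simp add: commutator_def)
  ultimately have "\<forall>i<4. f i = \<one>\<^bsub>H\<^esub>" unfolding all_less_4 by simp
  then show ?thesis
    by (intro free_group_hom_eq[OF H.is_group homh trivial_hom _ w]) (auto simp: f_def)
qed

section \<open>The normal subgroup generated by the relators\<close>

lemma (in group) normal_closure_normal: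
  assumes "S \<subseteq> carrier G"
  shows "normal_closure G S \<lhd> G"
proof -
  let ?C = "{K. K \<lhd> G \<and> S \<subseteq> K}"
  have ne: "carrier G \<in> ?C" using assms normal_self by auto
  have "subgroup (\<Inter>?C) G"
    using ne by (intro subgroups_Inter) (auto intro: normal_imp_subgroup)
  then show ?thesis
    unfolding normal_closure_def
  proof (rule normal_invI)
    fix x h assume "x \<in> carrier G" "h \<in> \<Inter>?C"
    then show "x \<otimes> h \<otimes> inv x \<in> \<Inter>?C" by (auto intro: normal.inv_op_closed2[of _ G])
  qed
qed

lemma (in group) normal_closure_superset: "S \<subseteq> normal_closure G S"
  by (auto simp: normal_closure_def)

lemma (in group) normal_closure_minimal: "K \<lhd> G \<Longrightarrow> S \<subseteq> K \<Longrightarrow> normal_closure G S \<subseteq> K"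
  by (auto simp: normal_closure_def)

lemma normal_vimage:
  assumes "group_hom G H h" "N \<lhd> H"
  shows "{x \<in> carrier G. h x \<in> N} \<lhd> G"
proof -
  interpret group_hom G H h by fact
  interpret N: normal N H by fact
  show ?thesis
  proof (rule G.normal_invI)
    show "subgroup {x \<in> carrier G. h x \<in> N} G"
    proof (rule G.subgroupI)
      have "\<one>\<^bsub>G\<^esub> \<in> {x \<in> carrier G. h x \<in> N}" by simp
      then show "{x \<in> carrier G. h x \<in> N} \<noteq> {}" by blast
      show "inv\<^bsub>G\<^esub> x \<in> {x \<in> carrier G. h x \<in> N}" if "x \<in> {x \<in> carrier G. h x \<in> N}" for x
        using that N.m_inv_closed[of "h x"] by simp
      show "x \<otimes>\<^bsub>G\<^esub> y \<in> {x \<in> carrier G. h x \<in> N}"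
        if "x \<in> {x \<in> carrier G. h x \<in> N}" "y \<in> {x \<in> carrier G. h x \<in> N}" for x y
        using that N.m_closed[of "h x" "h y"] by simp
    qed blast
    show "x \<otimes>\<^bsub>G\<^esub> y \<otimes>\<^bsub>G\<^esub> inv\<^bsub>G\<^esub> x \<in> {x \<in> carrier G. h x \<in> N}"
      if "x \<in> carrier G" "y \<in> {x \<in> carrier G. h x \<in> N}" for x y
      using that N.inv_op_closed2[of "h x" "h y"] by simp
  qed
qed

definition Rel :: "(nat \<times> bool) list set" where
  "Rel = normal_closure F4 (relator ` {..<4})"

lemma Rel_normal: "Rel \<lhd> F4"
  unfolding Rel_def by (rule group.normal_closure_normal[OF group_free_group]) (auto intro: relator_closed)

lemma relator_in_Rel: "i < 4 \<Longrightarrow> relator i \<in> Rel"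
  unfolding Rel_def by (rule subsetD[OF group.normal_closure_superset[OF group_free_group]]) simp

lemma Rel_subset:
  assumes "group_hom F4 H h" "N \<lhd> H" "\<And>i. i < 4 \<Longrightarrow> h (relator i) \<in> N" "w \<in> Rel"
  shows "h w \<in> N"
proof -
  have "Rel \<subseteq> {x \<in> carrier F4. h x \<in> N}"
    unfolding Rel_def
  proof (rule group.normal_closure_minimal[OF group_free_group normal_vimage[OF assms(1,2)]])
    show "relator ` {..<4} \<subseteq> {x \<in> carrier F4. h x \<in> N}"
    proof (rule image_subsetI)
      fix i :: nat assume "i \<in> {..<4}"
      then have "i < 4" by simp
      with relator_closed assms(3) show "relator i \<in> {x \<in> carrier F4. h x \<in> N}" by simp
    qed
  qed
  then show ?thesis using assms(4) by blast
qed

lemma normal_image: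
  assumes "group_hom G H h" "h ` carrier G = carrier H" "N \<lhd> G"
  shows "h ` N \<lhd> H"
proof -
  interpret group_hom G H h by fact
  interpret N: normal N G by fact
  have "subgroup (h ` N) H" by (rule subgroup_img_is_subgroup[OF N.subgroup_axioms])
  moreover have "y \<otimes>\<^bsub>H\<^esub> z \<otimes>\<^bsub>H\<^esub> inv\<^bsub>H\<^esub> y \<in> h ` N" if yz: "y \<in> carrier H" "z \<in> h ` N" for y z
  proof -
    obtain x n where x: "x \<in> carrier G" "y = h x" and n: "n \<in> N" "z = h n"
      using yz unfolding assms(2)[symmetric] by auto
    then have "y \<otimes>\<^bsub>H\<^esub> z \<otimes>\<^bsub>H\<^esub> inv\<^bsub>H\<^esub> y = h (x \<otimes>\<^bsub>G\<^esub> n \<otimes>\<^bsub>G\<^esub> inv\<^bsub>G\<^esub> x)"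
      using N.mem_carrier by simp
    then show ?thesis using N.inv_op_closed2[OF x(1) n(1)] by blast
  qed
  ultimately show ?thesis by (simp add: H.normal_inv_iff)
qed

text \<open>Dividing \<open>F4 Mod V\<close> further by the image of \<open>Rel\<close> leaves a
  finite quotient of \<open>F4\<close> in which the relators die, and such a quotient is
  trivial.\<close>

lemma Rel_dense:
  assumes V: "V \<in> finite_index_normals F4" and w: "w \<in> carrier F4"
  shows "\<exists>r\<in>Rel. V #>\<^bsub>F4\<^esub> w = V #>\<^bsub>F4\<^esub> r"
proof -
  let ?H = "F4 Mod V" and ?q = "\<lambda>x. V #>\<^bsub>F4\<^esub> x"
  interpret q: group_hom F4 ?H ?q by (rule finite_index_normals_hom(1)[OF V])
  have sur: "?q ` carrier F4 = carrier ?H" by (simp add: carrier_FactGroup)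
  have N: "?q ` Rel \<lhd> ?H" by (rule normal_image[OF q.group_hom_axioms sur Rel_normal])
  interpret N: normal "?q ` Rel" ?H by (rule N)
  let ?K = "?H Mod (?q ` Rel)" and ?k = "\<lambda>x. ?q ` Rel #>\<^bsub>?H\<^esub> ?q x"
  have "?k \<in> hom F4 ?K"
    using Group.hom_compose[OF q.homh N.r_coset_hom_Mod] by (simp add: comp_def)
  then interpret k: group_hom F4 ?K ?k
    using group_free_group N.factorgroup_is_group by (intro group_homI)
  have "?k w = \<one>\<^bsub>?K\<^esub>"
  proof (rule finite_quotient_trivial[OF k.group_hom_axioms _ _ w])
    show "finite (carrier ?K)"
      using finite_index_normals_hom(2)[OF V] by (simp only: carrier_FactGroup[of ?H] finite_imageI)
    show "?k (relator i) = \<one>\<^bsub>?K\<^esub>" if "i < 4" for i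
      using relator_in_Rel[OF that] relator_closed[OF that] by (simp only: one_FactGroup) (subst N.rcos_eq_self_iff; auto)
  qed
  then have "?q w \<in> ?q ` Rel" using q.hom_closed[OF w] N.rcos_eq_self_iff by (simp only: one_FactGroup)
  then show ?thesis by auto
qed

section \<open>Lifting to central extensions\<close>

lemma relator_form:
  assumes "i < 4"
  obtains c d where "c \<in> carrier F4" "d \<in> carrier F4" "relator i = gen i \<otimes>\<^bsub>F4\<^esub> commutator F4 c d"
proof (cases "even i")
  case True
  then have i: "Suc i < 4" using assms by presburger
  interpret group F4 by (rule group_free_group)
  show ?thesis
    by (rule that[of "gen i" "gen (Suc i) \<otimes>\<^bsub>F4\<^esub> gen i \<otimes>\<^bsub>F4\<^esub> inv\<^bsub>F4\<^esub> gen (Suc i)"])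
      (use True i assms gen_in_F4 in \<open>auto simp: relator_def rel_val_def\<close>)
next
  case False
  then show ?thesis
    by (intro that[of "gen ((i + 2) mod 4)" "gen ((i + 1) mod 4)"])
      (auto simp: relator_def rel_val_def intro: gen_in_F4)
qed

text \<open>This is the vanishing of the second homology of the group presented by the relators: since
  \<open>r\<^sub>i\<close> is \<open>x\<^sub>i\<close> times a commutator, replacing \<open>\<kappa> x\<^sub>i\<close> by \<open>\<kappa> x\<^sub>i (\<kappa> r\<^sub>i)\<^sup>-\<^sup>1\<close> kills
  all relators at once.\<close>

lemma central_lift:
  assumes "group_hom F4 G \<kappa>" "subgroup Z G"
    and comm: "\<And>z w. z \<in> Z \<Longrightarrow> w \<in> carrier F4 \<Longrightarrow> z \<otimes>\<^bsub>G\<^esub> \<kappa> w = \<kappa> w \<otimes>\<^bsub>G\<^esub> z"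
    and abel: "\<And>y z. y \<in> Z \<Longrightarrow> z \<in> Z \<Longrightarrow> y \<otimes>\<^bsub>G\<^esub> z = z \<otimes>\<^bsub>G\<^esub> y"
    and rel: "\<And>i. i < 4 \<Longrightarrow> \<kappa> (relator i) \<in> Z"
  shows "\<exists>\<kappa>'\<in>hom F4 G. (\<forall>i<4. \<kappa>' (relator i) = \<one>\<^bsub>G\<^esub>) \<and>
    (\<forall>w\<in>carrier F4. \<exists>z\<in>Z. \<kappa>' w = \<kappa> w \<otimes>\<^bsub>G\<^esub> z)"
proof -
  interpret group_hom F4 G \<kappa> by fact
  interpret Z: subgroup Z G by fact
  define f where "f i = \<kappa> (gen i) \<otimes>\<^bsub>G\<^esub> inv\<^bsub>G\<^esub> \<kappa> (relator i)" for i
  have f: "f \<in> {..<4} \<rightarrow> carrier G"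
    using gen_in_F4 relator_closed by (auto simp: f_def)
  define \<kappa>' where "\<kappa>' = free_eval G f"
  have hom': "\<kappa>' \<in> hom F4 G" unfolding \<kappa>'_def by (rule H.free_eval_hom[OF f])
  then interpret k': group_hom F4 G \<kappa>' using group_free_group H.is_group by (intro group_homI)
  have gen': "\<kappa>' (gen i) = f i" if "i < 4" for i
    unfolding \<kappa>'_def using f that by (intro H.free_eval_gen) auto
  have ex: "\<exists>z\<in>Z. \<kappa>' w = \<kappa> w \<otimes>\<^bsub>G\<^esub> z" if "w \<in> carrier F4" for w
  proof -
    have "w \<in> generate F4 (gen ` {..<4})" using that generate_free_group by blast
    then show ?thesis
    proof induction
      case one
      then show ?case by (intro bexI[of _ "\<one>\<^bsub>G\<^esub>"]) auto
    next
      case (incl h)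
      then obtain i where "i < 4" "h = gen i" by auto
      then show ?case using rel by (intro bexI[of _ "inv\<^bsub>G\<^esub> \<kappa> (relator i)"]) (auto simp: gen' f_def)
    next
      case (inv h)
      then obtain i where i: "i < 4" "h = gen i" by auto
      have c: "\<kappa> (relator i) \<in> carrier G" "\<kappa> (gen i) \<in> carrier G" "gen i \<in> carrier F4"
        using i relator_closed gen_in_F4 by auto
      have "\<kappa>' (inv\<^bsub>F4\<^esub> h) = \<kappa> (relator i) \<otimes>\<^bsub>G\<^esub> \<kappa> (inv\<^bsub>F4\<^esub> gen i)"
        using i c by (simp add: gen' f_def H.inv_mult_group)
      also have "\<dots> = \<kappa> (inv\<^bsub>F4\<^esub> gen i) \<otimes>\<^bsub>G\<^esub> \<kappa> (relator i)"
        using i c rel by (intro comm) auto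
      finally show ?case using i rel by auto
    next
      case (eng u v)
      have uv: "u \<in> carrier F4" "v \<in> carrier F4" using eng.hyps generate_free_group by blast+
      obtain y z where yz: "y \<in> Z" "\<kappa>' u = \<kappa> u \<otimes>\<^bsub>G\<^esub> y" "z \<in> Z" "\<kappa>' v = \<kappa> v \<otimes>\<^bsub>G\<^esub> z"
        using eng.IH by auto
      have "\<kappa>' (u \<otimes>\<^bsub>F4\<^esub> v) = \<kappa> u \<otimes>\<^bsub>G\<^esub> (y \<otimes>\<^bsub>G\<^esub> \<kappa> v) \<otimes>\<^bsub>G\<^esub> z"
        using uv yz by (simp add: H.m_assoc)
      also have "\<dots> = \<kappa> (u \<otimes>\<^bsub>F4\<^esub> v) \<otimes>\<^bsub>G\<^esub> (y \<otimes>\<^bsub>G\<^esub> z)"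
        using uv yz comm[OF yz(1) uv(2)] by (simp add: H.m_assoc)
      finally show ?case using yz by blast
    qed
  qed
  \<comment> \<open>Elements of \<open>Z\<close> commute with the image of \<open>\<kappa>\<close>
    and with each other, so they cancel from these commutators; hence \<open>\<kappa>\<close> and
    \<open>\<kappa>'\<close> agree on commutators.\<close>
  have comm_eq: "commutator G (x \<otimes>\<^bsub>G\<^esub> y) (x' \<otimes>\<^bsub>G\<^esub> y') = commutator G x x'"
    if "x = \<kappa> u" "x' = \<kappa> v" "u \<in> carrier F4" "v \<in> carrier F4" and y: "y \<in> Z" "y' \<in> Z" for x x' y y' u v
  proof -
    have c: "x \<in> carrier G" "x' \<in> carrier G" "y \<in> carrier G" "y' \<in> carrier G"
      using that by auto
    have 1: "y \<otimes>\<^bsub>G\<^esub> (x' \<otimes>\<^bsub>G\<^esub> r) = x' \<otimes>\<^bsub>G\<^esub> (y \<otimes>\<^bsub>G\<^esub> r)" if "r \<in> carrier G" for r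
      using comm[of y v] that c y \<open>x' = \<kappa> v\<close> \<open>v \<in> carrier F4\<close> by (simp flip: H.m_assoc)
    have ic: "inv\<^bsub>G\<^esub> x = \<kappa> (inv\<^bsub>F4\<^esub> u)" "inv\<^bsub>F4\<^esub> u \<in> carrier F4" using that by auto
    have 2: "y' \<otimes>\<^bsub>G\<^esub> (inv\<^bsub>G\<^esub> x \<otimes>\<^bsub>G\<^esub> r) = inv\<^bsub>G\<^esub> x \<otimes>\<^bsub>G\<^esub> (y' \<otimes>\<^bsub>G\<^esub> r)" if "r \<in> carrier G" for r
      using comm[of y' "inv\<^bsub>F4\<^esub> u"] that c y ic by (simp flip: H.m_assoc)
    have 3: "y \<otimes>\<^bsub>G\<^esub> (y' \<otimes>\<^bsub>G\<^esub> r) = y' \<otimes>\<^bsub>G\<^esub> (y \<otimes>\<^bsub>G\<^esub> r)" if "r \<in> carrier G" for r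
      using abel[of y y'] that c y by (simp flip: H.m_assoc)
    show ?thesis
      using c by (simp add: commutator_def H.inv_mult_group H.m_assoc H.inv_cancel_left 1 2 3)
  qed
  have "\<kappa>' (relator i) = \<one>\<^bsub>G\<^esub>" if i: "i < 4" for i
  proof -
    obtain c d where cd: "c \<in> carrier F4" "d \<in> carrier F4" "relator i = gen i \<otimes>\<^bsub>F4\<^esub> commutator F4 c d"
      using relator_form[OF i] by blast
    obtain y z where yz: "y \<in> Z" "\<kappa>' c = \<kappa> c \<otimes>\<^bsub>G\<^esub> y" "z \<in> Z" "\<kappa>' d = \<kappa> d \<otimes>\<^bsub>G\<^esub> z"
      using ex[OF cd(1)] ex[OF cd(2)] by auto
    have g: "gen i \<in> carrier F4" using gen_in_F4 i by auto
    have F: "commutator F4 c d \<in> carrier F4" using cd G.commutator_closed by blast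
    have "\<kappa>' (commutator F4 c d) = \<kappa> (commutator F4 c d)"
      using cd yz by (simp add: hom_commutator k'.hom_commutator comm_eq)
    \<comment> \<open>Moving the correction factor past the commutator reassembles
      \<open>\<kappa> (relator i)\<close> in front of its own inverse.\<close>
    then have "\<kappa>' (relator i) = \<kappa> (gen i) \<otimes>\<^bsub>G\<^esub> (inv\<^bsub>G\<^esub> \<kappa> (relator i) \<otimes>\<^bsub>G\<^esub> \<kappa> (commutator F4 c d))"
      using cd(3) g F i relator_closed[OF i] by (simp add: gen' f_def H.m_assoc)
    also have "inv\<^bsub>G\<^esub> \<kappa> (relator i) \<otimes>\<^bsub>G\<^esub> \<kappa> (commutator F4 c d) = \<kappa> (commutator F4 c d) \<otimes>\<^bsub>G\<^esub> inv\<^bsub>G\<^esub> \<kappa> (relator i)"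
      using rel[OF i] F by (intro comm) auto
    also have "\<kappa> (gen i) \<otimes>\<^bsub>G\<^esub> (\<kappa> (commutator F4 c d) \<otimes>\<^bsub>G\<^esub> inv\<^bsub>G\<^esub> \<kappa> (relator i)) = \<kappa> (relator i) \<otimes>\<^bsub>G\<^esub> inv\<^bsub>G\<^esub> \<kappa> (relator i)"
      using g F relator_closed[OF i] by (subst (2) cd(3)) (simp add: H.m_assoc)
    finally show ?thesis using relator_closed[OF i] by simp
  qed
  then show ?thesis using hom' ex by blast
qed

text \<open>Conjugation maps \<open>G\<close> into the finite group of permutations of
  \<open>S\<close>, and the centralizer is the kernel of this action.\<close>

lemma (in group) centralizer_finite_index:
  assumes "S \<lhd> G" "finite S"
  shows "{g \<in> carrier G. \<forall>s\<in>S. g \<otimes> s = s \<otimes> g} \<in> finite_index_normals G"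
proof -
  interpret S: normal S G by fact
  define h where "h g = (\<lambda>s\<in>S. g \<otimes> s \<otimes> inv g)" for g
  have hB: "h g \<in> Bij S" if g: "g \<in> carrier G" for g
    unfolding Bij_def h_def
  proof (intro IntI CollectI restrict_extensional bij_betw_byWitness[where f' = "\<lambda>s. inv g \<otimes> s \<otimes> g"])
    show "(\<lambda>s\<in>S. g \<otimes> s \<otimes> inv g) ` S \<subseteq> S" using S.inv_op_closed2[OF g] by auto
    show "(\<lambda>s. inv g \<otimes> s \<otimes> g) ` S \<subseteq> S" using S.inv_op_closed1[OF g] by auto
    show "\<forall>s\<in>S. inv g \<otimes> (\<lambda>s\<in>S. g \<otimes> s \<otimes> inv g) s \<otimes> g = s"
      using g by (simp add: m_assoc inv_cancel_left)
    show "\<forall>s\<in>S. (\<lambda>s\<in>S. g \<otimes> s \<otimes> inv g) (inv g \<otimes> s \<otimes> g) = s"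
      using g S.inv_op_closed1[OF g] by (simp add: m_assoc inv_cancel_left)
  qed
  have "h \<in> hom G (BijGroup S)"
  proof (rule homI)
    show "h x \<in> carrier (BijGroup S)" if "x \<in> carrier G" for x
      using hB[OF that] by (simp add: BijGroup_def)
    show "h (x \<otimes> y) = h x \<otimes>\<^bsub>BijGroup S\<^esub> h y" if xy: "x \<in> carrier G" "y \<in> carrier G" for x y
      using hB xy S.inv_op_closed2[OF xy(2)]
      by (auto simp: BijGroup_def compose_def h_def fun_eq_iff restrict_def m_assoc inv_mult_group)
  qed
  then interpret h: group_hom G "BijGroup S" h
    using group_BijGroup by (intro group_homI is_group)
  have "kernel G (BijGroup S) h \<in> finite_index_normals G"
  proof (rule kernel_finite_index[OF h.group_hom_axioms])
    have "h ` carrier G \<subseteq> S \<rightarrow>\<^sub>E S"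
      using hB by (force simp: Bij_def bij_betw_def extensional_def)
    then show "finite (h ` carrier G)"
      using finite_PiE[of S "\<lambda>_. S"] assms(2) finite_subset by blast
  qed
  moreover have "h g = \<one>\<^bsub>BijGroup S\<^esub> \<longleftrightarrow> (\<forall>s\<in>S. g \<otimes> s = s \<otimes> g)" if g: "g \<in> carrier G" for g
  proof -
    have "h g = \<one>\<^bsub>BijGroup S\<^esub> \<longleftrightarrow> (\<forall>s\<in>S. g \<otimes> s \<otimes> inv g = s)"
      by (auto simp: BijGroup_def h_def fun_eq_iff restrict_def)
    also have "\<dots> \<longleftrightarrow> (\<forall>s\<in>S. g \<otimes> s = s \<otimes> g)"
      using g by (metis S.mem_carrier inv_solve_right' m_closed)
    finally show ?thesis .
  qed
  then have "kernel G (BijGroup S) h = {g \<in> carrier G. \<forall>s\<in>S. g \<otimes> s = s \<otimes> g}"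
    by (auto simp: kernel_def)
  ultimately show ?thesis by simp
qed

section \<open>Complements of finite normal subgroups\<close>

text \<open>The group presented by the relators has no finite quotients, so \<open>G\<close> is generated by \<open>S\<close> and its
  centralizer; the complement is then provided by a lift of \<open>F4\<close> into the centralizer.\<close>

lemma finite_normal_complement:
  assumes q: "group_hom F4 G q" "q ` carrier F4 = carrier G" and S: "S \<lhd> G" "finite S"
    and rel: "\<And>i. i < 4 \<Longrightarrow> q (relator i) \<in> S" and pre: "{w \<in> carrier F4. q w \<in> S} \<subseteq> Rel"
  shows "\<exists>B\<in>finite_index_normals G. B \<inter> S = {\<one>\<^bsub>G\<^esub>}"
proof -
  interpret q: group_hom F4 G q by fact
  interpret S: normal S G by fact
  define C where "C = {g \<in> carrier G. \<forall>s\<in>S. g \<otimes>\<^bsub>G\<^esub> s = s \<otimes>\<^bsub>G\<^esub> g}"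
  have C: "C \<in> finite_index_normals G"
    unfolding C_def by (rule q.H.centralizer_finite_index[OF S])
  interpret C: normal C G using C by (simp add: finite_index_normals_def)
  have q_Rel: "q r \<in> S" if "r \<in> Rel" for r
    using Rel_subset[OF q(1) S(1) rel that] .
  \<comment> \<open>This says \<open>G = S C\<close>. The preimage of \<open>C\<close> has finite
    index in \<open>F4\<close>, so \<open>w\<close> agrees modulo it with an element of
    \<open>Rel\<close>, and \<open>q\<close> sends \<open>Rel\<close> into \<open>S\<close>.\<close>
  have "\<exists>c\<in>C. S #>\<^bsub>G\<^esub> c = S #>\<^bsub>G\<^esub> q w" if w: "w \<in> carrier F4" for w
  proof -
    define V where "V = {w \<in> carrier F4. q w \<in> C}"
    have V: "V \<in> finite_index_normals F4"
      unfolding V_def by (rule finite_index_normals_vimage[OF group_free_group q.homh C])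
    then interpret V: normal V F4 by (simp add: finite_index_normals_def)
    obtain r where r: "r \<in> Rel" "V #>\<^bsub>F4\<^esub> w = V #>\<^bsub>F4\<^esub> r"
      using Rel_dense[OF V w] by blast
    have rc: "r \<in> carrier F4" by (rule subgroup.mem_carrier[OF normal_imp_subgroup[OF Rel_normal] r(1)])
    have "w \<otimes>\<^bsub>F4\<^esub> inv\<^bsub>F4\<^esub> r \<in> V" using r(2) by (simp add: V.rcos_eq_iff[OF w rc])
    then have "q (w \<otimes>\<^bsub>F4\<^esub> inv\<^bsub>F4\<^esub> r) \<in> C" unfolding V_def by blast
    then have c: "q w \<otimes>\<^bsub>G\<^esub> inv\<^bsub>G\<^esub> q r \<in> C"
      using w rc by (simp only: q.hom_mult q.hom_inv q.G.inv_closed)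
    have "q w \<otimes>\<^bsub>G\<^esub> inv\<^bsub>G\<^esub> q r \<otimes>\<^bsub>G\<^esub> inv\<^bsub>G\<^esub> q w \<in> S"
      using S.inv_op_closed2[of "q w" "inv\<^bsub>G\<^esub> q r"] q_Rel[OF r(1)] w by simp
    then show ?thesis
      using c w rc by (intro bexI[of _ "q w \<otimes>\<^bsub>G\<^esub> inv\<^bsub>G\<^esub> q r"]) (simp_all add: S.rcos_eq_iff)
  qed
  note lift = this
  define c where "c i = (SOME c. c \<in> C \<and> S #>\<^bsub>G\<^esub> c = S #>\<^bsub>G\<^esub> q (gen i))" for i
  have c: "c i \<in> C \<and> S #>\<^bsub>G\<^esub> c i = S #>\<^bsub>G\<^esub> q (gen i)" if "i < 4" for i
    unfolding c_def by (rule someI_ex) (use lift[OF gen_in_F4[OF that]] in blast)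
  define \<kappa> where "\<kappa> = free_eval G c"
  have cC: "c \<in> {..<4} \<rightarrow> carrier G"
  proof (rule Pi_I)
    fix i :: nat assume "i \<in> {..<4}"
    then have "i < 4" by simp
    then show "c i \<in> carrier G" using c by (intro C.mem_carrier) blast
  qed
  interpret k: group_hom F4 G \<kappa>
    unfolding \<kappa>_def by (intro group_homI group_free_group q.H.is_group q.H.free_eval_hom[OF cC])
  have k_gen: "\<kappa> (gen i) = c i" if "i < 4" for i
    unfolding \<kappa>_def using cC that by (intro q.H.free_eval_gen) auto
  have k_C: "\<kappa> w \<in> C" if "w \<in> carrier F4" for w
  proof -
    have "w \<in> generate F4 (gen ` {..<4})" using that generate_free_group by blast
    then show ?thesis
    proof induction
      case (eng u v)
      have "u \<in> carrier F4" "v \<in> carrier F4" using eng.hyps generate_free_group by blast+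
      then show ?case using eng by simp
    qed (use c gen_in_F4 in \<open>auto simp: k_gen\<close>)
  qed
  let ?p = "\<lambda>x. S #>\<^bsub>G\<^esub> x"
  have pK: "(\<lambda>w. ?p (f w)) \<in> hom F4 (G Mod S)" if "f \<in> hom F4 G" for f
    using Group.hom_compose[OF that S.r_coset_hom_Mod] by (simp add: comp_def)
  have k_q: "?p (\<kappa> w) = ?p (q w)" if "w \<in> carrier F4" for w
    by (rule free_group_hom_eq[OF S.factorgroup_is_group pK[OF k.homh] pK[OF q.homh] _ that])
      (use c in \<open>simp add: k_gen\<close>)
  \<comment> \<open>\<open>S \<inter> C\<close> is the centre of \<open>S\<close> and commutes with
    the image of \<open>\<kappa>\<close>, so the values of \<open>\<kappa>\<close> on the relators
    are a central obstruction, which \<open>central_lift\<close> removes.\<close>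
  have Z: "subgroup (S \<inter> C) G"
    by (rule q.H.subgroups_Inter_pair[OF S.subgroup_axioms C.subgroup_axioms])
  have k_rel: "\<kappa> (relator i) \<in> S \<inter> C" if "i < 4" for i
  proof -
    have w: "relator i \<in> carrier F4" using that by (rule relator_closed)
    have "?p (\<kappa> (relator i)) = S"
      using k_q[OF w] rel[OF that] w by (simp add: S.rcos_eq_self_iff)
    then show ?thesis using k_C[OF w] w S.rcos_eq_self_iff by simp
  qed
  have zc: "z \<otimes>\<^bsub>G\<^esub> \<kappa> w = \<kappa> w \<otimes>\<^bsub>G\<^esub> z" if "z \<in> S \<inter> C" "w \<in> carrier F4" for z w
    using k_C[OF that(2)] that(1) unfolding C_def by auto
  have zz: "y \<otimes>\<^bsub>G\<^esub> z = z \<otimes>\<^bsub>G\<^esub> y" if "y \<in> S \<inter> C" "z \<in> S \<inter> C" for y z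
    using that unfolding C_def by blast
  obtain \<kappa>' where k': "\<kappa>' \<in> hom F4 G" "\<And>i. i < 4 \<Longrightarrow> \<kappa>' (relator i) = \<one>\<^bsub>G\<^esub>"
    and k'_k: "\<And>w. w \<in> carrier F4 \<Longrightarrow> \<exists>z\<in>S \<inter> C. \<kappa>' w = \<kappa> w \<otimes>\<^bsub>G\<^esub> z"
    using central_lift[OF k.group_hom_axioms Z zc zz k_rel] by blast
  interpret k': group_hom F4 G \<kappa>' using k'(1) by (intro group_homI group_free_group q.H.is_group)
  have k'_C: "\<kappa>' w \<in> C" if "w \<in> carrier F4" for w
    using k'_k[OF that] k_C[OF that] by auto
  have k'_q: "?p (\<kappa>' w) = ?p (q w)" if w: "w \<in> carrier F4" for w
  proof -
    obtain z where z: "z \<in> S" "\<kappa>' w = \<kappa> w \<otimes>\<^bsub>G\<^esub> z" using k'_k[OF w] by auto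
    have "\<kappa> w \<otimes>\<^bsub>G\<^esub> z \<otimes>\<^bsub>G\<^esub> inv\<^bsub>G\<^esub> \<kappa> w \<in> S" using S.inv_op_closed2 z(1) w by simp
    then have "?p (\<kappa>' w) = ?p (\<kappa> w)" using w z by (simp add: S.rcos_eq_iff)
    then show ?thesis using k_q[OF w] by simp
  qed
  have k'_Rel: "\<kappa>' r = \<one>\<^bsub>G\<^esub>" if "r \<in> Rel" for r
    using Rel_subset[OF k'.group_hom_axioms q.H.one_is_normal _ that] k'(2) by simp
  \<comment> \<open>The image of the corrected lift centralizes \<open>S\<close> and together with
    \<open>S\<close> fills \<open>G\<close>; it is therefore normal, and its index is at most the
    size of \<open>S\<close>.\<close>
  define B where "B = \<kappa>' ` carrier F4"
  have B: "subgroup B G" unfolding B_def by (rule k'.img_is_subgroup)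
  interpret B: subgroup B G by (rule B)
  have B_C: "B \<subseteq> C" using k'_C by (auto simp: B_def)
  have decomp: "\<exists>s\<in>S. \<exists>b\<in>B. g = s \<otimes>\<^bsub>G\<^esub> b" if g: "g \<in> carrier G" for g
  proof -
    obtain w where w: "w \<in> carrier F4" "g = q w" using g q(2) by blast
    have "?p g = ?p (\<kappa>' w)" using k'_q[OF w(1)] w(2) by simp
    then have "g \<otimes>\<^bsub>G\<^esub> inv\<^bsub>G\<^esub> \<kappa>' w \<in> S" by (simp only: S.rcos_eq_iff[OF g k'.hom_closed[OF w(1)]])
    then show ?thesis using w g
      by (intro bexI[of _ "g \<otimes>\<^bsub>G\<^esub> inv\<^bsub>G\<^esub> \<kappa>' w"] bexI[of _ "\<kappa>' w"]) (auto simp: B_def q.H.m_assoc)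
  qed
  have sb: "s \<otimes>\<^bsub>G\<^esub> b = b \<otimes>\<^bsub>G\<^esub> s" if "s \<in> S" "b \<in> B" for s b
  proof -
    have "b \<in> C" using B_C that(2) by blast
    then have "b \<otimes>\<^bsub>G\<^esub> s = s \<otimes>\<^bsub>G\<^esub> b" using that(1) unfolding C_def by blast
    then show ?thesis by (rule sym)
  qed
  have "B \<lhd> G"
  proof (rule q.H.normal_invI[OF B])
    fix g b assume g: "g \<in> carrier G" and b: "b \<in> B"
    obtain s b' where s: "s \<in> S" "b' \<in> B" "g = s \<otimes>\<^bsub>G\<^esub> b'" using decomp[OF g] by blast
    have "g \<otimes>\<^bsub>G\<^esub> b \<otimes>\<^bsub>G\<^esub> inv\<^bsub>G\<^esub> g = s \<otimes>\<^bsub>G\<^esub> (b' \<otimes>\<^bsub>G\<^esub> b \<otimes>\<^bsub>G\<^esub> inv\<^bsub>G\<^esub> b') \<otimes>\<^bsub>G\<^esub> inv\<^bsub>G\<^esub> s"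
      using s b by (simp add: q.H.m_assoc q.H.inv_mult_group)
    also have "\<dots> = b' \<otimes>\<^bsub>G\<^esub> b \<otimes>\<^bsub>G\<^esub> inv\<^bsub>G\<^esub> b'"
      using s b sb[of s "b' \<otimes>\<^bsub>G\<^esub> b \<otimes>\<^bsub>G\<^esub> inv\<^bsub>G\<^esub> b'"] by (simp add: q.H.m_assoc)
    finally show "g \<otimes>\<^bsub>G\<^esub> b \<otimes>\<^bsub>G\<^esub> inv\<^bsub>G\<^esub> g \<in> B" using s b by simp
  qed
  then interpret nB: normal B G .
  have "rcosets\<^bsub>G\<^esub> B \<subseteq> (\<lambda>s. B #>\<^bsub>G\<^esub> s) ` S"
  proof
    fix X assume "X \<in> rcosets\<^bsub>G\<^esub> B"
    then obtain g where g: "g \<in> carrier G" "X = B #>\<^bsub>G\<^esub> g" by (auto simp: RCOSETS_def)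
    then obtain s b where s: "s \<in> S" "b \<in> B" "g = s \<otimes>\<^bsub>G\<^esub> b" using decomp by blast
    then have "g \<otimes>\<^bsub>G\<^esub> inv\<^bsub>G\<^esub> s = b" using sb[OF s(1,2)] by (simp add: q.H.m_assoc)
    then have "X = B #>\<^bsub>G\<^esub> s" using g s by (simp add: nB.rcos_eq_iff)
    then show "X \<in> (\<lambda>s. B #>\<^bsub>G\<^esub> s) ` S" using s by blast
  qed
  then have "finite (rcosets\<^bsub>G\<^esub> B)" by (rule finite_subset) (intro finite_imageI S(2))
  then have "B \<in> finite_index_normals G"
    using \<open>B \<lhd> G\<close> by (simp add: finite_index_normals_def)
  moreover have "B \<inter> S = {\<one>\<^bsub>G\<^esub>}"
  proof -
    \<comment> \<open>An element of \<open>S\<close> in this image comes from a word in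
      \<open>Rel\<close>, by \<open>pre\<close>, and \<open>\<kappa>'\<close> kills
      \<open>Rel\<close>.\<close>
    have "b = \<one>\<^bsub>G\<^esub>" if b: "b \<in> B" "b \<in> S" for b
    proof -
      obtain w where w: "w \<in> carrier F4" "b = \<kappa>' w" using b(1) by (auto simp: B_def)
      have "?p (\<kappa>' w) = S" using b(2) w(2) S.rcos_eq_self_iff[OF k'.hom_closed[OF w(1)]] by blast
      then have "?p (q w) = S" using k'_q[OF w(1)] by (rule trans[OF sym, rotated])
      then have "q w \<in> S" by (rule S.rcos_eq_self_iff[OF q.hom_closed[OF w(1)], THEN iffD1])
      then have "w \<in> Rel" using w(1) pre by blast
      then show ?thesis using k'_Rel w by simp
    qed
    then show ?thesis by auto
  qed
  ultimately show ?thesis by blast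
qed

text \<open>In \<open>F4 Mod A\<close> the image of \<open>Rel\<close> is a finite normal subgroup.
  A normal subgroup of finite index that meets it trivially pulls back to the required
  \<open>B\<close>.\<close>

lemma finite_index_in_Rel:
  assumes A: "A \<lhd> F4" "A \<subseteq> Rel" "finite ((\<lambda>r. A #>\<^bsub>F4\<^esub> r) ` Rel)"
  shows "\<exists>B\<in>finite_index_normals F4. B \<inter> Rel \<subseteq> A"
proof -
  let ?G = "F4 Mod A" and ?q = "\<lambda>x. A #>\<^bsub>F4\<^esub> x"
  interpret A: normal A F4 by (rule A)
  interpret R: normal Rel F4 by (rule Rel_normal)
  interpret q: group_hom F4 ?G ?q
    by (intro group_homI group_free_group A.factorgroup_is_group A.r_coset_hom_Mod)
  have sur: "?q ` carrier F4 = carrier ?G" by (simp add: carrier_FactGroup)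
  have S: "?q ` Rel \<lhd> ?G" by (rule normal_image[OF q.group_hom_axioms sur Rel_normal])
  have pre: "{w \<in> carrier F4. ?q w \<in> ?q ` Rel} \<subseteq> Rel"
  proof clarify
    fix w r assume w: "w \<in> carrier F4" and r: "r \<in> Rel" and eq: "?q w = ?q r"
    have "w \<otimes>\<^bsub>F4\<^esub> inv\<^bsub>F4\<^esub> r \<in> Rel" using A.rcos_eq_iff[OF w R.mem_carrier[OF r]] eq A(2) by blast
    then have "w \<otimes>\<^bsub>F4\<^esub> inv\<^bsub>F4\<^esub> r \<otimes>\<^bsub>F4\<^esub> r \<in> Rel" using r by (rule R.m_closed)
    then show "w \<in> Rel" using w r by (simp add: A.m_assoc)
  qed
  obtain B where B: "B \<in> finite_index_normals ?G" "B \<inter> ?q ` Rel = {\<one>\<^bsub>?G\<^esub>}"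
    using finite_normal_complement[OF q.group_hom_axioms sur S A(3) _ pre] relator_in_Rel by blast
  have "{w \<in> carrier F4. ?q w \<in> B} \<inter> Rel \<subseteq> A"
  proof
    fix w assume w: "w \<in> {w \<in> carrier F4. ?q w \<in> B} \<inter> Rel"
    then have "?q w \<in> {\<one>\<^bsub>?G\<^esub>}" unfolding B(2)[symmetric] by blast
    then have "?q w = A" by simp
    moreover have "w \<in> carrier F4" using w by blast
    ultimately show "w \<in> A" using A.rcos_eq_self_iff by blast
  qed
  then show ?thesis
    using finite_index_normals_vimage[OF group_free_group q.homh B(1)] by blast
qed

section \<open>Isomorphisms of profinite completions\<close>

text \<open>It is enough to have one \<open>V\<close> whose trace lies inside \<open>U\<close>: by
  density \<open>N\<close> maps onto \<open>G Mod V\<close>, so the image of \<open>U\<close> there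
  is normal, and its preimage in \<open>G\<close> has trace exactly \<open>U\<close>.\<close>

lemma finite_index_vimage_eq:
  assumes "group_hom N G \<iota>" and V: "V \<in> finite_index_normals G" and U: "U \<in> finite_index_normals N"
    and dense: "\<And>y. y \<in> carrier G \<Longrightarrow> \<exists>x\<in>carrier N. V #>\<^bsub>G\<^esub> y = V #>\<^bsub>G\<^esub> \<iota> x"
    and sub: "{x \<in> carrier N. \<iota> x \<in> V} \<subseteq> U"
  shows "\<exists>W\<in>finite_index_normals G. {x \<in> carrier N. \<iota> x \<in> W} = U"
proof -
  interpret i: group_hom N G \<iota> by fact
  interpret V: normal V G using V by (simp add: finite_index_normals_def)
  interpret U: normal U N using U by (simp add: finite_index_normals_def)
  let ?k = "\<lambda>x. V #>\<^bsub>G\<^esub> \<iota> x"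
  have "?k \<in> hom N (G Mod V)"
    using Group.hom_compose[OF i.homh V.r_coset_hom_Mod] by (simp add: comp_def)
  then interpret k: group_hom N "G Mod V" ?k
    by (intro group_homI i.G.is_group V.factorgroup_is_group)
  have sur: "?k ` carrier N = carrier (G Mod V)"
    using dense by (fastforce simp: carrier_FactGroup)
  have "?k ` U \<lhd> G Mod V" by (rule normal_image[OF k.group_hom_axioms sur U.normal_axioms])
  moreover have "finite (rcosets\<^bsub>G Mod V\<^esub> (?k ` U))"
    using finite_index_normals_hom(2)[OF V] by (auto simp: RCOSETS_def)
  ultimately have "?k ` U \<in> finite_index_normals (G Mod V)" by (simp add: finite_index_normals_def)
  then have "{y \<in> carrier G. V #>\<^bsub>G\<^esub> y \<in> ?k ` U} \<in> finite_index_normals G"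
    by (rule finite_index_normals_vimage[OF i.H.is_group V.r_coset_hom_Mod])
  moreover have "{x \<in> carrier N. \<iota> x \<in> {y \<in> carrier G. V #>\<^bsub>G\<^esub> y \<in> ?k ` U}} = U"
  proof -
    have "x \<in> U" if x: "x \<in> carrier N" and u: "u \<in> U" and eq: "?k x = ?k u" for x u
    proof -
      have uc: "u \<in> carrier N" using u by (rule U.mem_carrier)
      have "\<iota> x \<otimes>\<^bsub>G\<^esub> inv\<^bsub>G\<^esub> \<iota> u \<in> V" using eq x uc V.rcos_eq_iff by simp
      then have "x \<otimes>\<^bsub>N\<^esub> inv\<^bsub>N\<^esub> u \<in> U" using sub x uc by auto
      then have "x \<otimes>\<^bsub>N\<^esub> inv\<^bsub>N\<^esub> u \<otimes>\<^bsub>N\<^esub> u \<in> U" using u by (rule U.m_closed)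
      then show ?thesis using x uc by (simp add: i.G.m_assoc)
    qed
    then show ?thesis using U.mem_carrier by auto
  qed
  ultimately show ?thesis by blast
qed

lemma set_mult_rcos_supset:
  assumes "U \<lhd> G" "V \<lhd> G" "U \<subseteq> V" "x \<in> carrier G"
  shows "V <#>\<^bsub>G\<^esub> (U #>\<^bsub>G\<^esub> x) = V #>\<^bsub>G\<^esub> x"
proof -
  interpret U: normal U G by fact
  interpret V: normal V G by fact
  have "V <#>\<^bsub>G\<^esub> U = V"
  proof
    show "V <#>\<^bsub>G\<^esub> U \<subseteq> V" using assms(3) by (auto simp: set_mult_def)
    show "V \<subseteq> V <#>\<^bsub>G\<^esub> U"
    proof
      fix v assume v: "v \<in> V"
      then show "v \<in> V <#>\<^bsub>G\<^esub> U"
        unfolding set_mult_def by (intro UN_I[OF v] UN_I[OF U.one_closed]) simp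
    qed
  qed
  then show ?thesis using U.setmult_rcos_assoc[OF V.subset U.subset assms(4)] by simp
qed

lemma (in normal) mem_rcos_iff:
  assumes "x \<in> carrier G" "y \<in> carrier G"
  shows "x \<in> H #> y \<longleftrightarrow> x \<otimes> inv y \<in> H"
proof -
  have "x \<in> H #> y \<longleftrightarrow> H #> x = H #> y"
    using repr_independence[OF _ assms(2) subgroup_axioms] rcos_self[OF assms(1) subgroup_axioms] by metis
  then show ?thesis using rcos_eq_iff[OF assms] by simp
qed

text \<open>Taking preimages under \<open>\<iota>\<close> is an order isomorphism between the normal
  subgroups of finite index of \<open>G\<close> and those of \<open>N\<close>, and corresponding
  quotients are isomorphic. So the two inverse systems of finite groups coincide.\<close>

lemma same_profinite_completionI:
  fixes N :: "('a, 'c) monoid_scheme" and G :: "('b, 'd) monoid_scheme"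
  assumes "group_hom N G \<iota>"
    and dense: "\<And>V y. V \<in> finite_index_normals G \<Longrightarrow> y \<in> carrier G \<Longrightarrow>
      \<exists>x\<in>carrier N. V #>\<^bsub>G\<^esub> y = V #>\<^bsub>G\<^esub> \<iota> x"
    and sep: "\<And>U. U \<in> finite_index_normals N \<Longrightarrow>
      \<exists>V\<in>finite_index_normals G. {x \<in> carrier N. \<iota> x \<in> V} = U"
  shows "same_profinite_completion N G"
proof -
  interpret i: group_hom N G \<iota> by fact
  let ?N = "finite_index_normals N" and ?G = "finite_index_normals G"
  have nN: "U \<lhd> N" if "U \<in> ?N" for U using that by (simp add: finite_index_normals_def)
  have nG: "V \<lhd> G" if "V \<in> ?G" for V using that by (simp add: finite_index_normals_def)
  define pull where "pull V = {x \<in> carrier N. \<iota> x \<in> V}" for V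
  have pull: "pull V \<in> ?N" if "V \<in> ?G" for V
    unfolding pull_def by (rule finite_index_normals_vimage[OF i.G.is_group i.homh that])
  \<comment> \<open>Density is applied to \<open>V \<inter> W\<close>: modulo it an element of
    \<open>V\<close> is some \<open>\<iota> x\<close>, and membership of \<open>\<iota> x\<close> in
    \<open>V\<close> or \<open>W\<close> is visible in \<open>N\<close>.\<close>
  have pull_le: "V \<subseteq> W" if V: "V \<in> ?G" and W: "W \<in> ?G" and le: "pull V \<subseteq> pull W" for V W
  proof
    fix v assume v: "v \<in> V"
    interpret V: normal V G by (rule nG[OF V])
    interpret W: normal W G by (rule nG[OF W])
    interpret VW: normal "V \<inter> W" G by (rule nG[OF finite_index_normals_Int[OF V W]])
    have vc: "v \<in> carrier G" using v by (rule V.mem_carrier)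
    obtain x where x: "x \<in> carrier N" "(V \<inter> W) #>\<^bsub>G\<^esub> v = (V \<inter> W) #>\<^bsub>G\<^esub> \<iota> x"
      using dense[OF finite_index_normals_Int[OF V W] vc] by blast
    then have d: "v \<otimes>\<^bsub>G\<^esub> inv\<^bsub>G\<^esub> \<iota> x \<in> V \<inter> W" using VW.rcos_eq_iff vc by simp
    have "inv\<^bsub>G\<^esub> (v \<otimes>\<^bsub>G\<^esub> inv\<^bsub>G\<^esub> \<iota> x) \<otimes>\<^bsub>G\<^esub> v \<in> V"
      by (rule V.m_closed[OF V.m_inv_closed v]) (use d in blast)
    then have "\<iota> x \<in> V" using vc x by (simp add: i.H.inv_mult_group i.H.m_assoc)
    then have "\<iota> x \<in> W" using le x by (auto simp: pull_def)
    then have "v \<otimes>\<^bsub>G\<^esub> inv\<^bsub>G\<^esub> \<iota> x \<otimes>\<^bsub>G\<^esub> \<iota> x \<in> W"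
      by (rule W.m_closed[rotated]) (use d in blast)
    then show "v \<in> W" using vc x by (simp add: i.H.m_assoc)
  qed
  define push where "push U = (SOME V. V \<in> ?G \<and> pull V = U)" for U
  have push: "push U \<in> ?G" "pull (push U) = U" if "U \<in> ?N" for U
    using someI_ex[of "\<lambda>V. V \<in> ?G \<and> pull V = U"] sep[OF that] by (auto simp: push_def pull_def)
  have push_pull: "push (pull V) = V" if "V \<in> ?G" for V
    using push[OF pull[OF that]] that pull_le by (intro equalityI) auto
  \<comment> \<open>\<open>\<rho> V\<close> and \<open>\<rho>'\<close> are inverse bijections
    between \<open>N Mod pull V\<close> and \<open>G Mod V\<close>, written without choosing
    representatives.\<close>
  define \<rho> where "\<rho> V X = (\<Union>x\<in>X. V #>\<^bsub>G\<^esub> \<iota> x)" for V X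
  define \<rho>' where "\<rho>' Y = {x \<in> carrier N. \<iota> x \<in> Y}" for Y
  have \<rho>: "\<rho> V (pull V #>\<^bsub>N\<^esub> x) = V #>\<^bsub>G\<^esub> \<iota> x" if V: "V \<in> ?G" and x: "x \<in> carrier N" for V x
  proof -
    interpret V: normal V G by (rule nG[OF V])
    interpret U: normal "pull V" N by (rule nN[OF pull[OF V]])
    have "V #>\<^bsub>G\<^esub> \<iota> y = V #>\<^bsub>G\<^esub> \<iota> x" if y: "y \<in> pull V #>\<^bsub>N\<^esub> x" for y
    proof -
      from y obtain u where u: "u \<in> pull V" "y = u \<otimes>\<^bsub>N\<^esub> x" unfolding r_coset_def by blast
      have uc: "u \<in> carrier N" and uV: "\<iota> u \<in> V" using u(1) unfolding pull_def by blast+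
      have "\<iota> y \<otimes>\<^bsub>G\<^esub> inv\<^bsub>G\<^esub> \<iota> x = \<iota> u" using u(2) uc x by (simp add: i.H.m_assoc)
      then show ?thesis using V.rcos_eq_iff[of "\<iota> y" "\<iota> x"] uV u(2) uc x by simp
    qed
    moreover have "x \<in> pull V #>\<^bsub>N\<^esub> x" by (rule i.G.rcos_self[OF x U.subgroup_axioms])
    ultimately show ?thesis unfolding \<rho>_def by (intro SUP_eq_const) blast
  qed
  have \<rho>': "\<rho>' (V #>\<^bsub>G\<^esub> \<iota> x) = pull V #>\<^bsub>N\<^esub> x" if V: "V \<in> ?G" and x: "x \<in> carrier N" for V x
  proof -
    interpret V: normal V G by (rule nG[OF V])
    interpret U: normal "pull V" N by (rule nN[OF pull[OF V]])
    have xc: "\<iota> x \<in> carrier G" using x by simp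
    have "\<iota> y \<in> V #>\<^bsub>G\<^esub> \<iota> x \<longleftrightarrow> y \<in> pull V #>\<^bsub>N\<^esub> x" if y: "y \<in> carrier N" for y
    proof -
      have "\<iota> y \<in> V #>\<^bsub>G\<^esub> \<iota> x \<longleftrightarrow> \<iota> y \<otimes>\<^bsub>G\<^esub> inv\<^bsub>G\<^esub> \<iota> x \<in> V"
        by (rule V.mem_rcos_iff) (use x y in simp_all)
      also have "\<dots> \<longleftrightarrow> \<iota> (y \<otimes>\<^bsub>N\<^esub> inv\<^bsub>N\<^esub> x) \<in> V" using x y by simp
      also have "\<dots> \<longleftrightarrow> y \<otimes>\<^bsub>N\<^esub> inv\<^bsub>N\<^esub> x \<in> pull V" unfolding pull_def using x y by blast
      also have "\<dots> \<longleftrightarrow> y \<in> pull V #>\<^bsub>N\<^esub> x"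
        by (rule U.mem_rcos_iff[symmetric]) (use x y in simp_all)
      finally show ?thesis .
    qed
    moreover have "pull V #>\<^bsub>N\<^esub> x \<subseteq> carrier N" by (rule i.G.r_coset_subset_G[OF U.subset x])
    ultimately show ?thesis unfolding \<rho>'_def by blast
  qed
  let ?cN = "profinite_completion N" and ?cG = "profinite_completion G"
  have memN: "\<exists>x\<in>carrier N. f U = U #>\<^bsub>N\<^esub> x" if "f \<in> carrier ?cN" "U \<in> ?N" for f U
  proof -
    have "f U \<in> carrier (N Mod U)" using that by (auto simp: profinite_completion_def)
    then show ?thesis by (auto simp: carrier_FactGroup)
  qed
  have memG: "\<exists>x\<in>carrier N. f V = V #>\<^bsub>G\<^esub> \<iota> x" if "f \<in> carrier ?cG" "V \<in> ?G" for f V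
    using that dense[OF that(2)] by (auto simp: profinite_completion_def PiE_iff carrier_FactGroup)
  define \<Psi> where "\<Psi> f = (\<lambda>V\<in>?G. \<rho> V (f (pull V)))" for f
  define \<Phi> where "\<Phi> g = (\<lambda>U\<in>?N. \<rho>' (g (push U)))" for g
  have \<Psi>_in: "\<Psi> f \<in> carrier ?cG" if f: "f \<in> carrier ?cN" for f
  proof -
    have "\<rho> V (f (pull V)) \<in> carrier (G Mod V)" if "V \<in> ?G" for V
      using memN[OF f pull[OF that]] \<rho>[OF that] by (auto simp: carrier_FactGroup)
    moreover have "W <#>\<^bsub>G\<^esub> \<rho> V (f (pull V)) = \<rho> W (f (pull W))"
      if V: "V \<in> ?G" and W: "W \<in> ?G" and VW: "V \<subseteq> W" for V W
    proof -
      have le: "pull V \<subseteq> pull W" using VW by (auto simp: pull_def)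
      obtain x where x: "x \<in> carrier N" "f (pull V) = pull V #>\<^bsub>N\<^esub> x" using memN[OF f pull[OF V]] by auto
      have "f (pull W) = pull W <#>\<^bsub>N\<^esub> f (pull V)"
        using f pull[OF V] pull[OF W] le by (simp add: profinite_completion_def)
      also have "\<dots> = pull W #>\<^bsub>N\<^esub> x"
        unfolding x(2) by (rule set_mult_rcos_supset[OF nN[OF pull[OF V]] nN[OF pull[OF W]] le x(1)])
      finally show ?thesis
        using x V W VW set_mult_rcos_supset[OF nG[OF V] nG[OF W] VW] by (simp add: \<rho>)
    qed
    ultimately show ?thesis by (auto simp: profinite_completion_def \<Psi>_def)
  qed
  have \<Phi>_in: "\<Phi> g \<in> carrier ?cN" if g: "g \<in> carrier ?cG" for g
  proof -
    have val: "\<exists>x\<in>carrier N. g (push U) = push U #>\<^bsub>G\<^esub> \<iota> x \<and> \<rho>' (g (push U)) = U #>\<^bsub>N\<^esub> x"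
      if "U \<in> ?N" for U
      using memG[OF g push(1)[OF that]] \<rho>'[OF push(1)[OF that]] push(2)[OF that] by auto
    have "\<rho>' (g (push U)) \<in> carrier (N Mod U)" if "U \<in> ?N" for U
      using val[OF that] by (auto simp: carrier_FactGroup)
    moreover have "W <#>\<^bsub>N\<^esub> \<rho>' (g (push U)) = \<rho>' (g (push W))"
      if U: "U \<in> ?N" and W: "W \<in> ?N" and UW: "U \<subseteq> W" for U W
    proof -
      have le: "push U \<subseteq> push W" using pull_le[OF push(1)[OF U] push(1)[OF W]] push U W UW by simp
      obtain x where x: "x \<in> carrier N" "g (push U) = push U #>\<^bsub>G\<^esub> \<iota> x" "\<rho>' (g (push U)) = U #>\<^bsub>N\<^esub> x"
        using val[OF U] by blast
      have "g (push W) = push W <#>\<^bsub>G\<^esub> g (push U)"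
        using g push(1)[OF U] push(1)[OF W] le by (simp add: profinite_completion_def)
      also have "\<dots> = push W #>\<^bsub>G\<^esub> \<iota> x"
        unfolding x(2) by (rule set_mult_rcos_supset[OF nG[OF push(1)[OF U]] nG[OF push(1)[OF W]] le])
          (use x in simp)
      finally show ?thesis
        using x set_mult_rcos_supset[OF nN[OF U] nN[OF W] UW x(1)] \<rho>'[OF push(1)[OF W] x(1)] push(2)[OF W]
        by simp
    qed
    ultimately show ?thesis by (auto simp: profinite_completion_def \<Phi>_def)
  qed
  have \<Phi>\<Psi>: "\<Phi> (\<Psi> f) = f" if f: "f \<in> carrier ?cN" for f
  proof (rule extensionalityI[of _ "?N"])
    show "f \<in> extensional ?N" using f by (auto simp: profinite_completion_def PiE_def)
    fix U assume U: "U \<in> ?N"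
    obtain x where "x \<in> carrier N" "f U = U #>\<^bsub>N\<^esub> x" using memN[OF f U] by auto
    then show "\<Phi> (\<Psi> f) U = f U"
      using U push[OF U] \<rho>[OF push(1)[OF U]] \<rho>'[OF push(1)[OF U]] by (simp add: \<Phi>_def \<Psi>_def)
  qed (simp add: \<Phi>_def)
  have \<Psi>\<Phi>: "\<Psi> (\<Phi> g) = g" if g: "g \<in> carrier ?cG" for g
  proof (rule extensionalityI[of _ "?G"])
    show "g \<in> extensional ?G" using g by (auto simp: profinite_completion_def PiE_def)
    fix V assume V: "V \<in> ?G"
    obtain x where "x \<in> carrier N" "g V = V #>\<^bsub>G\<^esub> \<iota> x" using memG[OF g V] by auto
    then show "\<Psi> (\<Phi> g) V = g V"
      using V pull[OF V] push_pull[OF V] \<rho>[OF V] \<rho>'[OF V] by (simp add: \<Phi>_def \<Psi>_def)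
  qed (simp add: \<Psi>_def)
  have "\<Psi> \<in> hom ?cN ?cG"
  proof (rule homI)
    fix f g assume f: "f \<in> carrier ?cN" and g: "g \<in> carrier ?cN"
    show "\<Psi> (f \<otimes>\<^bsub>?cN\<^esub> g) = \<Psi> f \<otimes>\<^bsub>?cG\<^esub> \<Psi> g"
    proof (rule extensionalityI[of _ "?G"])
      fix V assume V: "V \<in> ?G"
      interpret V: normal V G by (rule nG[OF V])
      interpret U: normal "pull V" N by (rule nN[OF pull[OF V]])
      obtain x y where "x \<in> carrier N" "f (pull V) = pull V #>\<^bsub>N\<^esub> x"
        "y \<in> carrier N" "g (pull V) = pull V #>\<^bsub>N\<^esub> y"
        using memN[OF f pull[OF V]] memN[OF g pull[OF V]] by auto
      then show "\<Psi> (f \<otimes>\<^bsub>?cN\<^esub> g) V = (\<Psi> f \<otimes>\<^bsub>?cG\<^esub> \<Psi> g) V"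
        using V pull[OF V] by (simp add: profinite_completion_def \<Psi>_def U.rcos_sum V.rcos_sum \<rho>)
    qed (simp_all add: \<Psi>_def profinite_completion_def)
  qed (rule \<Psi>_in)
  moreover have "bij_betw \<Psi> (carrier ?cN) (carrier ?cG)"
    by (rule bij_betw_byWitness[where f' = \<Phi>]) (use \<Phi>\<Psi> \<Psi>\<Phi> \<Psi>_in \<Phi>_in in auto)
  ultimately have "\<Psi> \<in> iso ?cN ?cG" by (simp add: iso_def)
  moreover have "homeomorphic_maps (profinite_topology N) (profinite_topology G) \<Psi> \<Phi>"
  proof -
    have tsN: "topspace (profinite_topology N) = carrier ?cN"
      by (auto simp: profinite_topology_def profinite_completion_def)
    have tsG: "topspace (profinite_topology G) = carrier ?cG"
      by (auto simp: profinite_topology_def profinite_completion_def)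
    have "continuous_map (profinite_topology N)
        (product_topology (\<lambda>V. discrete_topology (carrier (G Mod V))) ?G) \<Psi>"
      unfolding continuous_map_componentwise
    proof (intro conjI ballI)
      fix V assume V: "V \<in> ?G"
      have "continuous_map (profinite_topology N) (discrete_topology (carrier (N Mod pull V))) (\<lambda>f. f (pull V))"
        unfolding profinite_topology_def using pull[OF V]
        by (intro continuous_map_from_subtopology continuous_map_product_projection)
      moreover have "continuous_map (discrete_topology (carrier (N Mod pull V)))
          (discrete_topology (carrier (G Mod V))) (\<rho> V)"
        using \<rho>[OF V] by (auto simp: carrier_FactGroup)
      ultimately have "continuous_map (profinite_topology N) (discrete_topology (carrier (G Mod V)))
          (\<rho> V \<circ> (\<lambda>f. f (pull V)))" by (rule continuous_map_compose)
      then show "continuous_map (profinite_topology N) (discrete_topology (carrier (G Mod V))) (\<lambda>f. \<Psi> f V)"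
        using V by (simp add: \<Psi>_def comp_def)
    qed (auto simp: \<Psi>_def)
    then have c1: "continuous_map (profinite_topology N) (profinite_topology G) \<Psi>"
      using \<Psi>_in tsN by (subst (2) profinite_topology_def) (simp add: continuous_map_in_subtopology)
    have "continuous_map (profinite_topology G)
        (product_topology (\<lambda>U. discrete_topology (carrier (N Mod U))) ?N) \<Phi>"
      unfolding continuous_map_componentwise
    proof (intro conjI ballI)
      fix U assume U: "U \<in> ?N"
      have "continuous_map (profinite_topology G) (discrete_topology (carrier (G Mod push U))) (\<lambda>g. g (push U))"
        unfolding profinite_topology_def using push(1)[OF U]
        by (intro continuous_map_from_subtopology continuous_map_product_projection)
      moreover have "continuous_map (discrete_topology (carrier (G Mod push U)))
          (discrete_topology (carrier (N Mod U))) \<rho>'"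
      proof -
        have "\<rho>' (push U #>\<^bsub>G\<^esub> y) \<in> carrier (N Mod U)" if y: "y \<in> carrier G" for y
          using dense[OF push(1)[OF U] y] \<rho>'[OF push(1)[OF U]] push(2)[OF U] by (auto simp: carrier_FactGroup)
        then show ?thesis by (auto simp: carrier_FactGroup[of G])
      qed
      ultimately have "continuous_map (profinite_topology G) (discrete_topology (carrier (N Mod U)))
          (\<rho>' \<circ> (\<lambda>g. g (push U)))" by (rule continuous_map_compose)
      then show "continuous_map (profinite_topology G) (discrete_topology (carrier (N Mod U))) (\<lambda>g. \<Phi> g U)"
        using U by (simp add: \<Phi>_def comp_def)
    qed (auto simp: \<Phi>_def)
    then have c2: "continuous_map (profinite_topology G) (profinite_topology N) \<Phi>"
      using \<Phi>_in tsG by (subst (2) profinite_topology_def) (simp add: continuous_map_in_subtopology)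
    show ?thesis
      unfolding homeomorphic_maps_def using c1 c2 \<Phi>\<Psi> \<Psi>\<Phi> tsN tsG by simp
  qed
  ultimately show ?thesis
    unfolding same_profinite_completion_def homeomorphic_map_maps by blast
qed

section \<open>Lower central quotients\<close>

lemma (in group) lower_central_subset: "lower_central G n \<subseteq> carrier G"
  using lower_central_normal normal_imp_subgroup subgroup.subset by blast

lemma (in group) lower_central_Suc:
  "1 \<le> n \<Longrightarrow> lower_central G (Suc n) =
    generate G (\<Union>x\<in>lower_central G n. \<Union>y\<in>carrier G. {commutator G x y})"
  by (simp add: commutator_def)

lemma (in group) commutator_in_lower_central:
  assumes "1 \<le> n" "x \<in> lower_central G n" "y \<in> carrier G"
  shows "commutator G x y \<in> lower_central G (Suc n)"
  unfolding lower_central_Suc[OF assms(1)] using assms(2,3) by (intro generate.incl) auto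

lemma lower_central_1 [simp]: "lower_central G (Suc 0) = carrier G"
  by simp

declare lower_central.simps(2) [simp del]

lemma (in group) lower_central_Suc_subset: "lower_central G (Suc n) \<subseteq> lower_central G n"
proof (cases "n = 0")
  case False
  interpret N: normal "lower_central G n" G by (rule lower_central_normal)
  have "commutator G x y \<in> lower_central G n" if x: "x \<in> lower_central G n" and y: "y \<in> carrier G" for x y
  proof -
    have "y \<otimes> inv x \<otimes> inv y \<in> lower_central G n" using x y by (intro N.inv_op_closed2) auto
    then have "x \<otimes> (y \<otimes> inv x \<otimes> inv y) \<in> lower_central G n" by (rule N.m_closed[OF x])
    then show ?thesis using x y N.mem_carrier by (simp add: commutator_def m_assoc)
  qed
  then have "generate G (\<Union>x\<in>lower_central G n. \<Union>y\<in>carrier G. {commutator G x y}) \<subseteq> lower_central G n"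
    by (intro generate_subgroup_incl N.subgroup_axioms) auto
  then show ?thesis using lower_central_Suc[of n] False by simp
qed simp

lemma (in group) lower_central_antimono: "m \<le> n \<Longrightarrow> lower_central G n \<subseteq> lower_central G m"
  by (induction rule: dec_induct) (use lower_central_Suc_subset in blast)+

lemma (in group_hom) commute_if_commutator_trivial:
  assumes x: "x \<in> carrier G" and y: "y \<in> carrier G" and triv: "h (commutator G x y) = \<one>\<^bsub>H\<^esub>"
  shows "h x \<otimes>\<^bsub>H\<^esub> h y = h y \<otimes>\<^bsub>H\<^esub> h x"
proof -
  have "commutator G x y \<otimes>\<^bsub>G\<^esub> (y \<otimes>\<^bsub>G\<^esub> x) = x \<otimes>\<^bsub>G\<^esub> y"
    using x y by (simp add: commutator_def G.m_assoc G.inv_cancel_left)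
  then have "h (x \<otimes>\<^bsub>G\<^esub> y) = h (commutator G x y) \<otimes>\<^bsub>H\<^esub> h (y \<otimes>\<^bsub>G\<^esub> x)"
    using x y by (metis G.commutator_closed G.m_closed hom_mult)
  then show ?thesis using x y triv by simp
qed

text \<open>Expand \<open>[x, y z] = [x, y] (y [x, z] y\<^sup>-\<^sup>1)\<close>; the conjugation by
  \<open>y\<close> is invisible because \<open>h [x, z]\<close> commutes with
  \<open>h y\<close>.\<close>

lemma (in group_hom) commutator_hom_mod:
  assumes x: "x \<in> carrier G"
    and central: "\<And>u v. u \<in> carrier G \<Longrightarrow> v \<in> carrier G \<Longrightarrow> h (commutator G (commutator G x u) v) = \<one>\<^bsub>H\<^esub>"
  shows "(\<lambda>y. h (commutator G x y)) \<in> hom G H"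
proof (rule homI)
  fix y z assume y: "y \<in> carrier G" and z: "z \<in> carrier G"
  have c: "commutator G x y \<in> carrier G" "commutator G x z \<in> carrier G" using x y z by auto
  have "commutator G x (y \<otimes>\<^bsub>G\<^esub> z) = commutator G x y \<otimes>\<^bsub>G\<^esub> (y \<otimes>\<^bsub>G\<^esub> commutator G x z \<otimes>\<^bsub>G\<^esub> inv\<^bsub>G\<^esub> y)"
    using x y z by (simp add: commutator_def G.m_assoc G.inv_cancel_left G.inv_mult_group)
  then have "h (commutator G x (y \<otimes>\<^bsub>G\<^esub> z))
      = h (commutator G x y) \<otimes>\<^bsub>H\<^esub> (h y \<otimes>\<^bsub>H\<^esub> h (commutator G x z) \<otimes>\<^bsub>H\<^esub> inv\<^bsub>H\<^esub> h y)"
    using c y by simp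
  also have "h y \<otimes>\<^bsub>H\<^esub> h (commutator G x z) = h (commutator G x z) \<otimes>\<^bsub>H\<^esub> h y"
    using commute_if_commutator_trivial[OF c(2) y central[OF z y]] by (rule sym)
  also have "h (commutator G x z) \<otimes>\<^bsub>H\<^esub> h y \<otimes>\<^bsub>H\<^esub> inv\<^bsub>H\<^esub> h y = h (commutator G x z)"
    using c(2) y by (simp add: H.m_assoc)
  finally show "h (commutator G x (y \<otimes>\<^bsub>G\<^esub> z)) = h (commutator G x y) \<otimes>\<^bsub>H\<^esub> h (commutator G x z)" .
qed (use x in auto)

text \<open>The homomorphism \<open>y \<mapsto> h [x, y]\<close> has commuting values, so it kills
  \<open>w\<close>, which lies in the commutator subgroup; and \<open>h z\<close> commutes with the
  whole image of \<open>h\<close>, so \<open>z\<close> cancels.\<close>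

lemma (in group_hom) commutator_cong_mod:
  assumes x: "x \<in> carrier G" and z: "z \<in> carrier G" and y: "y \<in> carrier G" and w: "w \<in> lower_central G 2"
    and z_central: "\<And>v. v \<in> carrier G \<Longrightarrow> h (commutator G z v) = \<one>\<^bsub>H\<^esub>"
    and central: "\<And>u v. u \<in> carrier G \<Longrightarrow> v \<in> carrier G \<Longrightarrow> h (commutator G (commutator G x u) v) = \<one>\<^bsub>H\<^esub>"
  shows "h (commutator G (z \<otimes>\<^bsub>G\<^esub> x) (y \<otimes>\<^bsub>G\<^esub> w)) = h (commutator G x y)"
proof -
  define f where "f y = h (commutator G x y)" for y
  interpret f: group_hom G H f
    using commutator_hom_mod[OF x central] by (intro group_homI G.is_group H.is_group) (simp add: f_def[abs_def])
  let ?S = "\<Union>u\<in>lower_central G 1. \<Union>v\<in>carrier G. {commutator G u v}"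
  have wc: "w \<in> carrier G" using w G.lower_central_subset by blast
  have "f w = (\<lambda>_. \<one>\<^bsub>H\<^esub>) w"
  proof (rule hom_eq_on_generate[OF f.group_hom_axioms])
    show "group_hom G H (\<lambda>_. \<one>\<^bsub>H\<^esub>)" by (intro group_homI G.is_group H.is_group homI) auto
    show "?S \<subseteq> carrier G" by auto
    show "w \<in> generate G ?S" using w G.lower_central_Suc[of 1] by (simp add: numeral_2_eq_2)
    fix s assume "s \<in> ?S"
    then obtain u v where u: "u \<in> carrier G" "v \<in> carrier G" "s = commutator G u v" by auto
    have "f u \<otimes>\<^bsub>H\<^esub> f v = f v \<otimes>\<^bsub>H\<^esub> f u"
      unfolding f_def using x u by (intro commute_if_commutator_trivial central) auto
    then show "f s = \<one>\<^bsub>H\<^esub>" using u f.hom_commutator[OF u(1,2)]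
      by (simp add: commutator_def H.m_assoc H.inv_cancel_left)
  qed
  then have fyw: "f (y \<otimes>\<^bsub>G\<^esub> w) = f y" using y wc by simp
  define v where "v = y \<otimes>\<^bsub>G\<^esub> w"
  have v: "v \<in> carrier G" using y wc by (simp add: v_def)
  define u where "u = x \<otimes>\<^bsub>G\<^esub> v \<otimes>\<^bsub>G\<^esub> inv\<^bsub>G\<^esub> x"
  have u: "u \<in> carrier G" using x v by (simp add: u_def)
  have "commutator G (z \<otimes>\<^bsub>G\<^esub> x) v = z \<otimes>\<^bsub>G\<^esub> u \<otimes>\<^bsub>G\<^esub> inv\<^bsub>G\<^esub> z \<otimes>\<^bsub>G\<^esub> inv\<^bsub>G\<^esub> v"
    using x z v by (simp add: commutator_def u_def G.m_assoc G.inv_mult_group)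
  then have "h (commutator G (z \<otimes>\<^bsub>G\<^esub> x) v) = h z \<otimes>\<^bsub>H\<^esub> h u \<otimes>\<^bsub>H\<^esub> inv\<^bsub>H\<^esub> h z \<otimes>\<^bsub>H\<^esub> inv\<^bsub>H\<^esub> h v"
    using z u v by simp
  also have "h z \<otimes>\<^bsub>H\<^esub> h u = h u \<otimes>\<^bsub>H\<^esub> h z"
    by (rule commute_if_commutator_trivial[OF z u z_central[OF u]])
  also have "h u \<otimes>\<^bsub>H\<^esub> h z \<otimes>\<^bsub>H\<^esub> inv\<^bsub>H\<^esub> h z \<otimes>\<^bsub>H\<^esub> inv\<^bsub>H\<^esub> h v = h (u \<otimes>\<^bsub>G\<^esub> inv\<^bsub>G\<^esub> v)"
    using z u v by (simp add: H.m_assoc)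
  also have "u \<otimes>\<^bsub>G\<^esub> inv\<^bsub>G\<^esub> v = commutator G x v" by (simp add: u_def commutator_def)
  finally show ?thesis using fyw by (simp add: f_def v_def)
qed

text \<open>The commutator map on \<open>G\<^sub>n \<times> G\<close> only depends on the classes in \<open>G\<^sub>n/G\<^sub>n\<^sub>+\<^sub>1\<close> and \<open>G/G\<^sub>2\<close>,
  modulo \<open>G\<^sub>n\<^sub>+\<^sub>2\<close>.\<close>

lemma (in group) lower_central_commutator_cong:
  assumes n: "1 \<le> n" and x: "x \<in> lower_central G n" "x' \<in> lower_central G n" and y: "y \<in> carrier G" "y' \<in> carrier G"
    and xx: "lower_central G (Suc n) #> x = lower_central G (Suc n) #> x'"
    and yy: "lower_central G 2 #> y = lower_central G 2 #> y'"
  shows "lower_central G (Suc (Suc n)) #> commutator G x y = lower_central G (Suc (Suc n)) #> commutator G x' y'"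
proof -
  let ?K = "lower_central G (Suc (Suc n))"
  interpret K: normal ?K G by (rule lower_central_normal)
  interpret L: normal "lower_central G (Suc n)" G by (rule lower_central_normal)
  interpret D: normal "lower_central G 2" G by (rule lower_central_normal)
  have p: "group_hom G (G Mod ?K) (\<lambda>x. ?K #> x)"
    by (intro group_homI is_group K.factorgroup_is_group K.r_coset_hom_Mod)
  have xc: "x \<in> carrier G" "x' \<in> carrier G" using x lower_central_subset by blast+
  have p1: "?K #> commutator G z v = \<one>\<^bsub>G Mod ?K\<^esub>"
    if z: "z \<in> lower_central G (Suc n)" and v: "v \<in> carrier G" for z v
  proof -
    have "commutator G z v \<in> ?K" by (rule commutator_in_lower_central[OF _ z v]) simp
    then show ?thesis using K.mem_carrier K.rcos_eq_self_iff by simp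
  qed
  define z where "z = x \<otimes> inv x'"
  have z: "z \<in> lower_central G (Suc n)" "x = z \<otimes> x'"
    using xx xc L.rcos_eq_iff by (simp_all add: z_def m_assoc)
  define w where "w = inv y' \<otimes> y"
  have "y \<otimes> inv y' \<in> lower_central G 2" using yy y D.rcos_eq_iff by simp
  then have "inv y' \<otimes> (y \<otimes> inv y') \<otimes> y' \<in> lower_central G 2" by (rule D.inv_op_closed1[OF y(2)])
  then have w: "w \<in> lower_central G 2" "y = y' \<otimes> w" using y by (simp_all add: w_def m_assoc inv_cancel_left)
  have "?K #> commutator G (z \<otimes> x') (y' \<otimes> w) = ?K #> commutator G x' y'"
  proof (rule group_hom.commutator_cong_mod[OF p xc(2) L.mem_carrier[OF z(1)] y(2) w(1)])
    show "?K #> commutator G z v = \<one>\<^bsub>G Mod ?K\<^esub>" if "v \<in> carrier G" for v by (rule p1[OF z(1) that])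
    show "?K #> commutator G (commutator G x' u) v = \<one>\<^bsub>G Mod ?K\<^esub>" if "u \<in> carrier G" "v \<in> carrier G" for u v
      by (rule p1[OF commutator_in_lower_central[OF n x(2) that(1)] that(2)])
  qed
  then show ?thesis using z(2) w(2) by simp
qed

text \<open>An endomorphism that is the identity on \<open>G/G\<^sub>2\<close> is the identity on
  every layer \<open>G\<^sub>n/G\<^sub>n\<^sub>+\<^sub>1\<close>, since layers are generated by
  commutators. So an element of \<open>G\<^sub>n\<close> whose image lies in
  \<open>G\<^sub>n\<^sub>+\<^sub>1\<close> lies there itself, and one climbs from \<open>1\<close>
  to \<open>c\<close>.\<close>

lemma (in group) endo_reflects_lower_central:
  assumes f: "f \<in> hom G G" and near: "\<And>g. g \<in> carrier G \<Longrightarrow> lower_central G 2 #> f g = lower_central G 2 #> g"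
    and g: "g \<in> carrier G" "f g \<in> lower_central G c" and "1 \<le> c"
  shows "g \<in> lower_central G c"
proof -
  interpret f: group_hom G G f using f by (intro group_homI is_group)
  have graded: "lower_central G (Suc n) #> f x = lower_central G (Suc n) #> x"
    if "1 \<le> n" "x \<in> lower_central G n" for n x
    using that
  proof (induction n arbitrary: x rule: nat_induct_at_least)
    case base
    then show ?case using near by (simp add: numeral_2_eq_2)
  next
    case (Suc n)
    let ?K = "lower_central G (Suc (Suc n))"
    interpret K: normal ?K G by (rule lower_central_normal)
    let ?S = "\<Union>x\<in>lower_central G n. \<Union>y\<in>carrier G. {commutator G x y}"
    have "(\<lambda>x. ?K #> f x) \<in> hom G (G Mod ?K)"
      using Group.hom_compose[OF f K.r_coset_hom_Mod] by (simp add: comp_def)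
    then have h: "group_hom G (G Mod ?K) (\<lambda>x. ?K #> f x)" "group_hom G (G Mod ?K) (\<lambda>x. ?K #> x)"
      using K.r_coset_hom_Mod by (auto intro!: group_homI is_group K.factorgroup_is_group)
    show ?case
    proof (rule hom_eq_on_generate[OF h])
      show "?S \<subseteq> carrier G" using lower_central_subset[of n] by auto
      show "x \<in> generate G ?S" using Suc.prems lower_central_Suc[OF Suc.hyps] by simp
      fix s assume "s \<in> ?S"
      then obtain u y where u: "u \<in> lower_central G n" "y \<in> carrier G" "s = commutator G u y" by auto
      have uc: "u \<in> carrier G" using u(1) lower_central_subset by blast
      have "f u \<in> lower_central G n" using f.lower_central_image u(1) by blast
      from lower_central_commutator_cong[OF Suc.hyps this u(1) _ u(2) Suc.IH[OF u(1)] near[OF u(2)]]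
      show "?K #> f s = ?K #> s" using u uc f.hom_commutator[of u y] by simp
    qed
  qed
  have "g \<in> lower_central G n" if "1 \<le> n" "n \<le> c" for n
    using that
  proof (induction n rule: nat_induct_at_least)
    case base
    then show ?case using g by simp
  next
    case (Suc n)
    interpret L: normal "lower_central G (Suc n)" G by (rule lower_central_normal)
    have "f g \<in> lower_central G (Suc n)" using g(2) lower_central_antimono Suc.prems by blast
    moreover have "lower_central G (Suc n) #> f g = lower_central G (Suc n) #> g"
      using graded[OF Suc.hyps] Suc by simp
    ultimately show ?case using g(1) L.rcos_eq_self_iff f.hom_closed by metis
  qed
  then show ?thesis using \<open>1 \<le> c\<close> by blast
qed

text \<open>Surjectivity onto the abelianization spreads to every layer of the series through
  commutators; an approximation of \<open>x\<close> modulo one term is then corrected by an element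
  of the next layer.\<close>

lemma hom_surj_lower_central_quotient:
  assumes "group_hom G N h"
    and sur: "\<And>x. x \<in> carrier N \<Longrightarrow> \<exists>g\<in>carrier G. lower_central N 2 #>\<^bsub>N\<^esub> x = lower_central N 2 #>\<^bsub>N\<^esub> h g"
    and "1 \<le> c" and x: "x \<in> carrier N"
  shows "\<exists>g\<in>carrier G. lower_central N c #>\<^bsub>N\<^esub> x = lower_central N c #>\<^bsub>N\<^esub> h g"
proof -
  interpret h: group_hom G N h by fact
  have graded: "\<exists>g\<in>carrier G. lower_central N (Suc n) #>\<^bsub>N\<^esub> x = lower_central N (Suc n) #>\<^bsub>N\<^esub> h g"
    if "1 \<le> n" "x \<in> lower_central N n" for n x
    using that
  proof (induction n arbitrary: x rule: nat_induct_at_least)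
    case base
    then show ?case using sur by (simp add: numeral_2_eq_2)
  next
    case (Suc n)
    let ?K = "lower_central N (Suc (Suc n))"
    interpret K: normal ?K N by (rule h.H.lower_central_normal)
    interpret L: normal "lower_central N (Suc n)" N by (rule h.H.lower_central_normal)
    interpret M: normal "lower_central N n" N by (rule h.H.lower_central_normal)
    let ?S = "\<Union>x\<in>lower_central N n. \<Union>y\<in>carrier N. {commutator N x y}"
    have ScN: "?S \<subseteq> carrier N" using h.H.lower_central_subset[of n] by auto
    have gen: "\<exists>g\<in>carrier G. ?K #>\<^bsub>N\<^esub> s = ?K #>\<^bsub>N\<^esub> h g" if s: "s \<in> ?S" for s
    proof -
      obtain u y where u: "u \<in> lower_central N n" "y \<in> carrier N" "s = commutator N u y" using s by auto
      have uc: "u \<in> carrier N" using u(1) by (rule M.mem_carrier)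
      obtain g where g: "g \<in> carrier G" "lower_central N (Suc n) #>\<^bsub>N\<^esub> u = lower_central N (Suc n) #>\<^bsub>N\<^esub> h g"
        using Suc.IH[OF u(1)] by blast
      obtain k where k: "k \<in> carrier G" "lower_central N 2 #>\<^bsub>N\<^esub> y = lower_central N 2 #>\<^bsub>N\<^esub> h k"
        using sur[OF u(2)] by blast
      \<comment> \<open>The congruence for commutators compares two elements of the same term of the
        series, so \<open>h g\<close> has to be placed in that term first.\<close>
      have "h g \<otimes>\<^bsub>N\<^esub> inv\<^bsub>N\<^esub> u \<in> lower_central N (Suc n)" using L.rcos_eq_iff[of "h g" u] g(1) g(2)[symmetric] uc by simp
      then have "h g \<otimes>\<^bsub>N\<^esub> inv\<^bsub>N\<^esub> u \<in> lower_central N n" using h.H.lower_central_Suc_subset by blast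
      then have "h g \<otimes>\<^bsub>N\<^esub> inv\<^bsub>N\<^esub> u \<otimes>\<^bsub>N\<^esub> u \<in> lower_central N n" using u(1) by (rule M.m_closed)
      then have "h g \<in> lower_central N n" using g uc by (simp add: h.H.m_assoc)
      from h.H.lower_central_commutator_cong[OF Suc.hyps u(1) this u(2) _ g(2) k(2)]
      show ?thesis using u(3) g k h.hom_commutator[of g k] by (intro bexI[of _ "commutator G g k"]) auto
    qed
    have "x \<in> generate N ?S" using Suc.prems h.H.lower_central_Suc[OF Suc.hyps] by simp
    then show ?case
    proof induction
      case one
      then show ?case by (intro bexI[of _ "\<one>\<^bsub>G\<^esub>"]) auto
    next
      case (incl s)
      then show ?case by (rule gen)
    next
      case (inv s)
      then obtain g where g: "g \<in> carrier G" "?K #>\<^bsub>N\<^esub> s = ?K #>\<^bsub>N\<^esub> h g" using gen by blast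
      have "s \<in> carrier N" using inv ScN by blast
      then show ?case using g by (intro bexI[of _ "inv\<^bsub>G\<^esub> g"]) (simp_all add: K.rcos_inv[symmetric])
    next
      case (eng s t)
      have st: "s \<in> carrier N" "t \<in> carrier N"
        using eng.hyps h.H.generate_incl[OF ScN] by blast+
      obtain g k where "g \<in> carrier G" "?K #>\<^bsub>N\<^esub> s = ?K #>\<^bsub>N\<^esub> h g" "k \<in> carrier G" "?K #>\<^bsub>N\<^esub> t = ?K #>\<^bsub>N\<^esub> h k"
        using eng.IH by blast
      then show ?case using st by (intro bexI[of _ "g \<otimes>\<^bsub>G\<^esub> k"]) (simp_all add: K.rcos_sum[symmetric])
    qed
  qed
  have "\<exists>g\<in>carrier G. lower_central N c #>\<^bsub>N\<^esub> x = lower_central N c #>\<^bsub>N\<^esub> h g"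
    using \<open>1 \<le> c\<close> x
  proof (induction c arbitrary: x rule: nat_induct_at_least)
    case base
    interpret L: normal "lower_central N 1" N by (rule h.H.lower_central_normal)
    have "lower_central N 1 #>\<^bsub>N\<^esub> x = lower_central N 1 #>\<^bsub>N\<^esub> h \<one>\<^bsub>G\<^esub>"
      using base L.rcos_eq_iff[of x "h \<one>\<^bsub>G\<^esub>"] by simp
    then show ?case using h.G.one_closed by blast
  next
    case (Suc n)
    interpret K: normal "lower_central N (Suc n)" N by (rule h.H.lower_central_normal)
    interpret L: normal "lower_central N n" N by (rule h.H.lower_central_normal)
    obtain g where g: "g \<in> carrier G" "lower_central N n #>\<^bsub>N\<^esub> x = lower_central N n #>\<^bsub>N\<^esub> h g"
      using Suc by blast
    have "x \<otimes>\<^bsub>N\<^esub> inv\<^bsub>N\<^esub> h g \<in> lower_central N n" using g Suc.prems L.rcos_eq_iff by simp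
    then obtain k where k: "k \<in> carrier G"
      "lower_central N (Suc n) #>\<^bsub>N\<^esub> (x \<otimes>\<^bsub>N\<^esub> inv\<^bsub>N\<^esub> h g) = lower_central N (Suc n) #>\<^bsub>N\<^esub> h k"
      using graded[OF Suc.hyps] by blast
    have "x \<otimes>\<^bsub>N\<^esub> inv\<^bsub>N\<^esub> h g \<otimes>\<^bsub>N\<^esub> inv\<^bsub>N\<^esub> h k \<in> lower_central N (Suc n)"
      using k g Suc.prems by (subst K.rcos_eq_iff[symmetric]) auto
    then show ?case using g k Suc.prems
      by (intro bexI[of _ "k \<otimes>\<^bsub>G\<^esub> g"]) (simp_all add: K.rcos_eq_iff h.H.inv_mult_group h.H.m_assoc)
  qed
  then show ?thesis .
qed

text \<open>The isomorphism comes from \<open>\<Theta>\<close> and not from \<open>\<iota>\<close>: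
  it is onto by \<open>sur\<close>, and its kernel is found by pushing on to \<open>G\<close>, where
  \<open>\<iota> \<circ> \<Theta>\<close> is the identity modulo commutators.\<close>

lemma lower_central_quotients_iso:
  assumes "group_hom N G \<iota>" "group_hom G N \<Theta>"
    and near: "\<And>g. g \<in> carrier G \<Longrightarrow> lower_central G 2 #>\<^bsub>G\<^esub> \<iota> (\<Theta> g) = lower_central G 2 #>\<^bsub>G\<^esub> g"
    and sur: "\<And>x. x \<in> carrier N \<Longrightarrow> \<exists>g\<in>carrier G. lower_central N 2 #>\<^bsub>N\<^esub> x = lower_central N 2 #>\<^bsub>N\<^esub> \<Theta> g"
    and c: "1 \<le> c"
  shows "N Mod lower_central N c \<cong> G Mod lower_central G c"
proof -
  interpret i: group_hom N G \<iota> by fact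
  interpret t: group_hom G N \<Theta> by fact
  interpret NG: normal "lower_central G c" G by (rule i.H.lower_central_normal)
  have "{g \<in> carrier G. \<Theta> g \<in> lower_central N c} = lower_central G c"
  proof (intro equalityI subsetI)
    fix g assume "g \<in> {g \<in> carrier G. \<Theta> g \<in> lower_central N c}"
    then have g: "g \<in> carrier G" "\<iota> (\<Theta> g) \<in> lower_central G c"
      using i.lower_central_image[of c] by auto
    have "(\<lambda>g. \<iota> (\<Theta> g)) \<in> hom G G"
      using Group.hom_compose[OF t.homh i.homh] by (simp add: comp_def)
    from i.H.endo_reflects_lower_central[OF this near g c] show "g \<in> lower_central G c" by simp
  next
    fix g assume "g \<in> lower_central G c"
    then show "g \<in> {g \<in> carrier G. \<Theta> g \<in> lower_central N c}"
      using t.lower_central_image[of c] NG.mem_carrier by auto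
  qed
  from Mod_iso_Mod[OF i.H.is_group i.G.lower_central_normal t.homh this
      hom_surj_lower_central_quotient[OF assms(2) sur c]]
  have "G Mod lower_central G c \<cong> N Mod lower_central N c" .
  then show ?thesis using group.iso_sym[OF NG.factorgroup_is_group] by blast
qed

section \<open>A criterion for infinite second homology\<close>

definition chain_pairing :: "('a \<Rightarrow> 'a \<Rightarrow> rat) \<Rightarrow> ('a list \<Rightarrow>\<^sub>0 rat) \<Rightarrow> rat" where
  "chain_pairing c z = (\<Sum>xs\<in>Poly_Mapping.keys z. Poly_Mapping.lookup z xs * c (xs ! 0) (xs ! 1))"

lemma chain_pairing_superset:
  assumes "finite S" "Poly_Mapping.keys z \<subseteq> S"
  shows "chain_pairing c z = (\<Sum>xs\<in>S. Poly_Mapping.lookup z xs * c (xs ! 0) (xs ! 1))"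
  unfolding chain_pairing_def using assms by (intro sum.mono_neutral_left) (auto simp: in_keys_iff)

lemma chain_pairing_add: "chain_pairing c (y + z) = chain_pairing c y + chain_pairing c z"
proof -
  let ?S = "Poly_Mapping.keys y \<union> Poly_Mapping.keys z"
  have S: "finite ?S" "Poly_Mapping.keys y \<subseteq> ?S" "Poly_Mapping.keys z \<subseteq> ?S" "Poly_Mapping.keys (y + z) \<subseteq> ?S"
    using Poly_Mapping.keys_add[of y z] by auto
  show ?thesis
    unfolding S(2-4)[THEN chain_pairing_superset[OF S(1)]]
    by (simp add: lookup_add distrib_right sum.distrib)
qed

lemma chain_pairing_zero: "chain_pairing c 0 = 0"
  by (simp add: chain_pairing_def)

lemma chain_pairing_sum: "chain_pairing c (sum f A) = (\<Sum>x\<in>A. chain_pairing c (f x))"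
  by (induction A rule: infinite_finite_induct) (simp_all add: chain_pairing_add chain_pairing_zero)

lemma chain_pairing_scale: "chain_pairing c (Poly_Mapping.map ((*) r) z) = r * chain_pairing c z"
  by (subst chain_pairing_superset[OF finite_keys keys_scale])
    (simp add: chain_pairing_def sum_distrib_left mult.assoc)

lemma chain_pairing_single: "chain_pairing c (Poly_Mapping.single xs q) = q * c (xs ! 0) (xs ! 1)"
  by (subst chain_pairing_superset[of "{xs}"]) auto

definition two_cocycle :: "('a, 'b) monoid_scheme \<Rightarrow> ('a \<Rightarrow> 'a \<Rightarrow> rat) \<Rightarrow> bool" where
  "two_cocycle G c \<longleftrightarrow> (\<forall>x\<in>carrier G. \<forall>y\<in>carrier G. \<forall>z\<in>carrier G.
     c y z - c (x \<otimes>\<^bsub>G\<^esub> y) z + c x (y \<otimes>\<^bsub>G\<^esub> z) - c x y = 0)"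

lemma chain_pairing_boundary:
  assumes c: "two_cocycle G c" and z: "z \<in> bar_boundaries G 2"
  shows "chain_pairing c z = 0"
proof -
  obtain b where b: "b \<in> carrier (bar_chains G (Suc 2))" "z = bar_boundary G b"
    using z by (auto simp: bar_boundaries_def)
  have bs: "b = (\<Sum>xs\<in>Poly_Mapping.keys b. Poly_Mapping.single xs (Poly_Mapping.lookup b xs))"
    by (rule poly_mapping_eqI) (simp add: lookup_sum lookup_single when_def in_keys_iff)
  have "chain_pairing c (bar_boundary G (Poly_Mapping.single xs q)) = 0"
    if "xs \<in> Poly_Mapping.keys b" for xs q
  proof -
    have "length xs = 3" "set xs \<subseteq> carrier G" using that b(1) by (auto simp: bar_chains_def)
    then obtain u v w where xs: "xs = [u, v, w]" "u \<in> carrier G" "v \<in> carrier G" "w \<in> carrier G"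
      by (auto simp: numeral_eq_Suc length_Suc_conv)
    have "chain_pairing c (bar_boundary G (Poly_Mapping.single xs q))
        = q * (c v w - c (u \<otimes>\<^bsub>G\<^esub> v) w + c u (v \<otimes>\<^bsub>G\<^esub> w) - c u v)"
      by (simp add: xs bar_boundary_single numeral_eq_Suc chain_pairing_add chain_pairing_single
          bar_face_def algebra_simps)
    then show ?thesis using c xs by (simp add: two_cocycle_def)
  qed
  then show ?thesis
    unfolding b(2) by (subst bs) (simp add: bar_boundary_sum chain_pairing_sum)
qed

text \<open>For a commuting pair this is, up to sign, the image of the fundamental class of the
  torus under the map \<open>\<int>\<^sup>2 \<rightarrow> G\<close> given by the pair.\<close>

definition torus_cycle :: "'a \<Rightarrow> 'a \<Rightarrow> 'a list \<Rightarrow>\<^sub>0 rat" where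
  "torus_cycle x y = Poly_Mapping.single [x, y] 1 + Poly_Mapping.single [y, x] (- 1)"

lemma torus_cycle_in_cycles:
  assumes "x \<in> carrier G" "y \<in> carrier G" "x \<otimes>\<^bsub>G\<^esub> y = y \<otimes>\<^bsub>G\<^esub> x"
  shows "torus_cycle x y \<in> bar_cycles G 2"
proof -
  have "Poly_Mapping.keys (torus_cycle x y) \<subseteq> {[x, y], [y, x]}"
    unfolding torus_cycle_def by (rule order.trans[OF Poly_Mapping.keys_add]) auto
  moreover have "bar_boundary G (torus_cycle x y) = 0"
    unfolding torus_cycle_def bar_boundary_add bar_boundary_single
    by (simp add: numeral_eq_Suc bar_face_def assms(3) single_uminus)
  ultimately show ?thesis using assms by (auto simp: bar_cycles_def bar_chains_def)
qed

text \<open>A cocycle vanishes on boundaries and so defines a functional on homology. The given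
  functionals are dual to the torus classes, which are therefore distinct and linearly
  independent.\<close>

lemma infinite_second_homology:
  assumes "group G"
    and xy: "\<And>k :: nat. x k \<in> carrier G" "\<And>k. y k \<in> carrier G" "\<And>k. x k \<otimes>\<^bsub>G\<^esub> y k = y k \<otimes>\<^bsub>G\<^esub> x k"
    and c: "\<And>j :: nat. two_cocycle G (c j)"
    and dual: "\<And>j k. c j (x k) (y k) - c j (y k) (x k) = (if j = k then 1 else 0)"
  shows "\<not> vectorspace.fin_dim class_ring (rational_homology G 2)"
proof
  let ?V = "rational_homology G 2" and ?W = "bar_boundaries G 2"
  let ?K = "class_ring :: rat ring"
  interpret V: vectorspace ?K ?V by (rule vectorspace_rational_homology[OF assms(1)])
  assume fin: "V.fin_dim"
  have W0: "0 \<in> ?W"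
    unfolding bar_boundaries_def using bar_boundary_zero[of G]
    by (intro image_eqI[of _ _ 0]) (auto simp: bar_chains_def)
  have car: "X \<in> carrier ?V \<longleftrightarrow> (\<exists>z\<in>bar_cycles G 2. X = (\<lambda>w. w + z) ` ?W)" for X
    by (auto simp: rational_homology_def quotient_module_def A_RCOSETS_def' a_r_coset_def' bar_chains_def)
  define \<Psi> where "\<Psi> j X = chain_pairing (c j) (SOME z. z \<in> X)" for j X
  have \<Psi>: "\<Psi> j X = chain_pairing (c j) z" if X: "X \<in> carrier ?V" and z: "z \<in> X" for j X z
  proof -
    obtain z0 where z0: "X = (\<lambda>w. w + z0) ` ?W" using X by (auto simp: car)
    have "chain_pairing (c j) z' = chain_pairing (c j) z0" if "z' \<in> X" for z'
      using that chain_pairing_boundary[OF c] by (auto simp: z0 chain_pairing_add)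
    moreover have "(SOME z. z \<in> X) \<in> X" using z by (rule someI)
    ultimately show ?thesis using z by (simp add: \<Psi>_def)
  qed
  have ne: "\<exists>z. z \<in> X" if "X \<in> carrier ?V" for X using that W0 by (auto simp: car)
  have \<Psi>_add: "\<Psi> j (X \<oplus>\<^bsub>?V\<^esub> Y) = \<Psi> j X + \<Psi> j Y" if X: "X \<in> carrier ?V" and Y: "Y \<in> carrier ?V" for j X Y
  proof -
    obtain z y where zy: "z \<in> X" "y \<in> Y" using ne[OF X] ne[OF Y] by auto
    then have "z + y \<in> X \<oplus>\<^bsub>?V\<^esub> Y"
      by (auto simp: rational_homology_def quotient_module_def set_add_def' bar_chains_def)
    then show ?thesis
      using \<Psi>[OF V.M.a_closed[OF X Y]] \<Psi>[OF X zy(1)] \<Psi>[OF Y zy(2)] by (simp add: chain_pairing_add)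
  qed
  have \<Psi>_smult: "\<Psi> j (r \<odot>\<^bsub>?V\<^esub> X) = r * \<Psi> j X" if X: "X \<in> carrier ?V" for j r X
  proof -
    obtain z where z: "z \<in> X" using ne[OF X] by auto
    then have rz: "Poly_Mapping.map ((*) r) z \<in> r \<odot>\<^bsub>?V\<^esub> X"
      using W0 by (force simp: rational_homology_def quotient_module_def a_r_coset_def' bar_chains_def)
    have "r \<odot>\<^bsub>?V\<^esub> X \<in> carrier ?V" using X by (intro V.smult_closed) auto
    from \<Psi>[OF this rz] show ?thesis using \<Psi>[OF X z] by (simp add: chain_pairing_scale)
  qed
  have \<Psi>_zero: "\<Psi> j \<zero>\<^bsub>?V\<^esub> = 0" for j
    using \<Psi>_add[OF V.M.zero_closed V.M.zero_closed, of j] by simp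
  have \<Psi>_lincomb: "\<Psi> j (V.lincomb a A) = (\<Sum>v\<in>A. a v * \<Psi> j v)"
    if "finite A" "A \<subseteq> carrier ?V" for j a A
    using that
  proof (induction A)
    case empty
    then show ?case by (simp add: V.lincomb_def \<Psi>_zero)
  next
    case (insert v A)
    have cl: "a v \<odot>\<^bsub>?V\<^esub> v \<in> carrier ?V" "(\<lambda>v. a v \<odot>\<^bsub>?V\<^esub> v) \<in> A \<rightarrow> carrier ?V"
      using insert.prems by (auto intro!: V.smult_closed)
    have "V.lincomb a (insert v A) = a v \<odot>\<^bsub>?V\<^esub> v \<oplus>\<^bsub>?V\<^esub> V.lincomb a A"
      unfolding V.lincomb_def using insert.hyps cl by (intro V.M.finsum_insert) auto
    moreover have "V.lincomb a A \<in> carrier ?V"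
      unfolding V.lincomb_def using cl by (intro V.M.finsum_closed) auto
    ultimately show ?case using insert cl by (simp add: \<Psi>_add \<Psi>_smult)
  qed
  define Z where "Z k = (\<lambda>w. w + torus_cycle (x k) (y k)) ` ?W" for k
  have Z: "Z k \<in> carrier ?V" for k
    unfolding car Z_def using torus_cycle_in_cycles[OF xy] by blast
  have \<Psi>_Z: "\<Psi> j (Z k) = (if j = k then 1 else 0)" for j k
  proof -
    have "torus_cycle (x k) (y k) \<in> Z k" unfolding Z_def using W0 by (intro image_eqI[of _ _ 0]) auto
    from \<Psi>[OF Z this] show ?thesis
      using dual[of j k] by (simp add: torus_cycle_def chain_pairing_add chain_pairing_single)
  qed
  have inj: "inj Z"
  proof (rule injI)
    fix j k assume "Z j = Z k"
    then have "\<Psi> j (Z j) = \<Psi> j (Z k)" by simp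
    then show "j = k" by (simp add: \<Psi>_Z split: if_splits)
  qed
  have "\<not> V.lin_dep (range Z)"
  proof
    assume "V.lin_dep (range Z)"
    then obtain A a v where A: "finite A" "A \<subseteq> range Z" "V.lincomb a A = \<zero>\<^bsub>?V\<^esub>" "v \<in> A" "a v \<noteq> \<zero>\<^bsub>?K\<^esub>"
      unfolding V.lin_dep_def by blast
    obtain k where k: "v = Z k" using A by auto
    have AV: "A \<subseteq> carrier ?V" using A(2) Z by auto
    have "0 = (\<Sum>u\<in>A. a u * \<Psi> k u)"
      using \<Psi>_lincomb[OF A(1) AV, of k a] A(3) \<Psi>_zero by simp
    also have "\<dots> = (\<Sum>u\<in>A. if u = v then a v else 0)"
    proof (rule sum.cong[OF refl])
      fix u assume "u \<in> A"
      then obtain i where "u = Z i" using A(2) by auto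
      then show "a u * \<Psi> k u = (if u = v then a v else 0)"
        using inj by (auto simp: k \<Psi>_Z inj_eq)
    qed
    also have "\<dots> = a v" using A(1,4) by simp
    finally show False using A(5) by simp
  qed
  moreover have "range Z \<subseteq> carrier ?V" using Z by auto
  ultimately have "finite (range Z)" using V.fin_dim_li_fin[OF fin] by blast
  then show False using inj finite_imageD infinite_UNIV_nat by blast
qed

section \<open>The fibre product\<close>

definition fibre_product :: "((nat \<times> bool) list \<times> (nat \<times> bool) list) monoid" where
  "fibre_product = (F4 \<times>\<times> F4)\<lparr>carrier := {(u, v). u \<in> carrier F4 \<and> v \<in> carrier F4 \<and> u \<otimes>\<^bsub>F4\<^esub> inv\<^bsub>F4\<^esub> v \<in> Rel}\<rparr>"

lemma carrier_fibre_product: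
  "(u, v) \<in> carrier fibre_product \<longleftrightarrow> u \<in> carrier F4 \<and> v \<in> carrier F4 \<and> u \<otimes>\<^bsub>F4\<^esub> inv\<^bsub>F4\<^esub> v \<in> Rel"
  by (simp add: fibre_product_def)

lemma mult_fibre_product: "(u, v) \<otimes>\<^bsub>fibre_product\<^esub> (u', v') = (u \<otimes>\<^bsub>F4\<^esub> u', v \<otimes>\<^bsub>F4\<^esub> v')"
  and one_fibre_product: "\<one>\<^bsub>fibre_product\<^esub> = (\<one>\<^bsub>F4\<^esub>, \<one>\<^bsub>F4\<^esub>)"
  by (simp_all add: fibre_product_def DirProd_def)

interpretation F4: group F4 by (rule group_free_group)
interpretation Rel: normal Rel F4 by (rule Rel_normal)
interpretation F4F4: group "F4 \<times>\<times> F4" by (rule DirProd_group) (rule group_free_group)+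

lemma fibre_product_iff:
  assumes "u \<in> carrier F4" "v \<in> carrier F4"
  shows "(u, v) \<in> carrier fibre_product \<longleftrightarrow> Rel #>\<^bsub>F4\<^esub> u = Rel #>\<^bsub>F4\<^esub> v"
  using assms by (simp add: carrier_fibre_product Rel.rcos_eq_iff)

lemma subgroup_fibre_product: "subgroup (carrier fibre_product) (F4 \<times>\<times> F4)"
proof (rule F4F4.subgroupI)
  show "carrier fibre_product \<subseteq> carrier (F4 \<times>\<times> F4)" by (auto simp: fibre_product_def)
  show "carrier fibre_product \<noteq> {}"
    using fibre_product_iff[of "\<one>\<^bsub>F4\<^esub>" "\<one>\<^bsub>F4\<^esub>"] by blast
next
  fix a assume "a \<in> carrier fibre_product"
  then obtain u v where a: "a = (u, v)" and c: "u \<in> carrier F4" "v \<in> carrier F4" and eq: "Rel #>\<^bsub>F4\<^esub> u = Rel #>\<^bsub>F4\<^esub> v"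
    using fibre_product_iff by (cases a) (auto simp: carrier_fibre_product Rel.rcos_eq_iff)
  then show "inv\<^bsub>F4 \<times>\<times> F4\<^esub> a \<in> carrier fibre_product"
    by (simp add: inv_DirProd[OF F4.is_group F4.is_group] fibre_product_iff Rel.rcos_inv[symmetric])
next
  fix a b assume "a \<in> carrier fibre_product" "b \<in> carrier fibre_product"
  then obtain u v u' v' where a: "a = (u, v)" "b = (u', v')"
    and c: "u \<in> carrier F4" "v \<in> carrier F4" "u' \<in> carrier F4" "v' \<in> carrier F4"
    and eq: "Rel #>\<^bsub>F4\<^esub> u = Rel #>\<^bsub>F4\<^esub> v" "Rel #>\<^bsub>F4\<^esub> u' = Rel #>\<^bsub>F4\<^esub> v'"
    using fibre_product_iff by (cases a, cases b) (auto simp: carrier_fibre_product Rel.rcos_eq_iff)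
  then show "a \<otimes>\<^bsub>F4 \<times>\<times> F4\<^esub> b \<in> carrier fibre_product"
    by (simp add: fibre_product_iff Rel.rcos_sum[symmetric])
qed

lemma group_fibre_product: "group fibre_product"
  using F4F4.subgroup_imp_group[OF subgroup_fibre_product] by (simp add: fibre_product_def)

interpretation fibre_product: group fibre_product by (rule group_fibre_product)

lemma fibre_product_incl: "group_hom fibre_product (F4 \<times>\<times> F4) (\<lambda>x. x)"
  by (intro group_homI group_fibre_product F4F4.is_group)
    (auto simp: hom_def fibre_product_def)

lemma inv_fibre_product:
  assumes "(u, v) \<in> carrier fibre_product"
  shows "inv\<^bsub>fibre_product\<^esub> (u, v) = (inv\<^bsub>F4\<^esub> u, inv\<^bsub>F4\<^esub> v)"
proof -
  have "inv\<^bsub>fibre_product\<^esub> (u, v) = inv\<^bsub>F4 \<times>\<times> F4\<^esub> (u, v)"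
    using group_hom.hom_inv[OF fibre_product_incl assms] by simp
  then show ?thesis
    using assms by (simp add: carrier_fibre_product inv_DirProd[OF F4.is_group F4.is_group])
qed

text \<open>Only the first coordinate is corrected: modulo the trace of \<open>V\<close> on the
  first factor, \<open>u v\<^sup>-\<^sup>1\<close> is some \<open>r\<close> in \<open>Rel\<close>,
  and \<open>(r v, v)\<close> lies in the fibre product.\<close>

lemma fibre_product_dense:
  assumes V: "V \<in> finite_index_normals (F4 \<times>\<times> F4)" and y: "y \<in> carrier (F4 \<times>\<times> F4)"
  shows "\<exists>x\<in>carrier fibre_product. V #>\<^bsub>F4 \<times>\<times> F4\<^esub> y = V #>\<^bsub>F4 \<times>\<times> F4\<^esub> x"
proof -
  obtain u v where uv: "y = (u, v)" "u \<in> carrier F4" "v \<in> carrier F4" using y by auto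
  interpret V: normal V "F4 \<times>\<times> F4" using V by (simp add: finite_index_normals_def)
  have hom: "(\<lambda>x. (x, \<one>\<^bsub>F4\<^esub>)) \<in> hom F4 (F4 \<times>\<times> F4)" by (auto simp: hom_def)
  define W where "W = {x \<in> carrier F4. (x, \<one>\<^bsub>F4\<^esub>) \<in> V}"
  have W: "W \<in> finite_index_normals F4"
    unfolding W_def by (rule finite_index_normals_vimage[OF F4.is_group hom V])
  interpret W: normal W F4 using W by (simp add: finite_index_normals_def)
  obtain r where r: "r \<in> Rel" "W #>\<^bsub>F4\<^esub> (u \<otimes>\<^bsub>F4\<^esub> inv\<^bsub>F4\<^esub> v) = W #>\<^bsub>F4\<^esub> r"
    using Rel_dense[OF W, of "u \<otimes>\<^bsub>F4\<^esub> inv\<^bsub>F4\<^esub> v"] uv by auto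
  have rc: "r \<in> carrier F4" using r(1) by (rule Rel.mem_carrier)
  have "u \<otimes>\<^bsub>F4\<^esub> inv\<^bsub>F4\<^esub> v \<otimes>\<^bsub>F4\<^esub> inv\<^bsub>F4\<^esub> r \<in> W" using r(2) uv rc by (subst (asm) W.rcos_eq_iff) auto
  then have "(u \<otimes>\<^bsub>F4\<^esub> inv\<^bsub>F4\<^esub> v \<otimes>\<^bsub>F4\<^esub> inv\<^bsub>F4\<^esub> r, \<one>\<^bsub>F4\<^esub>) \<in> V" unfolding W_def by blast
  moreover have "(r \<otimes>\<^bsub>F4\<^esub> v, v) \<in> carrier fibre_product"
    using r(1) rc uv by (simp add: carrier_fibre_product F4.m_assoc)
  ultimately show ?thesis
    using uv rc by (intro bexI[of _ "(r \<otimes>\<^bsub>F4\<^esub> v, v)"])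
      (simp_all add: V.rcos_eq_iff inv_DirProd[OF F4.is_group F4.is_group] F4.inv_mult_group F4.m_assoc)
qed

text \<open>Every element splits as \<open>(u v\<^sup>-\<^sup>1, 1) (v, v)\<close>, so
  \<open>U\<close> is controlled by its traces on \<open>Rel\<close> in the first factor and on the
  diagonal. The first trace contains \<open>B \<inter> Rel\<close> for some \<open>B\<close> of
  finite index in \<open>F4\<close>; intersecting \<open>B\<close> with the second gives
  \<open>E\<close>, and the trace of \<open>E \<times> E\<close> lies inside
  \<open>U\<close>.\<close>

lemma fibre_product_separated:
  assumes U: "U \<in> finite_index_normals fibre_product"
  shows "\<exists>V\<in>finite_index_normals (F4 \<times>\<times> F4). {x \<in> carrier fibre_product. x \<in> V} = U"
proof -
  interpret U: normal U fibre_product using U by (simp add: finite_index_normals_def)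
  define A where "A = {r \<in> carrier F4. (r, \<one>\<^bsub>F4\<^esub>) \<in> U}"
  have A_Rel: "A \<subseteq> Rel"
    using U.subset by (auto simp: A_def carrier_fibre_product dest!: subsetD)
  have diag: "(w, w) \<in> carrier fibre_product" if "w \<in> carrier F4" for w
    using that by (simp add: carrier_fibre_product)
  have rel1: "(r, \<one>\<^bsub>F4\<^esub>) \<in> carrier fibre_product" if "r \<in> Rel" for r
    using that by (simp add: carrier_fibre_product Rel.mem_carrier)
  have "subgroup A F4"
  proof (rule F4.subgroupI)
    show "A \<noteq> {}" using U.one_closed by (auto simp: A_def one_fibre_product)
    show "inv\<^bsub>F4\<^esub> a \<in> A" if "a \<in> A" for a
      using that U.m_inv_closed[of "(a, \<one>\<^bsub>F4\<^esub>)"] rel1[of a] A_Rel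
      by (auto simp: A_def inv_fibre_product)
    show "a \<otimes>\<^bsub>F4\<^esub> b \<in> A" if "a \<in> A" "b \<in> A" for a b
      using that U.m_closed[of "(a, \<one>\<^bsub>F4\<^esub>)" "(b, \<one>\<^bsub>F4\<^esub>)"] by (auto simp: A_def mult_fibre_product)
  qed (auto simp: A_def)
  \<comment> \<open>The fibre product contains the diagonal, so \<open>(a, 1)\<close> may be
    conjugated by \<open>(w, w)\<close> for any \<open>w\<close> in \<open>F4\<close>; normality
    under \<open>Rel\<close> alone would be too weak.\<close>
  then have A: "A \<lhd> F4"
  proof (rule F4.normal_invI)
    fix w a assume w: "w \<in> carrier F4" and a: "a \<in> A"
    then have "(w, w) \<otimes>\<^bsub>fibre_product\<^esub> (a, \<one>\<^bsub>F4\<^esub>) \<otimes>\<^bsub>fibre_product\<^esub> inv\<^bsub>fibre_product\<^esub> (w, w) \<in> U"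
      by (intro U.inv_op_closed2 diag) (auto simp: A_def)
    then show "w \<otimes>\<^bsub>F4\<^esub> a \<otimes>\<^bsub>F4\<^esub> inv\<^bsub>F4\<^esub> w \<in> A"
      using w a by (simp add: A_def mult_fibre_product inv_fibre_product diag)
  qed
  have "finite ((\<lambda>r. A #>\<^bsub>F4\<^esub> r) ` Rel)"
  proof (rule finite_surj)
    show "finite (carrier (fibre_product Mod U))" by (rule finite_index_normals_hom(2)[OF U])
    show "(\<lambda>r. A #>\<^bsub>F4\<^esub> r) ` Rel \<subseteq> (\<lambda>X. {w \<in> carrier F4. (w, \<one>\<^bsub>F4\<^esub>) \<in> X}) ` carrier (fibre_product Mod U)"
    proof clarify
      fix r assume r: "r \<in> Rel"
      have rc: "r \<in> carrier F4" using r by (rule Rel.mem_carrier)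
      have "A #>\<^bsub>F4\<^esub> r = {w \<in> carrier F4. (w, \<one>\<^bsub>F4\<^esub>) \<in> U #>\<^bsub>fibre_product\<^esub> (r, \<one>\<^bsub>F4\<^esub>)}"
      proof (intro equalityI subsetI)
        fix w assume "w \<in> A #>\<^bsub>F4\<^esub> r"
        then show "w \<in> {w \<in> carrier F4. (w, \<one>\<^bsub>F4\<^esub>) \<in> U #>\<^bsub>fibre_product\<^esub> (r, \<one>\<^bsub>F4\<^esub>)}"
          using rc by (force simp: r_coset_def A_def mult_fibre_product)
      next
        fix w assume "w \<in> {w \<in> carrier F4. (w, \<one>\<^bsub>F4\<^esub>) \<in> U #>\<^bsub>fibre_product\<^esub> (r, \<one>\<^bsub>F4\<^esub>)}"
        then obtain a b where w: "w \<in> carrier F4" and ab: "(a, b) \<in> U" "w = a \<otimes>\<^bsub>F4\<^esub> r" "b \<otimes>\<^bsub>F4\<^esub> \<one>\<^bsub>F4\<^esub> = \<one>\<^bsub>F4\<^esub>"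
          by (auto simp: r_coset_def mult_fibre_product)
        have "a \<in> carrier F4" "b \<in> carrier F4" using U.mem_carrier[OF ab(1)] by (auto simp: carrier_fibre_product)
        then show "w \<in> A #>\<^bsub>F4\<^esub> r" using ab by (auto simp: r_coset_def A_def)
      qed
      then show "A #>\<^bsub>F4\<^esub> r \<in> (\<lambda>X. {w \<in> carrier F4. (w, \<one>\<^bsub>F4\<^esub>) \<in> X}) ` carrier (fibre_product Mod U)"
        using rel1[OF r] by (auto simp: carrier_FactGroup)
    qed
  qed
  then obtain B where B: "B \<in> finite_index_normals F4" "B \<inter> Rel \<subseteq> A"
    using finite_index_in_Rel[OF A A_Rel] by blast
  have "(\<lambda>w. (w, w)) \<in> hom F4 fibre_product" using diag by (auto simp: hom_def mult_fibre_product)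
  from finite_index_normals_vimage[OF F4.is_group this U]
  have D: "{w \<in> carrier F4. (w, w) \<in> U} \<in> finite_index_normals F4" .
  define E where "E = B \<inter> {w \<in> carrier F4. (w, w) \<in> U}"
  have E: "E \<in> finite_index_normals F4" unfolding E_def by (rule finite_index_normals_Int[OF B(1) D])
  have EB: "E \<subseteq> B" and EU: "\<And>w. w \<in> E \<Longrightarrow> (w, w) \<in> U" by (auto simp: E_def)
  interpret E: normal E F4 using E by (simp add: finite_index_normals_def)
  have "fst \<in> hom (F4 \<times>\<times> F4) F4" "snd \<in> hom (F4 \<times>\<times> F4) F4" by (auto simp: hom_def)
  then have V: "{x \<in> carrier (F4 \<times>\<times> F4). fst x \<in> E} \<inter> {x \<in> carrier (F4 \<times>\<times> F4). snd x \<in> E}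
      \<in> finite_index_normals (F4 \<times>\<times> F4)" (is "?V \<in> _")
    using E by (intro finite_index_normals_Int finite_index_normals_vimage F4F4.is_group) auto
  have "{x \<in> carrier fibre_product. x \<in> ?V} \<subseteq> U"
  proof clarify
    fix u v assume uv: "(u, v) \<in> carrier fibre_product" "(u, v) \<in> carrier (F4 \<times>\<times> F4)" "fst (u, v) \<in> E" "snd (u, v) \<in> E"
    then have E': "u \<in> E" "v \<in> E" by simp_all
    then have "u \<otimes>\<^bsub>F4\<^esub> inv\<^bsub>F4\<^esub> v \<in> E" by (intro E.m_closed E.m_inv_closed)
    moreover have "u \<otimes>\<^bsub>F4\<^esub> inv\<^bsub>F4\<^esub> v \<in> Rel" using uv(1) by (simp add: carrier_fibre_product)
    ultimately have "u \<otimes>\<^bsub>F4\<^esub> inv\<^bsub>F4\<^esub> v \<in> A" using EB B(2) by blast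
    then have "(u \<otimes>\<^bsub>F4\<^esub> inv\<^bsub>F4\<^esub> v, \<one>\<^bsub>F4\<^esub>) \<otimes>\<^bsub>fibre_product\<^esub> (v, v) \<in> U"
      using EU[OF E'(2)] by (intro U.m_closed) (simp add: A_def)
    then show "(u, v) \<in> U" using uv by (simp add: mult_fibre_product F4.m_assoc)
  qed
  with finite_index_vimage_eq[OF fibre_product_incl V U fibre_product_dense[OF V]]
  show ?thesis by simp
qed

section \<open>Fox derivatives and the homology of the fibre product\<close>

text \<open>\<open>L\<close> receives an image of \<open>Q\<close>. Fox derivatives of words are
  pushed forward to functions on \<open>L\<close>, where the infinite order of the image of
  \<open>a\<close> will keep its powers apart.\<close>

locale relator_quotient = L: group L for L :: "('l, 'm) monoid_scheme" +
  fixes \<pi> :: "(nat \<times> bool) list \<Rightarrow> 'l"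
  assumes pi_hom: "\<pi> \<in> hom F4 L"
    and pi_relator: "i < 4 \<Longrightarrow> \<pi> (relator i) = \<one>\<^bsub>L\<^esub>"
begin

sublocale pi: group_hom F4 L \<pi>
  by (intro group_homI group_free_group L.is_group pi_hom)

lemma pi_Rel: "r \<in> Rel \<Longrightarrow> \<pi> r = \<one>\<^bsub>L\<^esub>"
  using Rel_subset[OF pi.group_hom_axioms L.one_is_normal] pi_relator by simp

text \<open>\<open>fox_coeff w q\<close> is the coefficient of \<open>q\<close> in the image of the Fox derivative of \<open>w\<close> with respect to
  the generator \<open>1\<close>, and \<open>fox_sum w f\<close> is the sum of \<open>f\<close> over the terms of that derivative.\<close>

primrec fox_coeff :: "(nat \<times> bool) list \<Rightarrow> 'l \<Rightarrow> rat" where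
  "fox_coeff [] = (\<lambda>q. 0)"
| "fox_coeff (a # w) = (\<lambda>q.
     (if a = (1, True) then (if q = \<one>\<^bsub>L\<^esub> then 1 else 0)
      else if a = (1, False) then (if q = inv\<^bsub>L\<^esub> \<pi> (gen 1) then - 1 else 0) else 0)
     + fox_coeff w (inv\<^bsub>L\<^esub> letter_val L (\<lambda>i. \<pi> (gen i)) a \<otimes>\<^bsub>L\<^esub> q))"

primrec fox_sum :: "(nat \<times> bool) list \<Rightarrow> ('l \<Rightarrow> rat) \<Rightarrow> rat" where
  "fox_sum [] = (\<lambda>f. 0)"
| "fox_sum (a # w) = (\<lambda>f.
     (if a = (1, True) then f \<one>\<^bsub>L\<^esub> else if a = (1, False) then - f (inv\<^bsub>L\<^esub> \<pi> (gen 1)) else 0)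
     + fox_sum w (\<lambda>q. f (letter_val L (\<lambda>i. \<pi> (gen i)) a \<otimes>\<^bsub>L\<^esub> q)))"

lemma pi_gens: "(\<lambda>i. \<pi> (gen i)) \<in> {..<4} \<rightarrow> carrier L"
  by (intro funcsetI pi.hom_closed gen_in_F4) simp

lemma pi_eq_eval:
  assumes "w \<in> carrier F4"
  shows "\<pi> w = free_eval L (\<lambda>i. \<pi> (gen i)) w"
proof (rule free_group_hom_eq[OF L.is_group pi_hom L.free_eval_hom[OF pi_gens] _ assms])
  fix i :: nat assume "i \<in> {..<4}"
  then have "\<pi> (gen i) \<in> carrier L" by (rule funcset_mem[OF pi_gens])
  then show "\<pi> (gen i) = free_eval L (\<lambda>i. \<pi> (gen i)) (gen i)"
    by (rule L.free_eval_gen[where f = "\<lambda>i. \<pi> (gen i)", symmetric])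
qed

lemma fox_sum_cong:
  assumes "\<And>q. q \<in> carrier L \<Longrightarrow> f q = g q" "set w \<subseteq> {..<4} \<times> UNIV"
  shows "fox_sum w f = fox_sum w g"
  using assms
proof (induction w arbitrary: f g)
  case (Cons a w)
  have a: "letter_val L (\<lambda>i. \<pi> (gen i)) a \<in> carrier L"
    by (rule L.letter_val_closed[OF pi_gens]) (use Cons.prems(2) in simp)
  have "\<pi> (gen 1) \<in> carrier L" by (rule funcset_mem[OF pi_gens]) simp
  then show ?case
    using Cons.prems a Cons.IH[of "\<lambda>q. f (letter_val L (\<lambda>i. \<pi> (gen i)) a \<otimes>\<^bsub>L\<^esub> q)"
        "\<lambda>q. g (letter_val L (\<lambda>i. \<pi> (gen i)) a \<otimes>\<^bsub>L\<^esub> q)"] by simp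
qed simp

lemma fox_sum_add: "fox_sum w (\<lambda>q. f q + g q) = fox_sum w f + fox_sum w g"
  by (induction w arbitrary: f g) simp_all

text \<open>A cancelling pair \<open>t t\<^sup>-\<^sup>1\<close> contributes
  \<open>1 - t t\<^sup>-\<^sup>1 = 0\<close> to the derivative, likewise in the other order, and the
  remaining letters contribute nothing. So free reduction is harmless.\<close>

lemma fox_cons_letter:
  assumes a: "a \<in> {..<4} \<times> UNIV" and w: "set w \<subseteq> {..<4} \<times> UNIV"
  shows "q \<in> carrier L \<Longrightarrow> fox_coeff (cons_letter a w) q = fox_coeff (a # w) q"
    and "fox_sum (cons_letter a w) f = fox_sum (a # w) f"
proof -
  have g1: "\<pi> (gen 1) \<in> carrier L" using pi_gens by auto
  have *: "(q \<in> carrier L \<longrightarrow> fox_coeff (cons_letter a w) q = fox_coeff (a # w) q) \<and>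
    fox_sum (cons_letter a w) f = fox_sum (a # w) f"
  proof (cases "w \<noteq> [] \<and> a = letter_inv (hd w)")
    case True
    then obtain v where w': "w = letter_inv a # v" by (cases w) auto
    obtain i b where ib: "a = (i, b)" "i < 4" using a by auto
    have gi: "\<pi> (gen i) \<in> carrier L" using pi_gens ib by auto
    have v: "set v \<subseteq> {..<4} \<times> UNIV" using w w' by auto
    have l: "letter_val L (\<lambda>i. \<pi> (gen i)) a \<in> carrier L"
      "letter_val L (\<lambda>i. \<pi> (gen i)) (letter_inv a) = inv\<^bsub>L\<^esub> letter_val L (\<lambda>i. \<pi> (gen i)) a"
      using L.letter_val_closed[OF pi_gens a] L.letter_val_inv[OF pi_gens a] by auto
    have "fox_coeff (a # w) q = fox_coeff v q" if q: "q \<in> carrier L"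
    proof -
      have "inv\<^bsub>L\<^esub> \<pi> (gen 1) \<otimes>\<^bsub>L\<^esub> q = inv\<^bsub>L\<^esub> \<pi> (gen 1) \<longleftrightarrow> q = \<one>\<^bsub>L\<^esub>"
        using q g1 by (metis L.inv_closed L.l_cancel_one' L.r_cancel_one)
      moreover have "\<pi> (gen 1) \<otimes>\<^bsub>L\<^esub> q = \<one>\<^bsub>L\<^esub> \<longleftrightarrow> q = inv\<^bsub>L\<^esub> \<pi> (gen 1)"
        using q g1 by (metis L.inv_comm L.inv_equality L.r_inv)
      ultimately show ?thesis
        using q l g1 gi ib(2) unfolding w'
        by (cases b) (auto simp: ib(1) letter_inv_def letter_val_def L.inv_cancel_left)
    qed
    moreover have "fox_sum (a # w) f = fox_sum v f"
    proof -
      have "fox_sum v (\<lambda>q. f (letter_val L (\<lambda>i. \<pi> (gen i)) a \<otimes>\<^bsub>L\<^esub> (inv\<^bsub>L\<^esub> letter_val L (\<lambda>i. \<pi> (gen i)) a \<otimes>\<^bsub>L\<^esub> q))) = fox_sum v f"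
        using l by (intro fox_sum_cong v) (simp add: L.inv_cancel_left)
      then show ?thesis
        using l g1 gi unfolding w'
        by (cases b) (auto simp: ib(1) letter_inv_def letter_val_def)
    qed
    moreover have "cons_letter a w = v" by (simp add: w')
    ultimately show ?thesis by simp
  next
    case False
    then have "cons_letter a w = a # w" by (cases w) auto
    then show ?thesis by simp
  qed
  then show "q \<in> carrier L \<Longrightarrow> fox_coeff (cons_letter a w) q = fox_coeff (a # w) q"
    and "fox_sum (cons_letter a w) f = fox_sum (a # w) f" by blast+
qed

text \<open>The product rule \<open>D (u v) = D u + u (D v)\<close>, with the translation by
  \<open>u\<close> moved into the argument.\<close>

lemma fox_foldr:
  assumes u: "set u \<subseteq> {..<4} \<times> UNIV" and v: "set v \<subseteq> {..<4} \<times> UNIV"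
  shows "q \<in> carrier L \<Longrightarrow> fox_coeff (foldr cons_letter u v) q =
      fox_coeff u q + fox_coeff v (inv\<^bsub>L\<^esub> free_eval L (\<lambda>i. \<pi> (gen i)) u \<otimes>\<^bsub>L\<^esub> q)"
    and "fox_sum (foldr cons_letter u v) f =
      fox_sum u f + fox_sum v (\<lambda>q. f (free_eval L (\<lambda>i. \<pi> (gen i)) u \<otimes>\<^bsub>L\<^esub> q))"
proof -
  have *: "(\<forall>q\<in>carrier L. fox_coeff (foldr cons_letter u v) q =
      fox_coeff u q + fox_coeff v (inv\<^bsub>L\<^esub> free_eval L (\<lambda>i. \<pi> (gen i)) u \<otimes>\<^bsub>L\<^esub> q)) \<and>
    (\<forall>f. fox_sum (foldr cons_letter u v) f =
      fox_sum u f + fox_sum v (\<lambda>q. f (free_eval L (\<lambda>i. \<pi> (gen i)) u \<otimes>\<^bsub>L\<^esub> q)))"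
    using u
  proof (induction u)
    case Nil
    then show ?case using v by (auto simp: free_eval_simps intro!: fox_sum_cong)
  next
    case (Cons a u)
    have a: "a \<in> {..<4} \<times> UNIV" and u: "set u \<subseteq> {..<4} \<times> UNIV" using Cons.prems by auto
    have s: "set (foldr cons_letter u v) \<subseteq> {..<4} \<times> UNIV" using set_mult_word[of u v] u v by blast
    have l: "letter_val L (\<lambda>i. \<pi> (gen i)) a \<in> carrier L" by (rule L.letter_val_closed[OF pi_gens a])
    have e: "free_eval L (\<lambda>i. \<pi> (gen i)) u \<in> carrier L" by (rule L.free_eval_closed[OF pi_gens u])
    note IH = Cons.IH[OF u]
    have "fox_coeff (foldr cons_letter (a # u) v) q =
      fox_coeff (a # u) q + fox_coeff v (inv\<^bsub>L\<^esub> free_eval L (\<lambda>i. \<pi> (gen i)) (a # u) \<otimes>\<^bsub>L\<^esub> q)"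
      if q: "q \<in> carrier L" for q
      using IH q l e fox_cons_letter(1)[OF a s q]
      by (simp add: free_eval_simps L.inv_mult_group L.m_assoc)
    moreover have "fox_sum (foldr cons_letter (a # u) v) f =
      fox_sum (a # u) f + fox_sum v (\<lambda>q. f (free_eval L (\<lambda>i. \<pi> (gen i)) (a # u) \<otimes>\<^bsub>L\<^esub> q))" for f
    proof -
      have "fox_sum v (\<lambda>q. f (letter_val L (\<lambda>i. \<pi> (gen i)) a \<otimes>\<^bsub>L\<^esub> (free_eval L (\<lambda>i. \<pi> (gen i)) u \<otimes>\<^bsub>L\<^esub> q)))
          = fox_sum v (\<lambda>q. f (free_eval L (\<lambda>i. \<pi> (gen i)) (a # u) \<otimes>\<^bsub>L\<^esub> q))"
        using l e by (intro fox_sum_cong v) (simp add: free_eval_simps L.m_assoc)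
      then show ?thesis using IH fox_cons_letter(2)[OF a s, of f] by simp
    qed
    ultimately show ?case by blast
  qed
  then show "q \<in> carrier L \<Longrightarrow> fox_coeff (foldr cons_letter u v) q =
      fox_coeff u q + fox_coeff v (inv\<^bsub>L\<^esub> free_eval L (\<lambda>i. \<pi> (gen i)) u \<otimes>\<^bsub>L\<^esub> q)"
    and "fox_sum (foldr cons_letter u v) f =
      fox_sum u f + fox_sum v (\<lambda>q. f (free_eval L (\<lambda>i. \<pi> (gen i)) u \<otimes>\<^bsub>L\<^esub> q))" by blast+
qed

lemma fox_coeff_mult:
  assumes "u \<in> carrier F4" "v \<in> carrier F4" "q \<in> carrier L"
  shows "fox_coeff (u \<otimes>\<^bsub>F4\<^esub> v) q = fox_coeff u q + fox_coeff v (inv\<^bsub>L\<^esub> \<pi> u \<otimes>\<^bsub>L\<^esub> q)"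
  using fox_foldr(1)[of u v q] assms pi_eq_eval[OF assms(1)]
  by (simp add: mult_free_group carrier_free_group)

lemma fox_sum_mult:
  assumes "u \<in> carrier F4" "v \<in> carrier F4"
  shows "fox_sum (u \<otimes>\<^bsub>F4\<^esub> v) f = fox_sum u f + fox_sum v (\<lambda>q. f (\<pi> u \<otimes>\<^bsub>L\<^esub> q))"
  using fox_foldr(2)[of u v f] assms pi_eq_eval[OF assms(1)]
  by (simp add: mult_free_group carrier_free_group)

text \<open>The cup product of the two Fox derivations on the factors, twisted by right translation by \<open>g\<close>.\<close>

definition fox_cocycle :: "'l \<Rightarrow> (nat \<times> bool) list \<times> (nat \<times> bool) list \<Rightarrow> (nat \<times> bool) list \<times> (nat \<times> bool) list \<Rightarrow> rat" where
  "fox_cocycle g x y = fox_sum (fst x) (\<lambda>q. fox_coeff (snd y) (inv\<^bsub>L\<^esub> \<pi> (fst x) \<otimes>\<^bsub>L\<^esub> q \<otimes>\<^bsub>L\<^esub> g))"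

lemma pi_fibre_product:
  assumes "(u, v) \<in> carrier fibre_product"
  shows "\<pi> u = \<pi> v"
proof -
  have uv: "u \<in> carrier F4" "v \<in> carrier F4" "\<pi> (u \<otimes>\<^bsub>F4\<^esub> inv\<^bsub>F4\<^esub> v) = \<one>\<^bsub>L\<^esub>"
    using assms pi_Rel[of "u \<otimes>\<^bsub>F4\<^esub> inv\<^bsub>F4\<^esub> v"] by (simp_all add: carrier_fibre_product)
  then have "\<pi> u \<otimes>\<^bsub>L\<^esub> inv\<^bsub>L\<^esub> \<pi> v = \<one>\<^bsub>L\<^esub>" by simp
  then show ?thesis using uv by (metis L.inv_equality L.inv_inv pi.hom_closed L.inv_closed)
qed

text \<open>The product rule applied to \<open>x y\<close> in the first factor and to
  \<open>y z\<close> in the second yields the same cross term \<open>fox_sum x1 f\<close>, because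
  \<open>\<pi>\<close> agrees on the two coordinates of \<open>y\<close>. This is where the fibre
  condition enters.\<close>

lemma two_cocycle_fox_cocycle:
  assumes g: "g \<in> carrier L"
  shows "two_cocycle fibre_product (fox_cocycle g)"
  unfolding two_cocycle_def
proof (intro ballI)
  fix x y z assume xyz: "x \<in> carrier fibre_product" "y \<in> carrier fibre_product" "z \<in> carrier fibre_product"
  obtain x1 x2 y1 y2 z1 z2 where eqs: "x = (x1, x2)" "y = (y1, y2)" "z = (z1, z2)"
    by (metis surj_pair)
  have c: "x1 \<in> carrier F4" "x2 \<in> carrier F4" "y1 \<in> carrier F4" "y2 \<in> carrier F4" "z1 \<in> carrier F4" "z2 \<in> carrier F4"
    using xyz by (auto simp: eqs carrier_fibre_product)
  have py: "\<pi> y2 = \<pi> y1" using pi_fibre_product xyz(2) by (simp add: eqs)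
  have w: "set w \<subseteq> {..<4} \<times> UNIV" if "w \<in> carrier F4" for w using that by (simp add: carrier_free_group)
  define f where "f = (\<lambda>q. fox_coeff z2 (inv\<^bsub>L\<^esub> \<pi> y1 \<otimes>\<^bsub>L\<^esub> (inv\<^bsub>L\<^esub> \<pi> x1 \<otimes>\<^bsub>L\<^esub> (q \<otimes>\<^bsub>L\<^esub> g))))"
  have "fox_cocycle g (x \<otimes>\<^bsub>fibre_product\<^esub> y) z
      = fox_sum (x1 \<otimes>\<^bsub>F4\<^esub> y1) (\<lambda>q. fox_coeff z2 (inv\<^bsub>L\<^esub> \<pi> (x1 \<otimes>\<^bsub>F4\<^esub> y1) \<otimes>\<^bsub>L\<^esub> q \<otimes>\<^bsub>L\<^esub> g))"
    by (simp add: fox_cocycle_def eqs mult_fibre_product)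
  also have "\<dots> = fox_sum (x1 \<otimes>\<^bsub>F4\<^esub> y1) f"
    using c g by (intro fox_sum_cong w) (simp_all add: f_def L.inv_mult_group L.m_assoc)
  also have "\<dots> = fox_sum x1 f + fox_sum y1 (\<lambda>q. f (\<pi> x1 \<otimes>\<^bsub>L\<^esub> q))"
    using c by (simp add: fox_sum_mult)
  also have "fox_sum y1 (\<lambda>q. f (\<pi> x1 \<otimes>\<^bsub>L\<^esub> q)) = fox_cocycle g y z"
    unfolding fox_cocycle_def eqs fst_conv snd_conv
    using c g by (intro fox_sum_cong w) (simp_all add: f_def L.m_assoc L.inv_cancel_left)
  finally have 1: "fox_cocycle g (x \<otimes>\<^bsub>fibre_product\<^esub> y) z = fox_sum x1 f + fox_cocycle g y z" .
  have "fox_cocycle g x (y \<otimes>\<^bsub>fibre_product\<^esub> z)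
      = fox_sum x1 (\<lambda>q. fox_coeff (y2 \<otimes>\<^bsub>F4\<^esub> z2) (inv\<^bsub>L\<^esub> \<pi> x1 \<otimes>\<^bsub>L\<^esub> q \<otimes>\<^bsub>L\<^esub> g))"
    by (simp add: fox_cocycle_def eqs mult_fibre_product)
  also have "\<dots> = fox_sum x1 (\<lambda>q. fox_coeff y2 (inv\<^bsub>L\<^esub> \<pi> x1 \<otimes>\<^bsub>L\<^esub> q \<otimes>\<^bsub>L\<^esub> g) + f q)"
    using c g by (intro fox_sum_cong w) (simp_all add: f_def fox_coeff_mult py L.m_assoc)
  also have "\<dots> = fox_cocycle g x y + fox_sum x1 f"
    by (simp add: fox_sum_add fox_cocycle_def eqs)
  finally show "fox_cocycle g y z - fox_cocycle g (x \<otimes>\<^bsub>fibre_product\<^esub> y) z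
      + fox_cocycle g x (y \<otimes>\<^bsub>fibre_product\<^esub> z) - fox_cocycle g x y = 0"
    using 1 by simp
qed

lemma fox_coeff_inv:
  assumes "u \<in> carrier F4" "\<And>q. q \<in> carrier L \<Longrightarrow> fox_coeff u q = 0" "q \<in> carrier L"
  shows "fox_coeff (inv\<^bsub>F4\<^esub> u) q = 0"
  using fox_coeff_mult[of "inv\<^bsub>F4\<^esub> u" u q] assms by (simp add: one_free_group)

lemma fox_coeff_gen:
  "i \<noteq> 1 \<Longrightarrow> fox_coeff (gen i) q = 0"
  "fox_coeff (gen 1) q = (if q = \<one>\<^bsub>L\<^esub> then 1 else 0)"
  by simp_all

lemma relator_1: "relator 1 = gen 1 \<otimes>\<^bsub>F4\<^esub> commutator F4 (gen 3) (gen 2)"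
  unfolding relator_def rel_val_1 ..

text \<open>In \<open>t [t', a']\<close> the letter \<open>t\<close> occurs once, in front, so the
  derivative is the group element \<open>1\<close>. This makes relator \<open>1\<close> the
  convenient one for the generator \<open>t\<close>.\<close>

lemma fox_relator_1:
  assumes "q \<in> carrier L"
  shows "fox_coeff (relator 1) q = (if q = \<one>\<^bsub>L\<^esub> then 1 else 0)"
    and "fox_sum (relator 1) f = f \<one>\<^bsub>L\<^esub>"
proof -
  have g: "gen 1 \<in> carrier F4" "gen 2 \<in> carrier F4" "gen 3 \<in> carrier F4" by (auto intro: gen_in_F4)
  have p: "\<pi> (gen 1) \<in> carrier L" "\<pi> (gen 2) \<in> carrier L" "\<pi> (gen 3) \<in> carrier L" using g by auto
  have z: "fox_coeff (gen i) q = 0" if "i \<noteq> 1" for i q using that by simp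
  have 0: "fox_coeff (commutator F4 (gen 3) (gen 2)) q = 0" if "q \<in> carrier L" for q
    using that g p unfolding commutator_def
    by (simp add: fox_coeff_mult z fox_coeff_inv[OF _ z] del: fox_coeff.simps)
  show "fox_coeff (relator 1) q = (if q = \<one>\<^bsub>L\<^esub> then 1 else 0)"
    unfolding relator_1 using assms g p 0 by (subst fox_coeff_mult) auto
  have z': "fox_sum (gen i) f = 0" if "i \<noteq> 1" for i f using that by simp
  have zi: "fox_sum (inv\<^bsub>F4\<^esub> gen i) f = 0" if "i \<noteq> 1" "i < 4" for i f
  proof -
    have gi: "gen i \<in> carrier F4" by (rule gen_in_F4[OF that(2)])
    have "0 = fox_sum (gen i \<otimes>\<^bsub>F4\<^esub> inv\<^bsub>F4\<^esub> gen i) (\<lambda>q. f (inv\<^bsub>L\<^esub> \<pi> (gen i) \<otimes>\<^bsub>L\<^esub> q))"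
      using gi by (simp only: F4.r_inv) (simp add: one_free_group)
    also have "\<dots> = fox_sum (inv\<^bsub>F4\<^esub> gen i) (\<lambda>q. f (inv\<^bsub>L\<^esub> \<pi> (gen i) \<otimes>\<^bsub>L\<^esub> (\<pi> (gen i) \<otimes>\<^bsub>L\<^esub> q)))"
      unfolding fox_sum_mult[OF gi F4.inv_closed[OF gi]] z'[OF that(1)] by (rule add_0_left)
    also have "\<dots> = fox_sum (inv\<^bsub>F4\<^esub> gen i) f"
      using gi F4.inv_closed[OF gi] by (intro fox_sum_cong) (auto simp: carrier_free_group L.inv_cancel_left)
    finally show ?thesis by simp
  qed
  have 0: "fox_sum (commutator F4 (gen 3) (gen 2)) f = 0" for f
    using g unfolding commutator_def by (simp add: fox_sum_mult z' zi del: fox_sum.simps)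
  show "fox_sum (relator 1) f = f \<one>\<^bsub>L\<^esub>"
    unfolding relator_1 using g by (subst fox_sum_mult) (auto simp: 0)
qed

text \<open>The derivative of \<open>a\<^sup>k r a\<^sup>-\<^sup>k\<close> is the single element
  \<open>a\<^sup>k\<close>, because \<open>a\<close> has derivative zero and
  \<open>\<pi> r = 1\<close>; the twist by \<open>a\<^sup>j\<close> reads off its coefficient at
  \<open>a\<^sup>j\<close>. In the other order the first coordinate is trivial and the cocycle
  vanishes.\<close>

lemma fibre_product_infinite_homology_data:
  assumes inf: "\<And>n. 0 < n \<Longrightarrow> \<pi> (gen 0) [^]\<^bsub>L\<^esub> (n :: nat) \<noteq> \<one>\<^bsub>L\<^esub>"
  defines "h \<equiv> \<lambda>k :: nat. gen 0 [^]\<^bsub>F4\<^esub> k"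
  defines "x \<equiv> (relator 1, \<one>\<^bsub>F4\<^esub>)"
    and "y \<equiv> \<lambda>k. (\<one>\<^bsub>F4\<^esub>, h k \<otimes>\<^bsub>F4\<^esub> relator 1 \<otimes>\<^bsub>F4\<^esub> inv\<^bsub>F4\<^esub> h k)"
  shows "x \<in> carrier fibre_product" "y k \<in> carrier fibre_product"
    "x \<otimes>\<^bsub>fibre_product\<^esub> y k = y k \<otimes>\<^bsub>fibre_product\<^esub> x"
    "two_cocycle fibre_product (fox_cocycle (\<pi> (gen 0) [^]\<^bsub>L\<^esub> j))"
    "fox_cocycle (\<pi> (gen 0) [^]\<^bsub>L\<^esub> j) x (y k) - fox_cocycle (\<pi> (gen 0) [^]\<^bsub>L\<^esub> j) (y k) x
      = (if j = k then 1 else 0)"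
proof -
  have g0: "gen 0 \<in> carrier F4" by (auto intro: gen_in_F4)
  have hc: "h k \<in> carrier F4" using g0 by (simp add: h_def)
  have r: "relator 1 \<in> Rel" "relator 1 \<in> carrier F4" using relator_in_Rel[of 1] relator_closed[of 1] by auto
  have s: "h k \<otimes>\<^bsub>F4\<^esub> relator 1 \<otimes>\<^bsub>F4\<^esub> inv\<^bsub>F4\<^esub> h k \<in> Rel"
    by (rule Rel.inv_op_closed2[OF hc r(1)])
  note sc = Rel.mem_carrier[OF s]
  show "x \<in> carrier fibre_product" using r by (simp add: x_def carrier_fibre_product)
  have "\<one>\<^bsub>F4\<^esub> \<otimes>\<^bsub>F4\<^esub> inv\<^bsub>F4\<^esub> (h k \<otimes>\<^bsub>F4\<^esub> relator 1 \<otimes>\<^bsub>F4\<^esub> inv\<^bsub>F4\<^esub> h k) \<in> Rel"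
    using Rel.m_inv_closed[OF s] sc by simp
  then show "y k \<in> carrier fibre_product" using sc by (simp add: y_def carrier_fibre_product)
  show "x \<otimes>\<^bsub>fibre_product\<^esub> y k = y k \<otimes>\<^bsub>fibre_product\<^esub> x"
    using r sc by (simp add: x_def y_def mult_fibre_product)
  have pc: "\<pi> (gen 0) \<in> carrier L" using g0 by auto
  show "two_cocycle fibre_product (fox_cocycle (\<pi> (gen 0) [^]\<^bsub>L\<^esub> j))"
    using pc by (intro two_cocycle_fox_cocycle) auto
  have ph: "\<pi> (h k) = \<pi> (gen 0) [^]\<^bsub>L\<^esub> k" using g0 by (simp add: h_def pi.hom_nat_pow)
  have h0: "fox_coeff (h k) q = 0" if "q \<in> carrier L" for q
    using that
  proof (induction k arbitrary: q)
    case 0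
    then show ?case by (simp add: h_def one_free_group)
  next
    case (Suc k)
    have "h (Suc k) = h k \<otimes>\<^bsub>F4\<^esub> gen 0" by (simp add: h_def)
    then show ?case using Suc g0 pc by (simp add: fox_coeff_mult h_def pi.hom_nat_pow fox_coeff_gen del: fox_coeff.simps)
  qed
  have s_coeff: "fox_coeff (h k \<otimes>\<^bsub>F4\<^esub> relator 1 \<otimes>\<^bsub>F4\<^esub> inv\<^bsub>F4\<^esub> h k) q = (if q = \<pi> (gen 0) [^]\<^bsub>L\<^esub> k then 1 else 0)"
    if q: "q \<in> carrier L" for q
  proof -
    have pk: "\<pi> (h k) \<in> carrier L" "\<pi> (relator 1) = \<one>\<^bsub>L\<^esub>" using hc pi_relator[of 1] by auto
    have "fox_coeff (h k \<otimes>\<^bsub>F4\<^esub> relator 1 \<otimes>\<^bsub>F4\<^esub> inv\<^bsub>F4\<^esub> h k) q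
        = fox_coeff (relator 1) (inv\<^bsub>L\<^esub> \<pi> (h k) \<otimes>\<^bsub>L\<^esub> q)"
      using hc r q pk by (simp add: fox_coeff_mult h0 fox_coeff_inv[OF hc h0])
    also have "\<dots> = (if inv\<^bsub>L\<^esub> \<pi> (h k) \<otimes>\<^bsub>L\<^esub> q = \<one>\<^bsub>L\<^esub> then 1 else 0)"
      using pk q by (intro fox_relator_1) auto
    also have "inv\<^bsub>L\<^esub> \<pi> (h k) \<otimes>\<^bsub>L\<^esub> q = \<one>\<^bsub>L\<^esub> \<longleftrightarrow> q = \<pi> (h k)"
      using pk q by (metis L.inv_closed L.inv_equality L.inv_inv L.l_inv)
    finally show ?thesis by (simp add: ph)
  qed
  have "fox_cocycle (\<pi> (gen 0) [^]\<^bsub>L\<^esub> j) x (y k) = (if \<pi> (gen 0) [^]\<^bsub>L\<^esub> j = \<pi> (gen 0) [^]\<^bsub>L\<^esub> k then 1 else 0)"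
    unfolding fox_cocycle_def x_def y_def fst_conv snd_conv
    using pc pi_relator[of 1] s_coeff[OF L.nat_pow_closed[OF pc], of j]
    by (subst fox_relator_1(2)[OF L.one_closed]) simp
  moreover have "\<pi> (gen 0) [^]\<^bsub>L\<^esub> j = \<pi> (gen 0) [^]\<^bsub>L\<^esub> k \<longleftrightarrow> j = k"
  proof -
    have "i = l" if "\<pi> (gen 0) [^]\<^bsub>L\<^esub> i = \<pi> (gen 0) [^]\<^bsub>L\<^esub> l" "i \<le> l" for i l :: nat
    proof (rule ccontr)
      assume "i \<noteq> l"
      then have "0 < l - i" using that(2) by simp
      moreover have "\<pi> (gen 0) [^]\<^bsub>L\<^esub> (l - i) \<otimes>\<^bsub>L\<^esub> \<pi> (gen 0) [^]\<^bsub>L\<^esub> i = \<pi> (gen 0) [^]\<^bsub>L\<^esub> i"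
        using L.nat_pow_mult[OF pc, of "l - i" i] that by simp
      then have "\<pi> (gen 0) [^]\<^bsub>L\<^esub> (l - i) = \<one>\<^bsub>L\<^esub>"
        using L.r_cancel_one'[OF L.nat_pow_closed[OF pc] L.nat_pow_closed[OF pc]] by metis
      ultimately show False using inf by blast
    qed
    then show ?thesis by (metis nat_le_linear)
  qed
  moreover have "fox_cocycle (\<pi> (gen 0) [^]\<^bsub>L\<^esub> j) (y k) x = 0"
    by (simp add: fox_cocycle_def x_def y_def one_free_group)
  ultimately show "fox_cocycle (\<pi> (gen 0) [^]\<^bsub>L\<^esub> j) x (y k) - fox_cocycle (\<pi> (gen 0) [^]\<^bsub>L\<^esub> j) (y k) x
      = (if j = k then 1 else 0)" by simp
qed

end

section \<open>Generators, presentations and residual properties\<close>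

lemma (in group) commutator_in_lower_central_2:
  "x \<in> carrier G \<Longrightarrow> y \<in> carrier G \<Longrightarrow> commutator G x y \<in> lower_central G 2"
  using commutator_in_lower_central[of 1 x y] by (simp add: numeral_2_eq_2)

lemma generate_hom_image:
  assumes "group_hom G H h" "S \<subseteq> carrier G" "x \<in> generate G S" "h ` S \<subseteq> T"
  shows "h x \<in> generate H T"
proof -
  interpret group_hom G H h by fact
  have "h x \<in> generate H (h ` S)" using generate_img[OF assms(2)] assms(3) by blast
  then show ?thesis using H.mono_generate[OF assms(4)] by blast
qed

lemma free_group_hom_in_subgroup:
  assumes "group_hom (free_group X) W h" "subgroup C W" "\<And>i. i \<in> X \<Longrightarrow> h (gen i) \<in> C"
    and w: "w \<in> carrier (free_group X)"
  shows "h w \<in> C"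
proof -
  interpret group_hom "free_group X" W h by fact
  have X: "gen ` X \<subseteq> carrier (free_group X)" using gen_in_free_group by (intro image_subsetI)
  have "h w \<in> generate W C"
    by (rule generate_hom_image[OF assms(1) X]) (use w assms(3) generate_free_group[of X] in auto)
  then show ?thesis using H.generate_subgroup_incl[OF order_refl assms(2)] by (rule subsetD[rotated])
qed

definition fibre_gens :: "((nat \<times> bool) list \<times> (nat \<times> bool) list) set" where
  "fibre_gens = (\<lambda>i. (gen i, gen i)) ` {..<4} \<union> (\<lambda>i. (relator i, \<one>\<^bsub>F4\<^esub>)) ` {..<4}"

lemma fibre_gens_subset: "fibre_gens \<subseteq> carrier fibre_product"
  by (auto simp: fibre_gens_def carrier_fibre_product relator_in_Rel gen_in_F4 relator_closed
      simp del: One_nat_def)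

lemma diagonal_hom: "group_hom F4 fibre_product (\<lambda>w. (w, w))"
  by (intro group_homI group_free_group group_fibre_product)
    (auto simp: hom_def carrier_fibre_product mult_fibre_product)

text \<open>The \<open>a\<close> with \<open>(a, 1)\<close> in the generated subgroup form a normal
  subgroup of \<open>F4\<close>, by conjugation with the diagonal. It contains the relators and
  hence all of \<open>Rel\<close>.\<close>

lemma generate_fibre_product: "generate fibre_product fibre_gens = carrier fibre_product"
proof
  show "generate fibre_product fibre_gens \<subseteq> carrier fibre_product"
    by (rule fibre_product.generate_incl[OF fibre_gens_subset])
  let ?K = "generate fibre_product fibre_gens"
  interpret K: subgroup ?K fibre_product by (rule fibre_product.generate_is_subgroup[OF fibre_gens_subset])
  have diag: "(w, w) \<in> ?K" if "w \<in> carrier F4" for w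
    by (rule free_group_hom_in_subgroup[OF diagonal_hom K.subgroup_axioms _ that])
      (auto simp: fibre_gens_def intro!: generate.incl)
  let ?A = "{a \<in> carrier F4. (a, \<one>\<^bsub>F4\<^esub>) \<in> ?K}"
  have AP: "(a, \<one>\<^bsub>F4\<^esub>) \<in> carrier fibre_product" if "a \<in> ?A" for a using that K.mem_carrier by blast
  have "subgroup ?A F4"
  proof (rule F4.subgroupI)
    show "?A \<noteq> {}" using K.one_closed F4.one_closed by (auto simp: one_fibre_product)
    show "inv\<^bsub>F4\<^esub> a \<in> ?A" if "a \<in> ?A" for a
      using K.m_inv_closed[of "(a, \<one>\<^bsub>F4\<^esub>)"] inv_fibre_product[OF AP[OF that]] that by simp
    show "a \<otimes>\<^bsub>F4\<^esub> b \<in> ?A" if "a \<in> ?A" "b \<in> ?A" for a b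
      using K.m_closed[of "(a, \<one>\<^bsub>F4\<^esub>)" "(b, \<one>\<^bsub>F4\<^esub>)"] that by (simp add: mult_fibre_product)
  qed auto
  then have "?A \<lhd> F4"
  proof (rule F4.normal_invI)
    fix w a assume w: "w \<in> carrier F4" and a: "a \<in> ?A"
    have "(w, w) \<otimes>\<^bsub>fibre_product\<^esub> (a, \<one>\<^bsub>F4\<^esub>) \<otimes>\<^bsub>fibre_product\<^esub> inv\<^bsub>fibre_product\<^esub> (w, w) \<in> ?K"
      using diag[OF w] a by (intro K.m_closed K.m_inv_closed) auto
    then show "w \<otimes>\<^bsub>F4\<^esub> a \<otimes>\<^bsub>F4\<^esub> inv\<^bsub>F4\<^esub> w \<in> ?A"
      using w a inv_fibre_product[of w w] by (simp add: mult_fibre_product carrier_fibre_product)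
  qed
  moreover have "relator ` {..<4} \<subseteq> ?A"
    by (auto simp: fibre_gens_def relator_closed intro!: generate.incl)
  ultimately have A: "Rel \<subseteq> ?A" unfolding Rel_def by (rule F4.normal_closure_minimal)
  show "carrier fibre_product \<subseteq> ?K"
  proof clarify
    fix u v assume uv: "(u, v) \<in> carrier fibre_product"
    then have c: "u \<in> carrier F4" "v \<in> carrier F4" "u \<otimes>\<^bsub>F4\<^esub> inv\<^bsub>F4\<^esub> v \<in> Rel"
      by (simp_all add: carrier_fibre_product)
    have "(u \<otimes>\<^bsub>F4\<^esub> inv\<^bsub>F4\<^esub> v, \<one>\<^bsub>F4\<^esub>) \<otimes>\<^bsub>fibre_product\<^esub> (v, v) \<in> ?K"
      using A c diag by (intro K.m_closed) auto
    then show "(u, v) \<in> ?K" using c by (simp add: mult_fibre_product F4.m_assoc)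
  qed
qed

lemma finitely_generated_fibre_product: "finitely_generated_group fibre_product"
  unfolding finitely_generated_group_def
  using generate_fibre_product fibre_gens_subset group_fibre_product
  by (intro conjI exI[of _ fibre_gens]) (auto simp: fibre_gens_def)

lemma finitely_generated_group_surj:
  assumes "group_hom G H h" "h ` carrier G = carrier H" "finitely_generated_group G"
  shows "finitely_generated_group H"
proof -
  interpret group_hom G H h by fact
  obtain S where S: "finite S" "S \<subseteq> carrier G" "generate G S = carrier G"
    using assms(3) by (auto simp: finitely_generated_group_def)
  have "generate H (h ` S) = carrier H" using generate_img[OF S(2)] S(3) assms(2) by simp
  then show ?thesis
    unfolding finitely_generated_group_def using S H.is_group
    by (intro conjI exI[of _ "h ` S"]) auto
qed

lemma finitely_generated_free_group: "finite X \<Longrightarrow> finitely_generated_group (free_group X)"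
  unfolding finitely_generated_group_def
  by (intro conjI exI[of _ "gen ` X"] group_free_group generate_free_group image_subsetI gen_in_free_group)
    simp_all

lemma finitely_generated_finitely_presented:
  assumes "finitely_presented_group G"
  shows "finitely_generated_group G"
proof -
  obtain X :: "nat set" and R where X: "finite X" "R \<subseteq> carrier (free_group X)"
    and iso: "(free_group X Mod normal_closure (free_group X) R) \<cong> G" and G: "group G"
    using assms by (auto simp: finitely_presented_group_def)
  interpret F: group "free_group X" by (rule group_free_group)
  interpret K: normal "normal_closure (free_group X) R" "free_group X"
    by (rule F.normal_closure_normal[OF X(2)])
  let ?Q = "free_group X Mod normal_closure (free_group X) R"
  have "finitely_generated_group ?Q"
    by (rule finitely_generated_group_surj[OF group_homI[OF F.is_group K.factorgroup_is_group K.r_coset_hom_Mod]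
        _ finitely_generated_free_group[OF X(1)]]) (simp add: carrier_FactGroup)
  moreover obtain \<phi> where \<phi>: "\<phi> \<in> iso ?Q G" using iso by (auto simp: is_iso_def)
  then have "group_hom ?Q G \<phi>" "\<phi> ` carrier ?Q = carrier G"
    using G by (auto intro!: group_homI K.factorgroup_is_group simp: iso_def bij_betw_def)
  ultimately show ?thesis using finitely_generated_group_surj by blast
qed

lemma finitely_presented_group_iso:
  assumes "finitely_presented_group G" "G \<cong> H" "group H"
  shows "finitely_presented_group H"
  using assms iso_trans unfolding finitely_presented_group_def by blast

lemma (in group) subgroup_centralizer:
  assumes S: "S \<subseteq> carrier G"
  shows "subgroup {x \<in> carrier G. \<forall>s\<in>S. s \<otimes> x = x \<otimes> s} G" (is "subgroup ?C G")
proof (rule subgroupI)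
  show "?C \<noteq> {}" using S by (auto intro!: exI[of _ \<one>])
  show "inv x \<in> ?C" if x: "x \<in> ?C" for x
  proof -
    have "s \<otimes> inv x = inv x \<otimes> s" if s: "s \<in> S" for s
    proof -
      have c: "s \<in> carrier G" "x \<in> carrier G" "s \<otimes> x = x \<otimes> s" using s S x by auto
      have "inv x \<otimes> (s \<otimes> x) \<otimes> inv x = s \<otimes> inv x"
        unfolding c(3) using c(1,2) by (simp add: m_assoc inv_cancel_left)
      then show ?thesis using c(1,2) by (simp add: m_assoc)
    qed
    then show ?thesis using x by simp
  qed
  show "x \<otimes> y \<in> ?C" if x: "x \<in> ?C" and y: "y \<in> ?C" for x y
  proof -
    have "s \<otimes> (x \<otimes> y) = x \<otimes> y \<otimes> s" if s: "s \<in> S" for s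
    proof -
      have c: "s \<in> carrier G" "x \<in> carrier G" "y \<in> carrier G" "s \<otimes> x = x \<otimes> s" "s \<otimes> y = y \<otimes> s"
        using s S x y by auto
      have "s \<otimes> (x \<otimes> y) = x \<otimes> (s \<otimes> y)" using c(1-4) by (simp flip: m_assoc)
      then show ?thesis using c by (simp add: m_assoc)
    qed
    then show ?thesis using x y by simp
  qed
qed auto

text \<open>Centralizers are subgroups, so commuting passes from generators to words, on one side at
  a time.\<close>

lemma free_group_homs_commute:
  assumes a: "group_hom (free_group X) W a" and b: "group_hom (free_group Y) W b"
    and gens: "\<And>i j. i \<in> X \<Longrightarrow> j \<in> Y \<Longrightarrow> a (gen i) \<otimes>\<^bsub>W\<^esub> b (gen j) = b (gen j) \<otimes>\<^bsub>W\<^esub> a (gen i)"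
    and u: "u \<in> carrier (free_group X)" and v: "v \<in> carrier (free_group Y)"
  shows "a u \<otimes>\<^bsub>W\<^esub> b v = b v \<otimes>\<^bsub>W\<^esub> a u"
proof -
  interpret a: group_hom "free_group X" W a by (rule a)
  interpret b: group_hom "free_group Y" W b by (rule b)
  have gX: "a (gen i) \<in> carrier W" if "i \<in> X" for i
    by (rule a.hom_closed[OF gen_in_free_group[OF that]])
  have gY: "b (gen j) \<in> carrier W" if "j \<in> Y" for j
    by (rule b.hom_closed[OF gen_in_free_group[OF that]])
  have 1: "a (gen i) \<otimes>\<^bsub>W\<^esub> b v = b v \<otimes>\<^bsub>W\<^esub> a (gen i)" if i: "i \<in> X" for i
  proof -
    have "b v \<in> {x \<in> carrier W. \<forall>s\<in>{a (gen i)}. s \<otimes>\<^bsub>W\<^esub> x = x \<otimes>\<^bsub>W\<^esub> s}"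
      by (rule free_group_hom_in_subgroup[OF b a.H.subgroup_centralizer _ v]) (use gX gY gens i in simp_all)
    then show ?thesis by simp
  qed
  have "a u \<in> {x \<in> carrier W. \<forall>s\<in>{b v}. s \<otimes>\<^bsub>W\<^esub> x = x \<otimes>\<^bsub>W\<^esub> s}"
    by (rule free_group_hom_in_subgroup[OF a a.H.subgroup_centralizer _ u]) (use gX 1 v in simp_all)
  then show ?thesis by simp
qed

lemma hom_DirProd_commuting:
  assumes "group_hom A W a" "group_hom B W b"
    and comm: "\<And>u v. u \<in> carrier A \<Longrightarrow> v \<in> carrier B \<Longrightarrow> a u \<otimes>\<^bsub>W\<^esub> b v = b v \<otimes>\<^bsub>W\<^esub> a u"
  shows "(\<lambda>(u, v). a u \<otimes>\<^bsub>W\<^esub> b v) \<in> hom (A \<times>\<times> B) W"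
proof (rule homI)
  interpret a: group_hom A W a by fact
  interpret b: group_hom B W b by fact
  show "(case x of (u, v) \<Rightarrow> a u \<otimes>\<^bsub>W\<^esub> b v) \<in> carrier W" if "x \<in> carrier (A \<times>\<times> B)" for x
    using that by auto
  fix x y assume "x \<in> carrier (A \<times>\<times> B)" "y \<in> carrier (A \<times>\<times> B)"
  then obtain u v u' v' where xy: "x = (u, v)" "y = (u', v')"
    and c: "u \<in> carrier A" "v \<in> carrier B" "u' \<in> carrier A" "v' \<in> carrier B" by auto
  have "a u \<otimes>\<^bsub>W\<^esub> a u' \<otimes>\<^bsub>W\<^esub> (b v \<otimes>\<^bsub>W\<^esub> b v') = a u \<otimes>\<^bsub>W\<^esub> (a u' \<otimes>\<^bsub>W\<^esub> b v) \<otimes>\<^bsub>W\<^esub> b v'"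
    using c by (simp add: a.H.m_assoc)
  also have "\<dots> = a u \<otimes>\<^bsub>W\<^esub> b v \<otimes>\<^bsub>W\<^esub> (a u' \<otimes>\<^bsub>W\<^esub> b v')"
    unfolding comm[OF c(3,2)] using c by (simp add: a.H.m_assoc)
  finally show "(case x \<otimes>\<^bsub>A \<times>\<times> B\<^esub> y of (u, v) \<Rightarrow> a u \<otimes>\<^bsub>W\<^esub> b v)
      = (case x of (u, v) \<Rightarrow> a u \<otimes>\<^bsub>W\<^esub> b v) \<otimes>\<^bsub>W\<^esub> (case y of (u, v) \<Rightarrow> a u \<otimes>\<^bsub>W\<^esub> b v)"
    using c by (simp add: xy)
qed

section \<open>A finite presentation of the product of two free groups\<close>

text \<open>The generators \<open>i\<close> and \<open>i + 4\<close> are sent to the generator \<open>i\<close> of the left and of the right factor.\<close>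

lemma finitely_presented_F4_F4: "finitely_presented_group (F4 \<times>\<times> F4)"
proof -
  let ?X = "{..<8 :: nat}"
  let ?F = "free_group ?X"
  interpret F: group ?F by (rule group_free_group)
  define R where "R = (\<lambda>(i, j). commutator ?F (gen i) (gen (j + 4))) ` ({..<4} \<times> {..<4 :: nat})"
  have g: "gen i \<in> carrier ?F" "gen (i + 4) \<in> carrier ?F" if "i < 4" for i :: nat
    using that by (auto intro: gen_in_free_group)
  have R: "R \<subseteq> carrier ?F" using g by (auto simp: R_def)
  define N where "N = normal_closure ?F R"
  interpret N: normal N ?F unfolding N_def by (rule F.normal_closure_normal[OF R])
  define W where "W = ?F Mod N"
  define q where "q w = N #>\<^bsub>?F\<^esub> w" for w
  interpret q: group_hom ?F W q
    unfolding W_def q_def[abs_def] by (intro group_homI F.is_group N.factorgroup_is_group N.r_coset_hom_Mod)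
  have q_one: "q w = \<one>\<^bsub>W\<^esub> \<longleftrightarrow> w \<in> N" if "w \<in> carrier ?F" for w
    using N.rcos_eq_self_iff[OF that] by (simp add: W_def q_def)
  define f where "f i = (if i < 4 then (gen i, \<one>\<^bsub>F4\<^esub>) else (\<one>\<^bsub>F4\<^esub>, gen (i - 4)))" for i :: nat
  have f: "f \<in> ?X \<rightarrow> carrier (F4 \<times>\<times> F4)" by (auto simp: f_def gen_in_F4)
  define \<Phi> where "\<Phi> = free_eval (F4 \<times>\<times> F4) f"
  interpret P: group_hom ?F "F4 \<times>\<times> F4" \<Phi>
    unfolding \<Phi>_def by (intro group_homI F.is_group F4F4.is_group F4F4.free_eval_hom[OF f])
  have \<Phi>_gen: "\<Phi> (gen i) = f i" if "i < 8" for i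
    unfolding \<Phi>_def using funcset_mem[OF f] that by (intro F4F4.free_eval_gen) simp
  have qc: "(\<lambda>i. q (gen i)) \<in> {..<4} \<rightarrow> carrier W" "(\<lambda>i. q (gen (i + 4))) \<in> {..<4} \<rightarrow> carrier W"
    using q.hom_closed[OF g(1)] q.hom_closed[OF g(2)] by simp_all
  define \<alpha> where "\<alpha> = free_eval W (\<lambda>i. q (gen i))"
  define \<beta> where "\<beta> = free_eval W (\<lambda>i. q (gen (i + 4)))"
  interpret a: group_hom F4 W \<alpha>
    unfolding \<alpha>_def by (intro group_homI F4.is_group q.H.is_group q.H.free_eval_hom[OF qc(1)])
  interpret b: group_hom F4 W \<beta>
    unfolding \<beta>_def by (intro group_homI F4.is_group q.H.is_group q.H.free_eval_hom[OF qc(2)])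
  have \<alpha>_gen: "\<alpha> (gen i) = q (gen i)" if "i < 4" for i
    unfolding \<alpha>_def using q.hom_closed[OF g(1)[OF that]] by (rule q.H.free_eval_gen)
  have \<beta>_gen: "\<beta> (gen i) = q (gen (i + 4))" if "i < 4" for i
    unfolding \<beta>_def using q.hom_closed[OF g(2)[OF that]] by (rule q.H.free_eval_gen)
  have comm: "\<alpha> u \<otimes>\<^bsub>W\<^esub> \<beta> v = \<beta> v \<otimes>\<^bsub>W\<^esub> \<alpha> u" if "u \<in> carrier F4" "v \<in> carrier F4" for u v
  proof (rule free_group_homs_commute[OF a.group_hom_axioms b.group_hom_axioms _ that])
    fix i j :: nat assume "i \<in> {..<4}" "j \<in> {..<4}"
    then have ij: "i < 4" "j < 4" by simp_all
    have "commutator ?F (gen i) (gen (j + 4)) \<in> R" unfolding R_def using ij by (intro image_eqI[of _ _ "(i, j)"]) auto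
    then have "commutator ?F (gen i) (gen (j + 4)) \<in> N"
      unfolding N_def by (rule subsetD[OF F.normal_closure_superset])
    then have "q (commutator ?F (gen i) (gen (j + 4))) = \<one>\<^bsub>W\<^esub>" using q_one N.mem_carrier by blast
    from q.commute_if_commutator_trivial[OF g(1)[OF ij(1)] g(2)[OF ij(2)] this]
    show "\<alpha> (gen i) \<otimes>\<^bsub>W\<^esub> \<beta> (gen j) = \<beta> (gen j) \<otimes>\<^bsub>W\<^esub> \<alpha> (gen i)" using ij by (simp add: \<alpha>_gen \<beta>_gen)
  qed
  \<comment> \<open>\<open>\<psi>\<close> inverts \<open>\<Phi>\<close> modulo \<open>N\<close>: as
    \<open>\<psi> \<circ> \<Phi>\<close> is the projection \<open>q\<close>, the kernel of
    \<open>\<Phi>\<close> lies in \<open>N\<close>.\<close>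
  define \<psi> where "\<psi> = (\<lambda>(u, v). \<alpha> u \<otimes>\<^bsub>W\<^esub> \<beta> v)"
  have \<psi>: "\<psi> \<in> hom (F4 \<times>\<times> F4) W"
    unfolding \<psi>_def by (rule hom_DirProd_commuting[OF a.group_hom_axioms b.group_hom_axioms comm])
  have "(\<lambda>w. \<psi> (\<Phi> w)) \<in> hom ?F W"
    using Group.hom_compose[OF P.homh \<psi>] by (simp add: comp_def)
  then have \<psi>\<Phi>: "\<psi> (\<Phi> w) = q w" if "w \<in> carrier ?F" for w
  proof (rule free_group_hom_eq[OF q.H.is_group _ q.homh _ that])
    fix i assume i: "i \<in> ?X"
    show "\<psi> (\<Phi> (gen i)) = q (gen i)"
    proof (cases "i < 4")
      case True
      have "\<psi> (\<Phi> (gen i)) = \<alpha> (gen i) \<otimes>\<^bsub>W\<^esub> \<beta> \<one>\<^bsub>F4\<^esub>" using i True by (simp add: \<Phi>_gen f_def \<psi>_def)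
      then show ?thesis using q.hom_closed[OF g(1)[OF True]] by (simp only: b.hom_one \<alpha>_gen[OF True] q.H.r_one)
    next
      case False
      then have i4: "i - 4 < 4" "i - 4 + 4 = i" using i by auto
      have "\<psi> (\<Phi> (gen i)) = \<alpha> \<one>\<^bsub>F4\<^esub> \<otimes>\<^bsub>W\<^esub> \<beta> (gen (i - 4))" using i False by (simp add: \<Phi>_gen f_def \<psi>_def)
      then show ?thesis using q.hom_closed[OF g(2)[OF i4(1)]]
        by (simp only: a.hom_one \<beta>_gen[OF i4(1)] q.H.l_one i4(2))
    qed
  qed
  have "kernel ?F (F4 \<times>\<times> F4) \<Phi> = N"
  proof
    show "kernel ?F (F4 \<times>\<times> F4) \<Phi> \<subseteq> N"
    proof
      fix w assume "w \<in> kernel ?F (F4 \<times>\<times> F4) \<Phi>"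
      then have w: "w \<in> carrier ?F" "\<Phi> w = \<one>\<^bsub>F4 \<times>\<times> F4\<^esub>" by (simp_all add: kernel_def)
      have "q w = \<one>\<^bsub>W\<^esub>" using \<psi>\<Phi>[OF w(1)] w(2) hom_one[OF \<psi> F4F4.is_group q.H.is_group] by simp
      then show "w \<in> N" using w(1) q_one by blast
    qed
    have kr: "commutator ?F (gen i) (gen (j + 4)) \<in> kernel ?F (F4 \<times>\<times> F4) \<Phi>" if ij: "i < 4" "j < 4" for i j
    proof -
      have c: "gen i \<in> carrier ?F" "gen (j + 4) \<in> carrier ?F" using g ij by blast+
      have "\<Phi> (commutator ?F (gen i) (gen (j + 4))) = commutator (F4 \<times>\<times> F4) (gen i, \<one>\<^bsub>F4\<^esub>) (\<one>\<^bsub>F4\<^esub>, gen j)"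
        using P.hom_commutator[OF c] ij by (simp add: \<Phi>_gen f_def)
      also have "\<dots> = \<one>\<^bsub>F4 \<times>\<times> F4\<^esub>"
        using gen_in_F4[OF ij(1)] gen_in_F4[OF ij(2)]
        by (simp add: commutator_def inv_DirProd[OF F4.is_group F4.is_group])
      finally show ?thesis unfolding kernel_def using F.commutator_closed[OF c] by blast
    qed
    have "R \<subseteq> kernel ?F (F4 \<times>\<times> F4) \<Phi>"
    proof
      fix r assume "r \<in> R"
      then obtain i j where "i < 4" "j < 4" "r = commutator ?F (gen i) (gen (j + 4))" unfolding R_def by auto
      then show "r \<in> kernel ?F (F4 \<times>\<times> F4) \<Phi>" by (simp only: kr)
    qed
    then show "N \<subseteq> kernel ?F (F4 \<times>\<times> F4) \<Phi>"
      unfolding N_def by (rule F.normal_closure_minimal[OF P.normal_kernel])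
  qed
  moreover have "\<Phi> ` carrier ?F = carrier (F4 \<times>\<times> F4)"
  proof
    have l: "(u, \<one>\<^bsub>F4\<^esub>) \<in> \<Phi> ` carrier ?F" if u: "u \<in> carrier F4" for u
    proof (rule free_group_hom_in_subgroup[OF _ P.img_is_subgroup _ u])
      show "group_hom F4 (F4 \<times>\<times> F4) (\<lambda>u. (u, \<one>\<^bsub>F4\<^esub>))"
        by (intro group_homI F4.is_group F4F4.is_group) (auto simp: hom_def)
      show "(gen i, \<one>\<^bsub>F4\<^esub>) \<in> \<Phi> ` carrier ?F" if "i \<in> {..<4}" for i
        by (rule image_eqI[of _ _ "gen i"]) (use \<Phi>_gen[of i] g(1)[of i] that in \<open>simp_all add: f_def\<close>)
    qed
    have r: "(\<one>\<^bsub>F4\<^esub>, u) \<in> \<Phi> ` carrier ?F" if u: "u \<in> carrier F4" for u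
    proof (rule free_group_hom_in_subgroup[OF _ P.img_is_subgroup _ u])
      show "group_hom F4 (F4 \<times>\<times> F4) (\<lambda>u. (\<one>\<^bsub>F4\<^esub>, u))"
        by (intro group_homI F4.is_group F4F4.is_group) (auto simp: hom_def)
      show "(\<one>\<^bsub>F4\<^esub>, gen i) \<in> \<Phi> ` carrier ?F" if "i \<in> {..<4}" for i
        by (rule image_eqI[of _ _ "gen (i + 4)"]) (use \<Phi>_gen[of "i + 4"] g(2)[of i] that in \<open>simp_all add: f_def\<close>)
    qed
    interpret I: subgroup "\<Phi> ` carrier ?F" "F4 \<times>\<times> F4" by (rule P.img_is_subgroup)
    show "carrier (F4 \<times>\<times> F4) \<subseteq> \<Phi> ` carrier ?F"
    proof
      fix x assume "x \<in> carrier (F4 \<times>\<times> F4)"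
      then obtain u v where x: "x = (u, v)" "u \<in> carrier F4" "v \<in> carrier F4" by auto
      have "(u, \<one>\<^bsub>F4\<^esub>) \<otimes>\<^bsub>F4 \<times>\<times> F4\<^esub> (\<one>\<^bsub>F4\<^esub>, v) \<in> \<Phi> ` carrier ?F"
        by (rule I.m_closed[OF l[OF x(2)] r[OF x(3)]])
      then show "x \<in> \<Phi> ` carrier ?F" using x by simp
    qed
  qed (rule image_subsetI, rule P.hom_closed)
  ultimately have "(?F Mod N) \<cong> F4 \<times>\<times> F4" using P.FactGroup_iso by simp
  then show ?thesis
    unfolding finitely_presented_group_def N_def using R
    by (intro conjI F4F4.is_group exI[of _ ?X] exI[of _ R]) (simp_all add: R_def)
qed

section \<open>Residual properties of products and subgroups\<close>

lemma residually_torsion_free_nilpotent_F4_F4: "residually_torsion_free_nilpotent (F4 \<times>\<times> F4)"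
proof (rule residually_torsion_free_nilpotentI[OF F4F4.is_group])
  fix g assume g: "g \<in> carrier (F4 \<times>\<times> F4)" "g \<noteq> \<one>\<^bsub>F4 \<times>\<times> F4\<^esub>"
  have "\<exists>p\<in>{fst, snd}. p g \<in> carrier F4 \<and> p g \<noteq> \<one>\<^bsub>F4\<^esub>" using g by (cases g) auto
  then obtain p where p: "p = fst \<or> p = snd" "p g \<in> carrier F4" "p g \<noteq> \<one>\<^bsub>F4\<^esub>" by blast
  have hom: "p \<in> hom (F4 \<times>\<times> F4) F4" using p(1) by (auto simp: hom_def)
  obtain H :: "(nat \<times> bool) list set monoid" and \<phi>
    where H: "torsion_free_group H" "nilpotent_group H" "\<phi> \<in> hom F4 H" "\<phi> (p g) \<noteq> \<one>\<^bsub>H\<^esub>"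
    using residually_torsion_free_nilpotent_free_group[of "{..<4 :: nat}"] p(2,3)
    unfolding residually_torsion_free_nilpotent_def residually_def by blast
  have "\<phi> \<circ> p \<in> hom (F4 \<times>\<times> F4) H" using Group.hom_compose[OF hom H(3)] .
  then show "\<exists>(H :: (nat \<times> bool) list set monoid) \<phi>. torsion_free_group H \<and> nilpotent_group H \<and>
      \<phi> \<in> hom (F4 \<times>\<times> F4) H \<and> \<phi> g \<noteq> \<one>\<^bsub>H\<^esub>"
    using H by (intro exI[of _ H] exI[of _ "\<phi> \<circ> p"]) simp
qed

lemma residually_torsion_free_nilpotent_mon:
  assumes "group_hom G H h" "inj_on h (carrier G)" "residually_torsion_free_nilpotent H"
  shows "residually_torsion_free_nilpotent G"
proof -
  interpret group_hom G H h by fact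
  show ?thesis
  proof (rule residually_torsion_free_nilpotentI[OF G.is_group])
    fix g assume g: "g \<in> carrier G" "g \<noteq> \<one>\<^bsub>G\<^esub>"
    then have "h g \<noteq> \<one>\<^bsub>H\<^esub>" using inj_on_one_iff assms(2) by blast
    then obtain K :: "'c set monoid" and \<phi>
      where K: "torsion_free_group K" "nilpotent_group K" "\<phi> \<in> hom H K" "\<phi> (h g) \<noteq> \<one>\<^bsub>K\<^esub>"
      using assms(3) g(1) unfolding residually_torsion_free_nilpotent_def residually_def
      by (meson hom_closed)
    have "\<phi> \<circ> h \<in> hom G K" using Group.hom_compose[OF homh K(3)] .
    then show "\<exists>(K :: 'c set monoid) \<phi>. torsion_free_group K \<and> nilpotent_group K \<and> \<phi> \<in> hom G K \<and> \<phi> g \<noteq> \<one>\<^bsub>K\<^esub>"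
      using K by (intro exI[of _ K] exI[of _ "\<phi> \<circ> h"]) simp
  qed
qed

lemma residually_nilpotent_if_torsion_free:
  "residually_torsion_free_nilpotent G \<Longrightarrow> residually_nilpotent G"
  unfolding residually_torsion_free_nilpotent_def residually_nilpotent_def residually_def by blast

section \<open>The nilpotent genus of the fibre product\<close>

definition relator_map :: "(nat \<times> bool) list \<Rightarrow> (nat \<times> bool) list" where
  "relator_map = free_eval F4 relator"

lemma relator_map_hom: "group_hom F4 F4 relator_map"
  unfolding relator_map_def
  by (intro group_homI F4.is_group F4.free_eval_hom) (auto intro: relator_closed)

lemma relator_map_gen: "i < 4 \<Longrightarrow> relator_map (gen i) = relator i"
  unfolding relator_map_def by (rule F4.free_eval_gen) (rule relator_closed)

lemma relator_map_Rel:
  assumes "w \<in> carrier F4"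
  shows "relator_map w \<in> Rel"
  by (rule free_group_hom_in_subgroup[OF relator_map_hom Rel.subgroup_axioms _ assms])
    (simp add: relator_map_gen relator_in_Rel)

lemma relator_map_near:
  assumes "w \<in> carrier F4"
  shows "relator_map w \<otimes>\<^bsub>F4\<^esub> inv\<^bsub>F4\<^esub> w \<in> lower_central F4 2"
proof -
  let ?D = "lower_central F4 2"
  interpret D: normal ?D F4 by (rule F4.lower_central_normal)
  interpret r: group_hom F4 F4 relator_map by (rule relator_map_hom)
  have hom: "(\<lambda>w. ?D #>\<^bsub>F4\<^esub> relator_map w) \<in> hom F4 (F4 Mod ?D)"
    using Group.hom_compose[OF r.homh D.r_coset_hom_Mod] by (simp add: comp_def)
  have "?D #>\<^bsub>F4\<^esub> relator_map w = ?D #>\<^bsub>F4\<^esub> w"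
  proof (rule free_group_hom_eq[OF D.factorgroup_is_group hom D.r_coset_hom_Mod _ assms])
    fix i :: nat assume "i \<in> {..<4}"
    then have i: "i < 4" by simp
    obtain c d where cd: "c \<in> carrier F4" "d \<in> carrier F4" "relator i = gen i \<otimes>\<^bsub>F4\<^esub> commutator F4 c d"
      using relator_form[OF i] by blast
    have "commutator F4 c d \<in> ?D"
      by (rule group.commutator_in_lower_central_2[OF F4.is_group cd(1,2)])
    then have "gen i \<otimes>\<^bsub>F4\<^esub> commutator F4 c d \<otimes>\<^bsub>F4\<^esub> inv\<^bsub>F4\<^esub> gen i \<in> ?D"
      using gen_in_F4[OF i] by (intro D.inv_op_closed2)
    then show "?D #>\<^bsub>F4\<^esub> relator_map (gen i) = ?D #>\<^bsub>F4\<^esub> gen i"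
      using gen_in_F4[OF i] cd by (simp add: relator_map_gen[OF i] D.rcos_eq_iff)
  qed
  then show ?thesis using assms by (simp add: D.rcos_eq_iff)
qed

lemma relator_map_fibre_hom:
  "group_hom (F4 \<times>\<times> F4) fibre_product (\<lambda>(u, v). (relator_map u, relator_map v))"
proof -
  interpret r: group_hom F4 F4 relator_map by (rule relator_map_hom)
  have "relator_map u \<otimes>\<^bsub>F4\<^esub> inv\<^bsub>F4\<^esub> relator_map v \<in> Rel" if "u \<in> carrier F4" "v \<in> carrier F4" for u v
    using relator_map_Rel that by (intro Rel.m_closed Rel.m_inv_closed)
  then show ?thesis
    by (intro group_homI F4F4.is_group group_fibre_product)
      (auto simp: hom_def carrier_fibre_product mult_fibre_product)
qed

text \<open>Surjectivity on the abelianization of the fibre product is checked on its generators.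
  The pair \<open>(r\<^sub>i, 1)\<close> is the image of \<open>(x\<^sub>i, 1)\<close>, and
  \<open>(x\<^sub>i, x\<^sub>i)\<close> differs from \<open>(r\<^sub>i, r\<^sub>i)\<close> by a
  commutator of diagonal elements, that is, by a commutator taken inside the fibre product.\<close>

lemma fibre_product_lower_central_quotients:
  assumes "1 \<le> c"
  shows "fibre_product Mod lower_central fibre_product c \<cong> (F4 \<times>\<times> F4) Mod lower_central (F4 \<times>\<times> F4) c"
proof (rule lower_central_quotients_iso[OF fibre_product_incl relator_map_fibre_hom _ _ assms])
  interpret r: group_hom F4 F4 relator_map by (rule relator_map_hom)
  fix g assume "g \<in> carrier (F4 \<times>\<times> F4)"
  then obtain u v where g: "g = (u, v)" "u \<in> carrier F4" "v \<in> carrier F4" by auto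
  interpret D: normal "lower_central (F4 \<times>\<times> F4) 2" "F4 \<times>\<times> F4" by (rule F4F4.lower_central_normal)
  have l: "group_hom F4 (F4 \<times>\<times> F4) (\<lambda>u. (u, \<one>\<^bsub>F4\<^esub>))" and r: "group_hom F4 (F4 \<times>\<times> F4) (\<lambda>u. (\<one>\<^bsub>F4\<^esub>, u))"
    by (intro group_homI F4.is_group F4F4.is_group; auto simp: hom_def)+
  have "(relator_map u \<otimes>\<^bsub>F4\<^esub> inv\<^bsub>F4\<^esub> u, \<one>\<^bsub>F4\<^esub>) \<otimes>\<^bsub>F4 \<times>\<times> F4\<^esub> (\<one>\<^bsub>F4\<^esub>, relator_map v \<otimes>\<^bsub>F4\<^esub> inv\<^bsub>F4\<^esub> v)
      \<in> lower_central (F4 \<times>\<times> F4) 2"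
    using group_hom.lower_central_image[OF l, of 2] group_hom.lower_central_image[OF r, of 2]
      relator_map_near g by (intro D.m_closed) auto
  then have "(relator_map u, relator_map v) \<otimes>\<^bsub>F4 \<times>\<times> F4\<^esub> inv\<^bsub>F4 \<times>\<times> F4\<^esub> (u, v) \<in> lower_central (F4 \<times>\<times> F4) 2"
    using g by (simp add: inv_DirProd[OF F4.is_group F4.is_group])
  then show "lower_central (F4 \<times>\<times> F4) 2 #>\<^bsub>F4 \<times>\<times> F4\<^esub> (case g of (u, v) \<Rightarrow> (relator_map u, relator_map v))
      = lower_central (F4 \<times>\<times> F4) 2 #>\<^bsub>F4 \<times>\<times> F4\<^esub> g"
    using g by (simp add: D.rcos_eq_iff)
next
  let ?\<Theta> = "\<lambda>(u, v). (relator_map u, relator_map v)"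
  let ?E = "lower_central fibre_product 2"
  interpret t: group_hom "F4 \<times>\<times> F4" fibre_product ?\<Theta> by (rule relator_map_fibre_hom)
  interpret E: normal ?E fibre_product by (rule fibre_product.lower_central_normal)
  interpret d: group_hom F4 fibre_product "\<lambda>w. (w, w)" by (rule diagonal_hom)
  interpret r: group_hom F4 F4 relator_map by (rule relator_map_hom)
  have gens: "\<exists>g\<in>carrier (F4 \<times>\<times> F4). ?E #>\<^bsub>fibre_product\<^esub> x = ?E #>\<^bsub>fibre_product\<^esub> ?\<Theta> g" if "x \<in> fibre_gens" for x
  proof -
    obtain i where i: "i < 4" and x: "x = (gen i, gen i) \<or> x = (relator i, \<one>\<^bsub>F4\<^esub>)"
      using \<open>x \<in> fibre_gens\<close> by (auto simp: fibre_gens_def)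
    note g = gen_in_F4[OF i]
    show ?thesis
      using x
    proof
      assume x: "x = (gen i, gen i)"
      obtain c d where cd: "c \<in> carrier F4" "d \<in> carrier F4" "relator i = gen i \<otimes>\<^bsub>F4\<^esub> commutator F4 c d"
        using relator_form[OF i] by blast
      have xP: "x \<in> carrier fibre_product" using d.hom_closed[OF g] by (simp add: x)
      define k where "k = commutator fibre_product (c, c) (d, d)"
      have kE: "k \<in> ?E"
        unfolding k_def
        by (rule group.commutator_in_lower_central_2[OF group_fibre_product d.hom_closed[OF cd(1)] d.hom_closed[OF cd(2)]])
      have "(relator i, relator i) = x \<otimes>\<^bsub>fibre_product\<^esub> k"
        using d.hom_commutator[OF cd(1,2)] d.hom_mult[OF g, of "commutator F4 c d"] cd
        by (simp add: x k_def)
      moreover have "x \<otimes>\<^bsub>fibre_product\<^esub> k \<otimes>\<^bsub>fibre_product\<^esub> inv\<^bsub>fibre_product\<^esub> x \<in> ?E"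
        by (rule E.inv_op_closed2[OF xP kE])
      ultimately have "?E #>\<^bsub>fibre_product\<^esub> (relator i, relator i) = ?E #>\<^bsub>fibre_product\<^esub> x"
        using xP E.mem_carrier[OF kE] by (simp add: E.rcos_eq_iff)
      then show ?thesis using g by (intro bexI[of _ "(gen i, gen i)"]) (simp_all add: relator_map_gen[OF i])
    next
      assume "x = (relator i, \<one>\<^bsub>F4\<^esub>)"
      then show ?thesis using g r.hom_one
        by (intro bexI[of _ "(gen i, \<one>\<^bsub>F4\<^esub>)"]) (simp_all add: relator_map_gen[OF i])
    qed
  qed
  fix x assume "x \<in> carrier fibre_product"
  then have "x \<in> generate fibre_product fibre_gens" by (simp add: generate_fibre_product)
  then show "\<exists>g\<in>carrier (F4 \<times>\<times> F4). ?E #>\<^bsub>fibre_product\<^esub> x = ?E #>\<^bsub>fibre_product\<^esub> ?\<Theta> g"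
  proof induction
    case one
    show ?case by (rule bexI[OF _ F4F4.one_closed]) (simp only: t.hom_one)
  next
    case (incl s)
    then show ?case by (rule gens)
  next
    case (inv s)
    then obtain g where g: "g \<in> carrier (F4 \<times>\<times> F4)" "?E #>\<^bsub>fibre_product\<^esub> s = ?E #>\<^bsub>fibre_product\<^esub> ?\<Theta> g"
      using gens by blast
    have "s \<in> carrier fibre_product" using inv fibre_gens_subset by blast
    then have "?E #>\<^bsub>fibre_product\<^esub> inv\<^bsub>fibre_product\<^esub> s = ?E #>\<^bsub>fibre_product\<^esub> inv\<^bsub>fibre_product\<^esub> ?\<Theta> g"
      using g t.hom_closed[OF g(1)] by (metis E.rcos_inv)
    then show ?case using g t.hom_inv[OF g(1)] by (metis F4F4.inv_closed)
  next
    case (eng s u)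
    have su: "s \<in> carrier fibre_product" "u \<in> carrier fibre_product"
      using eng.hyps generate_fibre_product by auto
    obtain g k where gk: "g \<in> carrier (F4 \<times>\<times> F4)" "?E #>\<^bsub>fibre_product\<^esub> s = ?E #>\<^bsub>fibre_product\<^esub> ?\<Theta> g"
      "k \<in> carrier (F4 \<times>\<times> F4)" "?E #>\<^bsub>fibre_product\<^esub> u = ?E #>\<^bsub>fibre_product\<^esub> ?\<Theta> k"
      using eng.IH by blast
    have "?E #>\<^bsub>fibre_product\<^esub> (s \<otimes>\<^bsub>fibre_product\<^esub> u) = ?E #>\<^bsub>fibre_product\<^esub> (?\<Theta> g \<otimes>\<^bsub>fibre_product\<^esub> ?\<Theta> k)"
      using su gk t.hom_closed[OF gk(1)] t.hom_closed[OF gk(3)] by (metis E.rcos_sum)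
    then show ?case using gk t.hom_mult[OF gk(1,3)] by (metis F4F4.m_closed)
  qed
qed

section \<open>Transport to the natural numbers\<close>

text \<open>The groups of the theorem live on \<open>nat\<close>; words over a countable alphabet
  are countable.\<close>

definition nat_copy :: "('a :: countable, 'b) monoid_scheme \<Rightarrow> nat monoid" where
  "nat_copy G = \<lparr>carrier = to_nat ` carrier G,
     monoid.mult = (\<lambda>m n. to_nat (from_nat m \<otimes>\<^bsub>G\<^esub> from_nat n)), one = to_nat \<one>\<^bsub>G\<^esub>\<rparr>"

lemma nat_copy_iso: "to_nat \<in> iso G (nat_copy G)"
  by (auto simp: iso_def hom_def nat_copy_def bij_betw_def inj_on_def)

lemma group_nat_copy:
  assumes "group G"
  shows "group (nat_copy G)"
proof -
  interpret group G by fact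
  show ?thesis
  proof (rule groupI)
    fix x assume "x \<in> carrier (nat_copy G)"
    then obtain a where a: "a \<in> carrier G" "x = to_nat a" by (auto simp: nat_copy_def)
    then show "\<exists>y\<in>carrier (nat_copy G). y \<otimes>\<^bsub>nat_copy G\<^esub> x = \<one>\<^bsub>nat_copy G\<^esub>"
      by (intro bexI[of _ "to_nat (inv\<^bsub>G\<^esub> a)"]) (auto simp: nat_copy_def)
  qed (auto simp: nat_copy_def m_assoc)
qed

lemma nat_copy_homs:
  assumes "group G"
  shows "group_hom G (nat_copy G) to_nat" "group_hom (nat_copy G) G from_nat"
  using assms nat_copy_iso[of G] group_nat_copy[OF assms]
  by (auto intro!: group_homI simp: iso_def) (auto simp: hom_def nat_copy_def)

text \<open>The two maps are mutually inverse, so the conditions on abelianizations hold on the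
  nose.\<close>

lemma nat_copy_lower_central_quotients:
  assumes "group G" "1 \<le> c"
  shows "nat_copy G Mod lower_central (nat_copy G) c \<cong> G Mod lower_central G c"
  by (rule lower_central_quotients_iso[OF nat_copy_homs(2,1)[OF assms(1)] _ _ assms(2)])
    (auto simp: nat_copy_def)

lemma two_cocycle_vimage:
  assumes "group_hom G H h" "two_cocycle H c"
  shows "two_cocycle G (\<lambda>x y. c (h x) (h y))"
proof -
  interpret group_hom G H h by fact
  show ?thesis using assms(2) by (auto simp: two_cocycle_def)
qed

text \<open>Both groups share one element type and hence one numbering, so the inclusion stays the
  identity on numbers.\<close>

lemma nat_copy_fibre_product_incl: "group_hom (nat_copy fibre_product) (nat_copy (F4 \<times>\<times> F4)) (\<lambda>x. x)"
proof (intro group_homI group_nat_copy group_fibre_product F4F4.is_group homI)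
  fix x assume "x \<in> carrier (nat_copy fibre_product)"
  then show "x \<in> carrier (nat_copy (F4 \<times>\<times> F4))"
    by (auto simp: nat_copy_def carrier_fibre_product)
qed (simp add: nat_copy_def fibre_product_def)

text \<open>Density and separation are moved along the numbering, by taking preimages of subgroups
  of finite index under \<open>to_nat\<close> and \<open>from_nat\<close>.\<close>

lemma same_profinite_completion_nat_copy:
  "same_profinite_completion (nat_copy fibre_product) (nat_copy (F4 \<times>\<times> F4))"
proof (rule same_profinite_completionI[OF nat_copy_fibre_product_incl])
  let ?G = "nat_copy (F4 \<times>\<times> F4)"
  interpret e: group_hom "F4 \<times>\<times> F4" ?G to_nat by (rule nat_copy_homs(1)[OF F4F4.is_group])
  fix V y assume V: "V \<in> finite_index_normals ?G" and y: "y \<in> carrier ?G"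
  interpret V: normal V ?G using V by (simp add: finite_index_normals_def)
  define V0 where "V0 = {x \<in> carrier (F4 \<times>\<times> F4). to_nat x \<in> V}"
  have V0: "V0 \<in> finite_index_normals (F4 \<times>\<times> F4)"
    unfolding V0_def by (rule finite_index_normals_vimage[OF F4F4.is_group e.homh V])
  then interpret V0: normal V0 "F4 \<times>\<times> F4" by (simp add: finite_index_normals_def)
  obtain y0 where y0: "y0 \<in> carrier (F4 \<times>\<times> F4)" "y = to_nat y0" using y by (auto simp: nat_copy_def)
  obtain x where x: "x \<in> carrier fibre_product" "V0 #>\<^bsub>F4 \<times>\<times> F4\<^esub> y0 = V0 #>\<^bsub>F4 \<times>\<times> F4\<^esub> x"
    using fibre_product_dense[OF V0 y0(1)] by blast
  have xc: "x \<in> carrier (F4 \<times>\<times> F4)" using group_hom.hom_closed[OF fibre_product_incl x(1)] by simp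
  have "y0 \<otimes>\<^bsub>F4 \<times>\<times> F4\<^esub> inv\<^bsub>F4 \<times>\<times> F4\<^esub> x \<in> V0" using V0.rcos_eq_iff[OF y0(1) xc] x(2) by simp
  then have "to_nat (y0 \<otimes>\<^bsub>F4 \<times>\<times> F4\<^esub> inv\<^bsub>F4 \<times>\<times> F4\<^esub> x) \<in> V" unfolding V0_def by blast
  then have "y \<otimes>\<^bsub>?G\<^esub> inv\<^bsub>?G\<^esub> to_nat x \<in> V"
    using e.hom_mult[OF y0(1) F4F4.inv_closed[OF xc]] e.hom_inv[OF xc] y0(2) by simp
  then have "V #>\<^bsub>?G\<^esub> y = V #>\<^bsub>?G\<^esub> to_nat x" using V.rcos_eq_iff[OF y e.hom_closed[OF xc]] by simp
  moreover have "to_nat x \<in> carrier (nat_copy fibre_product)" using x(1) by (simp add: nat_copy_def)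
  ultimately show "\<exists>x\<in>carrier (nat_copy fibre_product). V #>\<^bsub>?G\<^esub> y = V #>\<^bsub>?G\<^esub> x" by blast
next
  let ?N = "nat_copy fibre_product" and ?G = "nat_copy (F4 \<times>\<times> F4)"
  fix U assume U: "U \<in> finite_index_normals ?N"
  let ?U0 = "{x \<in> carrier fibre_product. to_nat x \<in> U}"
  have "?U0 \<in> finite_index_normals fibre_product"
    by (rule finite_index_normals_vimage[OF group_fibre_product
          group_hom.homh[OF nat_copy_homs(1)[OF group_fibre_product]] U])
  then obtain V0 where V0: "V0 \<in> finite_index_normals (F4 \<times>\<times> F4)" "{x \<in> carrier fibre_product. x \<in> V0} = ?U0"
    using fibre_product_separated by blast
  have V: "{y \<in> carrier ?G. from_nat y \<in> V0} \<in> finite_index_normals ?G"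
    by (rule finite_index_normals_vimage[OF group_nat_copy[OF F4F4.is_group]
          group_hom.homh[OF nat_copy_homs(2)[OF F4F4.is_group]] V0(1)])
  have "U \<subseteq> carrier ?N"
    using U by (auto simp: finite_index_normals_def dest: normal_imp_subgroup subgroup.mem_carrier)
  moreover have "x \<in> {y \<in> carrier ?G. from_nat y \<in> V0} \<longleftrightarrow> x \<in> U" if x: "x \<in> carrier ?N" for x
  proof -
    obtain a where a: "a \<in> carrier fibre_product" "x = to_nat a" using x by (auto simp: nat_copy_def)
    have "x \<in> carrier ?G" by (rule group_hom.hom_closed[OF nat_copy_fibre_product_incl x])
    moreover have "a \<in> V0 \<longleftrightarrow> to_nat a \<in> U" using V0(2) a(1) by blast
    ultimately show ?thesis by (simp add: a(2))
  qed
  ultimately have "{x \<in> carrier ?N. x \<in> {y \<in> carrier ?G. from_nat y \<in> V0}} = U" by blast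
  then show "\<exists>V\<in>finite_index_normals ?G. {x \<in> carrier ?N. x \<in> V} = U" using V by blast
qed

lemma infinite_homology_nat_copy:
  "\<not> vectorspace.fin_dim class_ring (rational_homology (nat_copy fibre_product) 2)"
proof -
  obtain L :: "(((int \<times> rat) \<times> (nat \<times> bool) list \<Rightarrow> (int \<times> rat) \<times> (nat \<times> bool) list) \<Rightarrow>
      (int \<times> rat) \<times> (nat \<times> bool) list \<Rightarrow> (int \<times> rat) \<times> (nat \<times> bool) list) monoid"
    and \<pi> where L: "group L" "\<pi> \<in> hom F4 L" "\<And>i. i < 4 \<Longrightarrow> \<pi> (relator i) = \<one>\<^bsub>L\<^esub>"
    "\<And>n. 0 < n \<Longrightarrow> \<pi> (gen 0) [^]\<^bsub>L\<^esub> (n :: nat) \<noteq> \<one>\<^bsub>L\<^esub>"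
    using infinite_quotient by blast
  interpret relator_quotient L \<pi>
    using L by (simp add: relator_quotient_def relator_quotient_axioms_def)
  note data = fibre_product_infinite_homology_data[OF L(4)]
  interpret e: group_hom fibre_product "nat_copy fibre_product" to_nat
    by (rule nat_copy_homs(1)[OF group_fibre_product])
  let ?x = "(relator 1, \<one>\<^bsub>F4\<^esub>)"
  let ?h = "\<lambda>k :: nat. gen 0 [^]\<^bsub>F4\<^esub> k"
  let ?y = "\<lambda>k. (\<one>\<^bsub>F4\<^esub>, ?h k \<otimes>\<^bsub>F4\<^esub> relator 1 \<otimes>\<^bsub>F4\<^esub> inv\<^bsub>F4\<^esub> ?h k)"
  show ?thesis
  \<comment> \<open>The commuting pairs are pushed forward by \<open>to_nat\<close> and the cocycles
    pulled back along \<open>from_nat\<close>, so their pairing is unchanged.\<close>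
  proof (rule infinite_second_homology[OF e.H.is_group, where x = "\<lambda>_. to_nat ?x" and y = "\<lambda>k. to_nat (?y k)"
        and c = "\<lambda>j m n. fox_cocycle (\<pi> (gen 0) [^]\<^bsub>L\<^esub> j) (from_nat m) (from_nat n)"])
    show "to_nat ?x \<otimes>\<^bsub>nat_copy fibre_product\<^esub> to_nat (?y k) = to_nat (?y k) \<otimes>\<^bsub>nat_copy fibre_product\<^esub> to_nat ?x" for k
      using e.hom_mult[OF data(1,2)] e.hom_mult[OF data(2,1)] data(3) by metis
    show "two_cocycle (nat_copy fibre_product) (\<lambda>m n. fox_cocycle (\<pi> (gen 0) [^]\<^bsub>L\<^esub> j) (from_nat m) (from_nat n))"
      for j :: nat
      by (rule two_cocycle_vimage[OF nat_copy_homs(2)[OF group_fibre_product] data(4)])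
  qed (use data e.hom_closed in simp_all)
qed

theorem theoremB:
  shows "\<exists>(N :: nat monoid) (\<Gamma> :: nat monoid) \<iota>.
           group N \<and> group \<Gamma> \<and>
           finitely_generated_group N \<and> finitely_generated_group \<Gamma> \<and>
           residually_torsion_free_nilpotent N \<and> residually_torsion_free_nilpotent \<Gamma> \<and>
           \<iota> \<in> hom N \<Gamma> \<and> inj_on \<iota> (carrier N) \<and>
           same_nilpotent_genus N \<Gamma> \<and>
           same_profinite_completion N \<Gamma> \<and>
           finitely_presented_group \<Gamma> \<and>
           \<not> vectorspace.fin_dim class_ring (rational_homology N 2)"
proof -
  let ?N = "nat_copy fibre_product" and ?G = "nat_copy (F4 \<times>\<times> F4)"
  interpret i: group_hom ?N ?G "\<lambda>x. x" by (rule nat_copy_fibre_product_incl)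
  have fp: "finitely_presented_group ?G"
    using finitely_presented_group_iso[OF finitely_presented_F4_F4 _ i.H.is_group] nat_copy_iso
    by (auto simp: is_iso_def)
  have fg: "finitely_generated_group ?N"
    by (rule finitely_generated_group_surj[OF nat_copy_homs(1)[OF group_fibre_product] _
          finitely_generated_fibre_product]) (simp add: nat_copy_def)
  have rG: "residually_torsion_free_nilpotent ?G"
    by (rule residually_torsion_free_nilpotent_mon[OF nat_copy_homs(2)[OF F4F4.is_group] _
          residually_torsion_free_nilpotent_F4_F4]) (auto simp: nat_copy_def inj_on_def)
  have rN: "residually_torsion_free_nilpotent ?N"
    by (rule residually_torsion_free_nilpotent_mon[OF i.group_hom_axioms _ rG]) simp
  have "?N Mod lower_central ?N c \<cong> ?G Mod lower_central ?G c" if c: "1 \<le> c" for c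
  proof -
    have "?N Mod lower_central ?N c \<cong> fibre_product Mod lower_central fibre_product c"
      by (rule nat_copy_lower_central_quotients[OF group_fibre_product c])
    also have "\<dots> \<cong> (F4 \<times>\<times> F4) Mod lower_central (F4 \<times>\<times> F4) c"
      by (rule fibre_product_lower_central_quotients[OF c])
    also have "\<dots> \<cong> ?G Mod lower_central ?G c"
      by (rule group.iso_sym[OF normal.factorgroup_is_group[OF i.H.lower_central_normal]
            nat_copy_lower_central_quotients[OF F4F4.is_group c]])
    finally show ?thesis .
  qed
  then have "same_nilpotent_genus ?N ?G"
    unfolding same_nilpotent_genus_def
    using rN rG residually_nilpotent_if_torsion_free by blast
  then show ?thesis
    using i.G.is_group i.H.is_group fg finitely_generated_finitely_presented[OF fp] rN rG i.homh
      same_profinite_completion_nat_copy fp infinite_homology_nat_copy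
    by (intro exI[of _ ?N] exI[of _ ?G] exI[of _ "\<lambda>x. x"]) simp
qed

end
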